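(* For $m>0$ let $A_m$ be the imaginary Airy-Dirac operator in $L^2(\mathbb{R},\mathbb{C}^2)$ $$A_m=-i\partial_x\sigma_1+m\sigma_3+ixI_2,\qquad \mathrm{Dom}(A_m)=H^1(\mathbb{R},\mathbb{C}^2)\cap\mathrm{Dom}(xI_2).$$ Let $R>0$ be fixed and let $\lambda\in[-R,R]$. Then the following claims hold. (i) If $m\to0+$, then $$\|(A_m-\lambda)^{-1}\|=\frac{\exp(\lambda^2)}{m}\left(1+\mathcal{O}(m)\right),$$ where the remainder estimate is uniform for $\lambda\in[-R,R]$. (ii) If $m\in[m_1,m_2]$ for some fixed $m_2>m_1>0$, then $\|(A_m-\lambda)^{-1}\|\approx1$. (iii) If $m\to+\infty$, then $$\|(A_m-\lambda)^{-1}\|=\frac1m\left(1+\mathcal{O}(m^{-1})\right).$$ In particular, $$\|(A_m-\lambda)^{-1}\|\approx\frac1m,\qquad m>0.$$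
   Context: $\sigma_1=\begin{pmatrix}0&1\\1&0\end{pmatrix}$, $\sigma_3=\begin{pmatrix}1&0\\0&-1\end{pmatrix}$, $I_2$ is the $2\times2$ identity matrix, so $A_mu=\big((m+ix)u_1-iu_2',\,-iu_1'+(-m+ix)u_2\big)^t$ for $u=(u_1,u_2)^t$. $\mathrm{Dom}(xI_2)=\{u\in L^2(\mathbb{R},\mathbb{C}^2):xu\in L^2(\mathbb{R},\mathbb{C}^2)\}$. $\|\cdot\|$ is the operator norm on $L^2(\mathbb{R},\mathbb{C}^2)$. $a\approx b$ means $C^{-1}b\le a\le Cb$ with a constant $C>0$ independent of $\lambda\in[-R,R]$ and of $m$ in the indicated range ($C$ may depend on $R$, and in (ii) on $m_1,m_2$). *)

theory Defs
  imports "HOL-Analysis.Analysis"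
begin

section \<open>The Hilbert space $L^2(R, C^2)$\<close>

definition square_integrable :: "(real \<Rightarrow> complex^2) \<Rightarrow> bool" where
  "square_integrable u \<longleftrightarrow>
     u \<in> borel_measurable lborel \<and> integrable lborel (\<lambda>x. (norm (u x))\<^sup>2)"

lemma square_integrable_zero: "square_integrable (\<lambda>x. 0)"
  by (simp add: square_integrable_def)

lemma square_integrable_add:
  assumes "square_integrable u" "square_integrable v"
  shows "square_integrable (\<lambda>x. u x + v x)"
proof -
  have m: "u \<in> borel_measurable lborel" "v \<in> borel_measurable lborel"
    and i: "integrable lborel (\<lambda>x. (norm (u x))\<^sup>2)" "integrable lborel (\<lambda>x. (norm (v x))\<^sup>2)"
    using assms by (auto simp: square_integrable_def)
  have "integrable lborel (\<lambda>x. 2 * (norm (u x))\<^sup>2 + 2 * (norm (v x))\<^sup>2)"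
    using i by simp
  then have "integrable lborel (\<lambda>x. (norm (u x + v x))\<^sup>2)"
  proof (rule Bochner_Integration.integrable_bound)
    show "(\<lambda>x. (norm (u x + v x))\<^sup>2) \<in> borel_measurable lborel"
      using m by measurable
    have "(norm (a + b))\<^sup>2 \<le> 2 * (norm a)\<^sup>2 + 2 * (norm b)\<^sup>2" for a b :: "complex^2"
    proof -
      have "(norm (a + b))\<^sup>2 \<le> (norm a + norm b)\<^sup>2"
        by (intro power_mono norm_triangle_ineq) simp
      also have "\<dots> \<le> 2 * (norm a)\<^sup>2 + 2 * (norm b)\<^sup>2"
        using sum_squares_bound[of "norm a" "norm b"] by (simp add: power2_sum)
      finally show ?thesis .
    qed
    then show "AE x in lborel. norm ((norm (u x + v x))\<^sup>2)
                 \<le> norm (2 * (norm (u x))\<^sup>2 + 2 * (norm (v x))\<^sup>2)"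
      by (intro AE_I2) simp
  qed
  with m show ?thesis by (simp add: square_integrable_def)
qed

lemma square_integrable_scaleR:
  assumes "square_integrable u"
  shows "square_integrable (\<lambda>x. c *\<^sub>R u x)"
  using assms by (auto simp: square_integrable_def power_mult_distrib)

lemma square_integrable_inner:
  assumes "square_integrable u" "square_integrable v"
  shows "integrable lborel (\<lambda>x. u x \<bullet> v x)"
proof -
  have m: "u \<in> borel_measurable lborel" "v \<in> borel_measurable lborel"
    and i: "integrable lborel (\<lambda>x. (norm (u x))\<^sup>2)" "integrable lborel (\<lambda>x. (norm (v x))\<^sup>2)"
    using assms by (auto simp: square_integrable_def)
  have "integrable lborel (\<lambda>x. (norm (u x))\<^sup>2 + (norm (v x))\<^sup>2)"
    using i by simp
  then show ?thesis
  proof (rule Bochner_Integration.integrable_bound)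
    show "(\<lambda>x. u x \<bullet> v x) \<in> borel_measurable lborel"
      using m by measurable
    have "\<bar>a \<bullet> b\<bar> \<le> (norm a)\<^sup>2 + (norm b)\<^sup>2" for a b :: "complex^2"
    proof -
      have "\<bar>a \<bullet> b\<bar> \<le> norm a * norm b" by (rule Cauchy_Schwarz_ineq2)
      moreover have "0 \<le> norm a * norm b" by simp
      ultimately show ?thesis using sum_squares_bound[of "norm a" "norm b"] by linarith
    qed
    then show "AE x in lborel. norm (u x \<bullet> v x) \<le> norm ((norm (u x))\<^sup>2 + (norm (v x))\<^sup>2)"
      by (intro AE_I2) simp
  qed
qed

quotient_type L2 = "real \<Rightarrow> complex^2" /
  partial: "\<lambda>u v. square_integrable u \<and> square_integrable v \<and> (AE x in lborel. u x = v x)"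
proof (rule part_equivpI)
  show "\<exists>u. square_integrable u \<and> square_integrable u \<and> (AE x in lborel. u x = u x)"
    using square_integrable_zero by auto
  show "symp (\<lambda>u v. square_integrable u \<and> square_integrable v \<and> (AE x in lborel. u x = v x))"
    by (auto simp: symp_def elim: AE_mp)
  show "transp (\<lambda>u v. square_integrable u \<and> square_integrable v \<and> (AE x in lborel. u x = v x))"
    by (auto simp: transp_def elim: eventually_elim2)
qed

instantiation L2 :: real_vector
begin

lift_definition zero_L2 :: L2 is "\<lambda>x. 0"
  by (simp add: square_integrable_zero)

lift_definition plus_L2 :: "L2 \<Rightarrow> L2 \<Rightarrow> L2" is "\<lambda>u v x. u x + v x"
  by (auto intro: square_integrable_add elim: eventually_elim2)

lift_definition scaleR_L2 :: "real \<Rightarrow> L2 \<Rightarrow> L2" is "\<lambda>c u x. c *\<^sub>R u x"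
  by (auto intro: square_integrable_scaleR elim: eventually_mono)

definition uminus_L2 :: "L2 \<Rightarrow> L2" where "uminus_L2 U = (-1) *\<^sub>R U"

definition minus_L2 :: "L2 \<Rightarrow> L2 \<Rightarrow> L2" where "minus_L2 U V = U + (- V)"

instance
proof
  fix a b :: real and U V W :: L2
  show "U + V + W = U + (V + W)"
    by transfer (auto simp: algebra_simps intro!: square_integrable_add)
  show "U + V = V + U"
    by transfer (auto simp: algebra_simps intro!: square_integrable_add)
  show "0 + U = U"
    by transfer auto
  show "- U + U = 0"
    unfolding uminus_L2_def
    by transfer (auto simp: square_integrable_zero)
  show "U - V = U + - V"
    by (simp add: minus_L2_def)
  show "a *\<^sub>R (U + V) = a *\<^sub>R U + a *\<^sub>R V"
    by transfer (auto simp: algebra_simps intro!: square_integrable_add square_integrable_scaleR)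
  show "(a + b) *\<^sub>R U = a *\<^sub>R U + b *\<^sub>R U"
    by transfer (auto simp: algebra_simps intro!: square_integrable_add square_integrable_scaleR)
  show "a *\<^sub>R b *\<^sub>R U = (a * b) *\<^sub>R U"
    by transfer (auto intro!: square_integrable_scaleR)
  show "1 *\<^sub>R U = U"
    by transfer auto
qed

end

text \<open>
  The class \<^class>\<open>real_inner\<close> asks for a real inner product; on \<^typ>\<open>complex^2\<close> it is the
  real part of the Hermitian one, so that the norm below is the usual norm of $L^2(R, C^2)$.
\<close>

instantiation L2 :: real_inner
begin

lift_definition inner_L2 :: "L2 \<Rightarrow> L2 \<Rightarrow> real" is "\<lambda>u v. \<integral>x. u x \<bullet> v x \<partial>lborel"
proof -
  fix u u' v v' :: "real \<Rightarrow> complex^2"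
  assume u: "square_integrable u \<and> square_integrable u' \<and> (AE x in lborel. u x = u' x)"
    and v: "square_integrable v \<and> square_integrable v' \<and> (AE x in lborel. v x = v' x)"
  show "(\<integral>x. u x \<bullet> v x \<partial>lborel) = (\<integral>x. u' x \<bullet> v' x \<partial>lborel)"
  proof (rule integral_cong_AE)
    show "(\<lambda>x. u x \<bullet> v x) \<in> borel_measurable lborel"
      "(\<lambda>x. u' x \<bullet> v' x) \<in> borel_measurable lborel"
      using u v square_integrable_inner[THEN borel_measurable_integrable] by blast+
    show "AE x in lborel. u x \<bullet> v x = u' x \<bullet> v' x"
      using u v by (auto elim: eventually_elim2)
  qed
qed

definition norm_L2 :: "L2 \<Rightarrow> real" where "norm_L2 U = sqrt (inner U U)"

definition sgn_L2 :: "L2 \<Rightarrow> L2" where "sgn_L2 U = U /\<^sub>R norm U"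

definition dist_L2 :: "L2 \<Rightarrow> L2 \<Rightarrow> real" where "dist_L2 U V = norm (U - V)"

definition uniformity_L2 :: "(L2 \<times> L2) filter" where
  "uniformity_L2 = (INF e\<in>{0<..}. principal {(U, V). dist U V < e})"

definition open_L2 :: "L2 set \<Rightarrow> bool" where
  "open_L2 S = (\<forall>U\<in>S. \<forall>\<^sub>F (U', V) in uniformity. U' = U \<longrightarrow> V \<in> S)"

instance
proof
  fix a :: real and U V W :: L2 and S :: "L2 set"
  show "inner U V = inner V U"
    by transfer (simp add: inner_commute)
  show "inner (U + V) W = inner U W + inner V W"
    by transfer (auto simp: inner_add_left square_integrable_inner)
  show "inner (a *\<^sub>R U) V = a * inner U V"
    by transfer simp
  show "0 \<le> inner U U"
    by transfer simp
  show "inner U U = 0 \<longleftrightarrow> U = 0"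
  proof transfer
    fix u :: "real \<Rightarrow> complex^2"
    assume "square_integrable u \<and> square_integrable u \<and> (AE x in lborel. u x = u x)"
    then have u: "square_integrable u" by simp
    have "(\<integral>x. u x \<bullet> u x \<partial>lborel) = 0 \<longleftrightarrow> (AE x in lborel. u x \<bullet> u x = 0)"
      by (rule integral_nonneg_eq_0_iff_AE) (auto intro: square_integrable_inner u)
    with u show "(\<integral>x. u x \<bullet> u x \<partial>lborel) = 0 \<longleftrightarrow>
        square_integrable u \<and> square_integrable (\<lambda>x. 0) \<and> (AE x in lborel. u x = 0)"
      by (simp add: square_integrable_zero)
  qed
  show "norm U = sqrt (inner U U)"
    by (simp add: norm_L2_def)
  show "sgn U = U /\<^sub>R norm U"
    by (simp add: sgn_L2_def)
  show "dist U V = norm (U - V)"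
    by (simp add: dist_L2_def)
  show "(uniformity :: (L2 \<times> L2) filter) = (INF e\<in>{0<..}. principal {(U, V). dist U V < e})"
    by (simp add: uniformity_L2_def)
  show "open S = (\<forall>U\<in>S. \<forall>\<^sub>F (U', V) in uniformity. U' = U \<longrightarrow> V \<in> S)"
    by (simp add: open_L2_def)
qed

end

lemma square_integrable_rep_L2: "square_integrable (rep_L2 U)"
  using Quotient3_rep_reflp[OF Quotient3_L2, of U] by simp

lemma abs_rep_L2: "abs_L2 (rep_L2 U) = U"
  by (rule Quotient3_abs_rep[OF Quotient3_L2])

lemma rep_abs_L2:
  assumes "square_integrable u"
  shows "AE x in lborel. rep_L2 (abs_L2 u) x = u x"
  using rep_abs_rsp_left[OF Quotient3_L2, of u u] assms by simp

lemma norm_L2_eq: "norm U = sqrt (\<integral>x. (norm (rep_L2 U x))\<^sup>2 \<partial>lborel)"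
  by (simp add: norm_L2_def inner_L2.rep_eq dot_square_norm)


section \<open>The Sobolev space $H^1(R, C^2)$\<close>

definition test_function :: "(real \<Rightarrow> real) \<Rightarrow> bool" where
  "test_function \<phi> \<longleftrightarrow>
     (\<forall>n x. (deriv ^^ n) \<phi> differentiable at x) \<and> compact (closure {x. \<phi> x \<noteq> 0})"

text \<open>
  Real-valued test functions suffice, since the defining identity is linear in the test function.
\<close>

definition has_weak_deriv :: "L2 \<Rightarrow> L2 \<Rightarrow> bool" where
  "has_weak_deriv U V \<longleftrightarrow>
     (\<forall>\<phi>. test_function \<phi> \<longrightarrow>
        (\<integral>x. deriv \<phi> x *\<^sub>R rep_L2 U x \<partial>lborel) = - (\<integral>x. \<phi> x *\<^sub>R rep_L2 V x \<partial>lborel))"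

definition H1 :: "L2 set" where
  "H1 = {U. \<exists>V. has_weak_deriv U V}"

text \<open>Weak derivatives are unique as elements of \<^typ>\<open>L2\<close>; the value outside
  \<^const>\<open>H1\<close> is never used.\<close>

definition weak_deriv :: "L2 \<Rightarrow> L2" where
  "weak_deriv U = (THE V. has_weak_deriv U V)"


section \<open>The imaginary Airy-Dirac operator\<close>

definition sigma1 :: "complex^2^2" where
  "sigma1 = vector [vector [0, 1], vector [1, 0]]"

definition sigma3 :: "complex^2^2" where
  "sigma3 = vector [vector [1, 0], vector [0, -1]]"

lemma sigma1_mult: "sigma1 *v w = vector [w $ 2, w $ 1]"
  by (simp add: sigma1_def matrix_vector_mult_def vec_eq_iff forall_2 sum_2)

lemma sigma3_mult: "sigma3 *v w = vector [w $ 1, - w $ 2]"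
  by (simp add: sigma3_def matrix_vector_mult_def vec_eq_iff forall_2 sum_2)

definition dom_x :: "L2 set" where
  "dom_x = {U. square_integrable (\<lambda>x. x *\<^sub>R rep_L2 U x)}"

definition dom_airy_dirac :: "L2 set" where
  "dom_airy_dirac = H1 \<inter> dom_x"

text \<open>Only meaningful on \<^const>\<open>dom_airy_dirac\<close>, where the function inside \<^const>\<open>abs_L2\<close>
  is square integrable.\<close>

definition airy_dirac :: "real \<Rightarrow> L2 \<Rightarrow> L2" where
  "airy_dirac m U = abs_L2 (\<lambda>x.
     (- \<i>) *s (sigma1 *v rep_L2 (weak_deriv U) x)
     + complex_of_real m *s (sigma3 *v rep_L2 U x)
     + (\<i> * complex_of_real x) *s rep_L2 U x)"


section \<open>Inverses of unbounded operators\<close>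

text \<open>An unbounded operator is given by a map \<open>T\<close> together with its domain \<open>D\<close>.\<close>

definition boundedly_invertible ::
  "'a::real_normed_vector set \<Rightarrow> ('a \<Rightarrow> 'a) \<Rightarrow> bool" where
  "boundedly_invertible D T \<longleftrightarrow> bij_betw T D UNIV \<and> bounded_linear (inv_into D T)"

definition airy_dirac_shift :: "real \<Rightarrow> real \<Rightarrow> L2 \<Rightarrow> L2" where
  "airy_dirac_shift m l U = airy_dirac m U - l *\<^sub>R U"

definition resolvent_norm :: "real \<Rightarrow> real \<Rightarrow> real" where
  "resolvent_norm m l = onorm (inv_into dom_airy_dirac (airy_dirac_shift m l))"

end

theory Submission
  imports Defs "HOL-Probability.Probability"
begin

text \<open>
  Put \<open>v = u\<^sub>1 + u\<^sub>2\<close>, \<open>w = u\<^sub>1 - u\<^sub>2\<close> and \<open>D\<^sub>\<plusminus> = d/dx \<plusminus> (x + i l)\<close>. Then \<open>A\<^sub>m - l\<close> maps \<open>(v, w)\<close> to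
  \<open>(g, h) = (- i D\<^sub>- v + m w, i D\<^sub>+ w + m v)\<close>, and integration by parts gives
  \<open>\<parallel>(g, h)\<parallel>\<^sup>2 \<ge> (m\<^sup>2 - 2 m \<bar>l\<bar>) \<parallel>(v, w)\<parallel>\<^sup>2\<close>, which settles large \<open>m\<close>. The relation
  \<open>D\<^sub>+ D\<^sub>- = D\<^sub>- D\<^sub>+ - 2\<close> turns a bound for \<open>sqrt (m\<^sup>2 + 2)\<close> into a bound for \<open>m\<close>; iterating downwards gives a bound
  that is uniform for \<open>m \<ge> a\<close>, for every \<open>a > 0\<close>. Such a bound implies surjectivity: the range is closed, and a
  function orthogonal to it yields, after conjugation and exchange of the components, a weak solution of the
  homogeneous equation, which lies in the domain and hence vanishes.

  For small \<open>m\<close> the resolvent is governed by the kernel of \<open>D\<^sub>+\<close>, spanned by \<open>\<phi> = exp (- (x + i l)\<^sup>2 / 2)\<close>.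
  Pairing the first equation with \<open>\<phi>\<close>, which removes \<open>v\<close>, determines the component of \<open>w\<close> along \<open>\<phi>\<close>, and the factor
  \<open>exp (l\<^sup>2)\<close> is the quotient of \<open>\<integral> \<bar>\<phi>\<bar>\<^sup>2 = exp (l\<^sup>2) sqrt \<pi>\<close> by \<open>\<integral> \<phi>\<^sup>2 = sqrt \<pi>\<close>. Finally \<open>(0, \<phi>)\<close> is mapped to \<open>(m \<phi>, 0)\<close>,
  so the resolvent norm is at least \<open>1 / m\<close> for all \<open>m\<close>.
\<close>

section \<open>Square integrable functions\<close>

text \<open>The obstacle is non-self-adjointness: the Hermitian adjoint of \<open>D\<^sub>-\<close>
  is \<open>- D\<^sub>+\<close> with \<open>- l\<close> in place of \<open>l\<close>, so the cross
  terms of the squared norm do not cancel and coercivity is lost once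
  \<open>m \<le> 2 \<bar>l\<bar>\<close>. The bilinear pairing without conjugation keeps
  \<open>l\<close>: for it the transpose of \<open>D\<^sub>-\<close> is \<open>- D\<^sub>+\<close>
  with the same \<open>l\<close>.

  Eliminating \<open>w\<close> leaves \<open>m\<^sup>2 - D\<^sub>+ D\<^sub>-\<close>, which by the
  commutation relation is \<open>(m\<^sup>2 + 2) - D\<^sub>- D\<^sub>+\<close>, the result of
  eliminating the other component at mass \<open>sqrt (m\<^sup>2 + 2)\<close>. Each step adds 2 to
  the squared mass, so a number of steps depending only on \<open>R\<close> and \<open>a\<close>
  reaches the coercive range. Every step worsens the constant and recovering \<open>w\<close>
  divides by \<open>m\<close>, so sharp constants for small \<open>m\<close> need a separate
  argument.

  There the coefficient \<open>c\<close> of \<open>\<phi>\<close> in \<open>w\<close> satisfies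
  \<open>m c sqrt \<pi> = \<integral> g \<phi>\<close> up to a small error. The leading part of the
  inverse thus has rank one, with \<open>\<phi>\<close> both as functional and as vector; this is
  why the squared norm of \<open>\<phi>\<close> stands in the numerator.\<close>

definition in_l2 :: "(real \<Rightarrow> complex) \<Rightarrow> bool" where
  "in_l2 f \<longleftrightarrow> f \<in> borel_measurable lborel \<and> integrable lborel (\<lambda>x. (norm (f x))\<^sup>2)"

definition l2norm :: "(real \<Rightarrow> complex) \<Rightarrow> real" where
  "l2norm f = sqrt (\<integral>x. (norm (f x))\<^sup>2 \<partial>lborel)"

definition pairing :: "(real \<Rightarrow> complex) \<Rightarrow> (real \<Rightarrow> complex) \<Rightarrow> complex" where
  "pairing f g = (\<integral>x. f x * g x \<partial>lborel)"

lemma norm_complex2: "(norm (u :: complex^2))\<^sup>2 = (norm (u $ 1))\<^sup>2 + (norm (u $ 2))\<^sup>2"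
  by (simp add: norm_vec_def L2_set_def sum_2)

lemma inner_complex2: "(u :: complex^2) \<bullet> v = Re (u $ 1 * cnj (v $ 1)) + Re (u $ 2 * cnj (v $ 2))"
  by (simp add: inner_vec_def sum_2 inner_complex_def)

lemma measurable_vec_nth [measurable]: "(\<lambda>u. u $ i) \<in> borel_measurable (borel :: (complex^2) measure)"
  by (intro borel_measurable_continuous_onI continuous_intros)

lemma measurable_vector2 [measurable]:
  assumes [measurable]: "f \<in> borel_measurable lborel" "g \<in> borel_measurable lborel"
  shows "(\<lambda>x. vector [f x, g x] :: complex^2) \<in> borel_measurable lborel"
proof (subst borel_measurable_euclidean_space, intro ballI)
  fix i :: "complex^2"
  assume "i \<in> Basis"
  then obtain k b where "i = axis k b" by (auto simp: Basis_vec_def)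
  moreover have "(\<lambda>x. (vector [f x, g x] :: complex^2) $ k) \<in> borel_measurable lborel"
    using exhaust_2[of k] assms by (auto simp del: measurable_lborel1)
  ultimately show "(\<lambda>x. (vector [f x, g x] :: complex^2) \<bullet> i) \<in> borel_measurable lborel"
    by (simp add: inner_axis borel_measurable_inner)
qed

lemma square_integrable_iff:
  "square_integrable u \<longleftrightarrow> in_l2 (\<lambda>x. u x $ 1) \<and> in_l2 (\<lambda>x. u x $ 2)"
proof
  assume u: "square_integrable u"
  then have [measurable]: "u \<in> borel_measurable lborel"
    and i: "integrable lborel (\<lambda>x. (norm (u x))\<^sup>2)"
    by (auto simp: square_integrable_def)
  have "in_l2 (\<lambda>x. u x $ k)" for k :: 2
    unfolding in_l2_def
  proof (intro conjI)
    show "(\<lambda>x. u x $ k) \<in> borel_measurable lborel" by measurable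
    show "integrable lborel (\<lambda>x. (norm (u x $ k))\<^sup>2)"
      by (rule Bochner_Integration.integrable_bound[OF i])
        (auto intro!: AE_I2 power_mono Finite_Cartesian_Product.norm_nth_le)
  qed
  then show "in_l2 (\<lambda>x. u x $ 1) \<and> in_l2 (\<lambda>x. u x $ 2)" by blast
next
  assume a: "in_l2 (\<lambda>x. u x $ 1) \<and> in_l2 (\<lambda>x. u x $ 2)"
  then have "(\<lambda>x. vector [u x $ 1, u x $ 2] :: complex^2) \<in> borel_measurable lborel"
    by (intro measurable_vector2) (auto simp: in_l2_def)
  moreover have "(\<lambda>x. vector [u x $ 1, u x $ 2]) = u"
    by (auto simp: vec_eq_iff forall_2)
  ultimately show "square_integrable u"
    using a by (auto simp: square_integrable_def in_l2_def norm_complex2)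
qed

lemma inner_abs_L2:
  "square_integrable u \<Longrightarrow> square_integrable v \<Longrightarrow>
    inner (abs_L2 u) (abs_L2 v) = (\<integral>x. u x \<bullet> v x \<partial>lborel)"
  by (simp add: inner_L2.abs_eq)

lemma norm_abs_L2:
  assumes "square_integrable u"
  shows "(norm (abs_L2 u))\<^sup>2 = (l2norm (\<lambda>x. u x $ 1))\<^sup>2 + (l2norm (\<lambda>x. u x $ 2))\<^sup>2"
proof -
  have "(norm (abs_L2 u))\<^sup>2 = (\<integral>x. (norm (u x))\<^sup>2 \<partial>lborel)"
    using assms by (simp only: power2_norm_eq_inner inner_abs_L2)
  also have "\<dots> = (\<integral>x. (norm (u x $ 1))\<^sup>2 \<partial>lborel) + (\<integral>x. (norm (u x $ 2))\<^sup>2 \<partial>lborel)"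
    using assms by (simp add: norm_complex2 square_integrable_iff in_l2_def)
  finally show ?thesis by (simp add: l2norm_def)
qed

lemma abs_L2_eq_iff:
  assumes "square_integrable u" "square_integrable v"
  shows "abs_L2 u = abs_L2 v \<longleftrightarrow> (AE x in lborel. u x = v x)"
  using Quotient3_rel[OF Quotient3_L2, of u v] by (simp only: assms simp_thms eventually_True)

text \<open>Embedding scalar functions into \<^typ>\<open>L2\<close> gives the triangle and Cauchy--Schwarz
  inequalities for \<^const>\<open>l2norm\<close>.\<close>

definition scalar_L2 :: "(real \<Rightarrow> complex) \<Rightarrow> L2" where
  "scalar_L2 f = abs_L2 (\<lambda>x. vector [f x, 0])"

lemma in_l2_zero [simp]: "in_l2 (\<lambda>x. 0)"
  by (simp add: in_l2_def)

lemma square_integrable_scalar: "in_l2 f \<Longrightarrow> square_integrable (\<lambda>x. vector [f x, 0])"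
  by (simp add: square_integrable_iff)

lemma norm_scalar_L2:
  assumes "in_l2 f" shows "norm (scalar_L2 f) = l2norm f"
proof -
  have "(norm (scalar_L2 f))\<^sup>2 = (l2norm f)\<^sup>2"
    using norm_abs_L2[OF square_integrable_scalar, OF assms]
    by (simp add: scalar_L2_def l2norm_def[of "\<lambda>x. 0"])
  moreover have "0 \<le> l2norm f" by (simp add: l2norm_def)
  ultimately show ?thesis by simp
qed

lemma in_l2_measurable: "in_l2 f \<Longrightarrow> f \<in> borel_measurable lborel"
  by (simp add: in_l2_def)

lemma in_l2_add [intro]:
  assumes "in_l2 f" "in_l2 g" shows "in_l2 (\<lambda>x. f x + g x)"
  using square_integrable_add[OF assms[THEN square_integrable_scalar]]
  by (simp add: square_integrable_iff)

lemma in_l2_cmult [intro]: "in_l2 f \<Longrightarrow> in_l2 (\<lambda>x. c * f x)"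
  unfolding in_l2_def by (auto simp: norm_mult power_mult_distrib simp del: measurable_lborel1)

lemma in_l2_uminus [intro]: "in_l2 f \<Longrightarrow> in_l2 (\<lambda>x. - f x)"
  by (simp add: in_l2_def)

lemma in_l2_diff [intro]: "in_l2 f \<Longrightarrow> in_l2 g \<Longrightarrow> in_l2 (\<lambda>x. f x - g x)"
  using in_l2_add[of f "\<lambda>x. - g x"] by auto

lemma in_l2_cnj [intro]:
  assumes "in_l2 f" shows "in_l2 (\<lambda>x. cnj (f x))"
proof -
  have "cnj \<in> borel_measurable borel"
    by (intro borel_measurable_continuous_onI continuous_intros)
  then have "(\<lambda>x. cnj (f x)) \<in> borel_measurable lborel"
    using assms measurable_compose in_l2_def by blast
  then show ?thesis
    using assms by (simp add: in_l2_def)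
qed

lemma in_l2_norm: "in_l2 f \<Longrightarrow> in_l2 (\<lambda>x. of_real (norm (f x)))"
  unfolding in_l2_def by (auto simp del: measurable_lborel1)

lemma in_l2_bound:
  assumes "in_l2 f" "g \<in> borel_measurable lborel" "AE x in lborel. norm (g x) \<le> norm (f x)"
  shows "in_l2 g"
  unfolding in_l2_def
proof (intro conjI)
  show "integrable lborel (\<lambda>x. (norm (g x))\<^sup>2)"
  proof (rule Bochner_Integration.integrable_bound)
    show "integrable lborel (\<lambda>x. (norm (f x))\<^sup>2)"
      using assms by (simp add: in_l2_def)
    show "(\<lambda>x. (norm (g x))\<^sup>2) \<in> borel_measurable lborel"
      using assms(2) by measurable
    show "AE x in lborel. norm ((norm (g x))\<^sup>2) \<le> norm ((norm (f x))\<^sup>2)"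
      using assms(3) by eventually_elim (auto intro: power_mono)
  qed
qed (rule assms)

lemma l2norm_nonneg [simp]: "0 \<le> l2norm f"
  by (simp add: l2norm_def)

lemma l2norm_power2: "(l2norm f)\<^sup>2 = (\<integral>x. (norm (f x))\<^sup>2 \<partial>lborel)"
  by (simp add: l2norm_def)

lemma l2norm_norm: "l2norm (\<lambda>x. of_real (norm (f x))) = l2norm f"
  by (simp add: l2norm_def)

lemma l2norm_cmult [simp]: "l2norm (\<lambda>x. c * f x) = norm c * l2norm f"
  by (simp add: l2norm_def norm_mult power_mult_distrib real_sqrt_mult)

lemma l2norm_uminus [simp]: "l2norm (\<lambda>x. - f x) = l2norm f"
  by (simp add: l2norm_def)

lemma l2norm_cnj [simp]: "l2norm (\<lambda>x. cnj (f x)) = l2norm f"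
  by (simp add: l2norm_def)

lemma l2norm_triangle:
  assumes "in_l2 f" "in_l2 g"
  shows "l2norm (\<lambda>x. f x + g x) \<le> l2norm f + l2norm g"
proof -
  have "scalar_L2 (\<lambda>x. f x + g x) = scalar_L2 f + scalar_L2 g"
  proof -
    have "(\<lambda>x. vector [f x + g x, 0] :: complex^2) = (\<lambda>x. vector [f x, 0] + vector [g x, 0])"
      by (auto simp: vec_eq_iff forall_2)
    then show ?thesis
      using assms[THEN square_integrable_scalar] by (simp add: scalar_L2_def plus_L2.abs_eq)
  qed
  then show ?thesis
    using norm_triangle_ineq[of "scalar_L2 f" "scalar_L2 g"] assms
      norm_scalar_L2[OF in_l2_add[OF assms]]
    by (simp add: norm_scalar_L2)
qed

lemma l2norm_diff_triangle:
  assumes "in_l2 f" "in_l2 g"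
  shows "l2norm (\<lambda>x. f x - g x) \<le> l2norm f + l2norm g"
  using l2norm_triangle[OF assms(1) in_l2_uminus[OF assms(2)]] by simp

lemma l2norm_cong_AE:
  assumes "in_l2 f" "in_l2 g" "AE x in lborel. f x = g x"
  shows "l2norm f = l2norm g"
proof -
  have "(\<integral>x. (norm (f x))\<^sup>2 \<partial>lborel) = (\<integral>x. (norm (g x))\<^sup>2 \<partial>lborel)"
    using assms by (intro integral_cong_AE) (auto simp: in_l2_def)
  then show ?thesis by (simp add: l2norm_def)
qed

lemma integrable_mult_l2:
  assumes "in_l2 f" "in_l2 g"
  shows "integrable lborel (\<lambda>x. f x * g x)"
proof (rule Bochner_Integration.integrable_bound)
  show "integrable lborel (\<lambda>x. (norm (f x))\<^sup>2 + (norm (g x))\<^sup>2)"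
    using assms by (auto simp: in_l2_def)
  show "(\<lambda>x. f x * g x) \<in> borel_measurable lborel"
    using assms by (auto simp: in_l2_def)
  have "a * b \<le> a\<^sup>2 + b\<^sup>2" if "a \<ge> 0" "b \<ge> 0" for a b :: real
    using sum_squares_bound[of a b] mult_nonneg_nonneg[OF that] by linarith
  then show "AE x in lborel. norm (f x * g x) \<le> norm ((norm (f x))\<^sup>2 + (norm (g x))\<^sup>2)"
    by (auto simp: norm_mult)
qed

lemma pairing_bound:
  assumes "in_l2 f" "in_l2 g"
  shows "norm (pairing f g) \<le> l2norm f * l2norm g"
proof -
  let ?f = "\<lambda>x. of_real (norm (f x)) :: complex" and ?g = "\<lambda>x. of_real (norm (g x)) :: complex"
  have "norm (pairing f g) \<le> (\<integral>x. norm (f x * g x) \<partial>lborel)"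
    unfolding pairing_def by (rule integral_norm_bound)
  also have "\<dots> = inner (scalar_L2 ?f) (scalar_L2 ?g)"
    using assms
    by (simp add: scalar_L2_def inner_abs_L2 square_integrable_scalar in_l2_norm inner_complex2 norm_mult
        flip: of_real_mult)
  also have "\<dots> \<le> norm (scalar_L2 ?f) * norm (scalar_L2 ?g)"
    by (rule norm_cauchy_schwarz)
  finally show ?thesis
    using assms by (simp add: norm_scalar_L2 in_l2_norm l2norm_norm)
qed

lemma pairing_add_left: "in_l2 f \<Longrightarrow> in_l2 g \<Longrightarrow> in_l2 h \<Longrightarrow>
  pairing (\<lambda>x. f x + g x) h = pairing f h + pairing g h"
  by (simp add: pairing_def distrib_right integrable_mult_l2)

lemma pairing_diff_left: "in_l2 f \<Longrightarrow> in_l2 g \<Longrightarrow> in_l2 h \<Longrightarrow>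
  pairing (\<lambda>x. f x - g x) h = pairing f h - pairing g h"
  by (simp add: pairing_def left_diff_distrib integrable_mult_l2)

lemma pairing_commute: "pairing f g = pairing g f"
  by (simp add: pairing_def mult.commute)

lemma pairing_add_right: "in_l2 f \<Longrightarrow> in_l2 g \<Longrightarrow> in_l2 h \<Longrightarrow>
  pairing h (\<lambda>x. f x + g x) = pairing h f + pairing h g"
  by (simp add: pairing_def distrib_left integrable_mult_l2)

lemma pairing_diff_right: "in_l2 f \<Longrightarrow> in_l2 g \<Longrightarrow> in_l2 h \<Longrightarrow>
  pairing h (\<lambda>x. f x - g x) = pairing h f - pairing h g"
  by (simp add: pairing_def right_diff_distrib integrable_mult_l2)

lemma pairing_uminus_left [simp]: "pairing (\<lambda>x. - f x) g = - pairing f g"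
  by (simp add: pairing_def)

lemma pairing_uminus_right [simp]: "pairing f (\<lambda>x. - g x) = - pairing f g"
  by (simp add: pairing_def)

lemma pairing_cmult_left [simp]: "pairing (\<lambda>x. c * f x) g = c * pairing f g"
  by (simp add: pairing_def mult.assoc)

lemma pairing_cmult_right [simp]: "pairing f (\<lambda>x. c * g x) = c * pairing f g"
  by (simp add: pairing_def mult.left_commute)

lemma pairing_cnj: "cnj (pairing f g) = pairing (\<lambda>x. cnj (f x)) (\<lambda>x. cnj (g x))"
  unfolding pairing_def by (subst Bochner_Integration.integral_cnj[symmetric]) simp

lemma pairing_cnj_self: "pairing f (\<lambda>x. cnj (f x)) = of_real ((l2norm f)\<^sup>2)"
proof -
  have "pairing f (\<lambda>x. cnj (f x)) = (\<integral>x. of_real ((norm (f x))\<^sup>2) \<partial>lborel)"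
    unfolding pairing_def by (simp only: complex_norm_square)
  also have "\<dots> = of_real ((l2norm f)\<^sup>2)"
    unfolding l2norm_power2 by (rule integral_complex_of_real)
  finally show ?thesis .
qed

lemma pairing_cong_AE:
  assumes "in_l2 f" "in_l2 g" "in_l2 h" "AE x in lborel. f x = g x"
  shows "pairing f h = pairing g h"
  unfolding pairing_def
  using assms by (intro integral_cong_AE) (auto simp: in_l2_def)

section \<open>Absolutely continuous functions\<close>

text \<open>The integrated form of local absolute continuity: \<open>f\<close> is fixed pointwise
  while \<open>f'\<close> matters only up to null sets, which suits derivatives known only as square
  integrable classes.\<close>

definition ac_deriv :: "(real \<Rightarrow> complex) \<Rightarrow> (real \<Rightarrow> complex) \<Rightarrow> bool" where
  "ac_deriv f f' \<longleftrightarrow> f' \<in> borel_measurable lborel \<and>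
     (\<forall>a b. a \<le> b \<longrightarrow> set_integrable lborel {a..b} f' \<and> f b - f a = (LINT x:{a..b}|lborel. f' x))"

lemma ac_derivD:
  assumes "ac_deriv f f'"
  shows "f' \<in> borel_measurable lborel" "set_integrable lborel {a..b} f'"
    "a \<le> b \<Longrightarrow> (LINT x:{a..b}|lborel. f' x) = f b - f a"
proof -
  show "set_integrable lborel {a..b} f'"
    using assms by (cases "a \<le> b") (auto simp: ac_deriv_def set_integrable_def)
qed (use assms in \<open>auto simp: ac_deriv_def\<close>)

lemma ac_deriv_continuous:
  assumes "ac_deriv f f'" shows "continuous_on A f"
proof -
  have "isCont f x" for x
  proof -
    have eq: "f y = f (x - 1) + integral {x - 1..y} f'" if "y \<in> {x - 1..x + 1}" for y
      using ac_derivD(3)[OF assms, of "x - 1" y] that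
        set_borel_integral_eq_integral(2)[OF ac_derivD(2)[OF assms]]
      by (simp add: algebra_simps)
    have "continuous_on {x - 1..x + 1} (\<lambda>y. f (x - 1) + integral {x - 1..y} f')"
      by (intro continuous_intros indefinite_integral_continuous_1
          set_borel_integral_eq_integral(1) ac_derivD(2)[OF assms])
    then have "continuous_on {x - 1..x + 1} f"
      using eq by (rule continuous_on_cong[THEN iffD2, rotated 2, OF _ refl]) 
    then show ?thesis
      by (rule continuous_on_interior) auto
  qed
  then show ?thesis
    by (auto intro: continuous_at_imp_continuous_on)
qed

lemma ac_deriv_measurable:
  "ac_deriv f f' \<Longrightarrow> f \<in> borel_measurable lborel"
  using ac_deriv_continuous[of f f' UNIV] by (simp add: borel_measurable_continuous_onI)

lemma ac_deriv_const: "ac_deriv (\<lambda>x. c) (\<lambda>x. 0)"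
  by (simp add: ac_deriv_def set_integrable_def set_lebesgue_integral_def)

lemma ac_deriv_add:
  assumes "ac_deriv f f'" "ac_deriv g g'"
  shows "ac_deriv (\<lambda>x. f x + g x) (\<lambda>x. f' x + g' x)"
  using assms unfolding ac_deriv_def
  by (auto intro!: set_integral_add simp: set_integral_add(2) algebra_simps simp del: measurable_lborel1)

lemma ac_deriv_cmult:
  assumes "ac_deriv f f'"
  shows "ac_deriv (\<lambda>x. c * f x) (\<lambda>x. c * f' x)"
  using assms unfolding ac_deriv_def
  by (auto simp flip: right_diff_distrib simp del: measurable_lborel1)

lemma ac_deriv_cnj:
  assumes "ac_deriv f f'"
  shows "ac_deriv (\<lambda>x. cnj (f x)) (\<lambda>x. cnj (f' x))"
proof -
  have c: "cnj \<in> borel_measurable borel"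
    by (intro borel_measurable_continuous_onI continuous_intros)
  have e: "(\<lambda>x. indicator {a..b} x *\<^sub>R cnj (f' x)) = (\<lambda>x. cnj (indicator {a..b} x *\<^sub>R f' x))" for a b
    by (auto simp: indicator_def)
  show ?thesis
    unfolding ac_deriv_def
  proof (intro conjI allI impI)
    show "(\<lambda>x. cnj (f' x)) \<in> borel_measurable lborel"
      using measurable_compose[OF ac_derivD(1)[OF assms] c] by simp
    fix a b :: real assume "a \<le> b"
    show "set_integrable lborel {a..b} (\<lambda>x. cnj (f' x))"
      unfolding set_integrable_def e
      by (rule integrable_bounded_linear[OF bounded_linear_cnj ac_derivD(2)[OF assms, unfolded set_integrable_def]])
    show "cnj (f b) - cnj (f a) = (LINT x:{a..b}|lborel. cnj (f' x))"
      using ac_derivD(3)[OF assms \<open>a \<le> b\<close>]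
      unfolding set_lebesgue_integral_def e Bochner_Integration.integral_cnj by simp
  qed
qed

lemma ac_deriv_reflect:
  assumes "ac_deriv f f'"
  shows "ac_deriv (\<lambda>x. f (- x)) (\<lambda>x. - f' (- x))"
  unfolding ac_deriv_def
proof (intro conjI allI impI)
  show "(\<lambda>x. - f' (- x)) \<in> borel_measurable lborel"
    using ac_derivD(1)[OF assms] by simp
  fix a b :: real assume "a \<le> b"
  have e: "indicator {a..b} x *\<^sub>R - f' (- x) = - (indicator {- b..- a} (0 + (-1) * x) *\<^sub>R f' (0 + (-1) * x))" for x
    by (auto simp: indicator_def)
  show "set_integrable lborel {a..b} (\<lambda>x. - f' (- x))"
    unfolding set_integrable_def e
    using lborel_integrable_real_affine[OF ac_derivD(2)[OF assms, of "- b" "- a", unfolded set_integrable_def], of "-1" 0]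
    by simp
  show "f (- b) - f (- a) = (LINT x:{a..b}|lborel. - f' (- x))"
    unfolding set_lebesgue_integral_def e
    using lborel_integral_real_affine[of "-1" "\<lambda>x. indicator {- b..- a} x *\<^sub>R f' x" 0]
      ac_derivD(3)[OF assms, of "- b" "- a"] \<open>a \<le> b\<close>
    by (simp add: set_lebesgue_integral_def algebra_simps)
qed

lemma ac_deriv_C1:
  assumes d: "\<And>x. (f has_vector_derivative f' x) (at x)" and c: "continuous_on UNIV f'"
  shows "ac_deriv f f'"
  unfolding ac_deriv_def
proof (intro conjI allI impI)
  show "f' \<in> borel_measurable lborel"
    using c by (simp add: borel_measurable_continuous_onI)
  fix a b :: real assume ab: "a \<le> b"
  show i: "set_integrable lborel {a..b} f'"
    using c by (intro borel_integrable_atLeastAtMost') (rule continuous_on_subset, auto)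
  have "(f' has_integral f b - f a) {a..b}"
    using ab d by (intro fundamental_theorem_of_calculus) (auto intro: has_vector_derivative_at_within)
  then show "f b - f a = (LINT x:{a..b}|lborel. f' x)"
    using set_borel_integral_eq_integral(2)[OF i] by (simp add: integral_unique)
qed

lemma set_integrable_mult_continuous:
  fixes f g :: "real \<Rightarrow> complex"
  assumes "set_integrable lborel {a..b} f" "continuous_on {a..b} g" "f \<in> borel_measurable lborel"
    "g \<in> borel_measurable lborel"
  shows "set_integrable lborel {a..b} (\<lambda>x. f x * g x)"
proof -
  have "compact (g ` {a..b})"
    using assms(2) by (intro compact_continuous_image) auto
  then obtain B where B: "\<And>x. x \<in> {a..b} \<Longrightarrow> norm (g x) \<le> B"
    by (metis compact_imp_bounded bounded_iff image_eqI)
  show ?thesis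
    unfolding set_integrable_def
  proof (rule Bochner_Integration.integrable_bound)
    show "integrable lborel (\<lambda>x. B *\<^sub>R (indicator {a..b} x *\<^sub>R f x))"
      using assms(1) unfolding set_integrable_def by (rule integrable_scaleR_right)
    show "(\<lambda>x. indicator {a..b} x *\<^sub>R (f x * g x)) \<in> borel_measurable lborel"
      using assms by (auto simp del: measurable_lborel1)
    have "norm (f x) * norm (g x) \<le> \<bar>B\<bar> * norm (f x)" if "x \<in> {a..b}" for x
      using B[OF that] by (subst mult.commute) (intro mult_right_mono, auto)
    then show "AE x in lborel. norm (indicator {a..b} x *\<^sub>R (f x * g x)) \<le> norm (B *\<^sub>R (indicator {a..b} x *\<^sub>R f x))"
      by (auto simp: indicator_def norm_mult)
  qed
qed

text \<open>Fubini on the triangle \<open>a \<le> s \<le> t \<le> b\<close> for \<open>f' s * g' t\<close>.\<close>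

lemma ac_deriv_mult:
  assumes f: "ac_deriv f f'" and g: "ac_deriv g g'"
  shows "ac_deriv (\<lambda>x. f x * g x) (\<lambda>x. f' x * g x + f x * g' x)"
  unfolding ac_deriv_def
proof (intro conjI allI impI)
  note meas [measurable] = ac_derivD(1)[OF f, simplified] ac_derivD(1)[OF g, simplified]
    ac_deriv_measurable[OF f, simplified] ac_deriv_measurable[OF g, simplified]
  show "(\<lambda>x. f' x * g x + f x * g' x) \<in> borel_measurable lborel"
    by measurable
  fix a b :: real assume ab: "a \<le> b"
  have 1: "set_integrable lborel {a..b} (\<lambda>x. f' x * g x)"
    by (intro set_integrable_mult_continuous ac_derivD[OF f] ac_deriv_continuous[OF g]) simp_all
  have "set_integrable lborel {a..b} (\<lambda>x. g' x * f x)"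
    by (intro set_integrable_mult_continuous ac_derivD[OF g] ac_deriv_continuous[OF f]) simp_all
  then have 2: "set_integrable lborel {a..b} (\<lambda>x. f x * g' x)"
    by (simp add: mult.commute)
  from 1 2 show "set_integrable lborel {a..b} (\<lambda>x. f' x * g x + f x * g' x)"
    by (rule set_integral_add)
  define F where "F = (\<lambda>s. indicator {a..b} s *\<^sub>R f' s)"
  define G where "G = (\<lambda>s. indicator {a..b} s *\<^sub>R g' s)"
  define K where "K = (\<lambda>s t. if s \<le> t then F s * G t else 0)"
  have FG: "integrable lborel F" "integrable lborel G"
    using ac_derivD(2)[OF f] ac_derivD(2)[OF g] by (auto simp: F_def G_def set_integrable_def)
  have [measurable]: "F \<in> borel_measurable borel" "G \<in> borel_measurable borel"
    by (auto simp: F_def G_def)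
  have iF: "(\<integral>s. F s \<partial>lborel) = f b - f a" and iG: "(\<integral>s. G s \<partial>lborel) = g b - g a"
    using ac_derivD(3)[OF f ab] ac_derivD(3)[OF g ab]
    by (simp_all add: F_def G_def set_lebesgue_integral_def)
  have Kle: "norm (K s t) \<le> norm (F s) * norm (G t)" for s t
    by (auto simp: K_def norm_mult)
  have mK: "(\<lambda>(s, t). K s t) \<in> borel_measurable (lborel \<Otimes>\<^sub>M lborel)"
    unfolding K_def split_beta by measurable
  have iK: "integrable lborel (K s)" for s
  proof (rule Bochner_Integration.integrable_bound)
    show "integrable lborel (\<lambda>t. F s * G t)" using FG by simp
    show "K s \<in> borel_measurable lborel"
      unfolding K_def by measurable
  qed (auto simp: norm_mult Kle)
  have "integrable (lborel \<Otimes>\<^sub>M lborel) (\<lambda>(s, t). K s t)"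
  proof (rule lborel_pair.Fubini_integrable[OF mK])
    show "integrable lborel (\<lambda>s. \<integral>t. norm (case (s, t) of (s, t) \<Rightarrow> K s t) \<partial>lborel)"
    proof (rule Bochner_Integration.integrable_bound)
      show "integrable lborel (\<lambda>s. norm (F s) * (\<integral>t. norm (G t) \<partial>lborel))" using FG by simp
      show "(\<lambda>s. \<integral>t. norm (case (s, t) of (s, t) \<Rightarrow> K s t) \<partial>lborel) \<in> borel_measurable lborel"
        using mK by (intro lborel.borel_measurable_lebesgue_integral) (simp add: split_beta)
      have "(\<integral>t. norm (K s t) \<partial>lborel) \<le> norm (F s) * (\<integral>t. norm (G t) \<partial>lborel)" for s
      proof -
        have "(\<integral>t. norm (K s t) \<partial>lborel) \<le> (\<integral>t. norm (F s) * norm (G t) \<partial>lborel)"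
          using FG iK Kle by (intro integral_mono) auto
        then show ?thesis by simp
      qed
      then show "AE s in lborel. norm (\<integral>t. norm (case (s, t) of (s, t) \<Rightarrow> K s t) \<partial>lborel)
          \<le> norm (norm (F s) * (\<integral>t. norm (G t) \<partial>lborel))"
        by (auto simp: abs_mult)
    qed
  qed (use iK in auto)
  then have fub: "(\<integral>t. (\<integral>s. K s t \<partial>lborel) \<partial>lborel) = (\<integral>s. (\<integral>t. K s t \<partial>lborel) \<partial>lborel)"
    by (rule lborel_pair.Fubini_integral)
  have "(\<integral>s. K s t \<partial>lborel) = indicator {a..b} t *\<^sub>R (f t * g' t) - f a * G t" for t
  proof (cases "t \<in> {a..b}")
    case True
    then have "K s t = (indicator {a..t} s *\<^sub>R f' s) * g' t" for s
      by (auto simp: K_def F_def G_def indicator_def)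
    then have "(\<integral>s. K s t \<partial>lborel) = (LINT s:{a..t}|lborel. f' s) * g' t"
      by (simp only: integral_mult_left_zero set_lebesgue_integral_def)
    then show ?thesis
      using ac_derivD(3)[OF f, of a t] True by (simp add: G_def left_diff_distrib)
  next
    case False
    then have "G t = 0" by (auto simp: G_def indicator_def)
    with False show ?thesis by (simp add: K_def cong: if_cong)
  qed
  then have l: "(\<integral>t. (\<integral>s. K s t \<partial>lborel) \<partial>lborel) = (LINT t:{a..b}|lborel. f t * g' t) - f a * (g b - g a)"
    using 2 FG(2) iG by (simp add: set_integrable_def set_lebesgue_integral_def)
  have "(\<integral>t. K s t \<partial>lborel) = F s * g b - indicator {a..b} s *\<^sub>R (f' s * g s)" for s
  proof (cases "s \<in> {a..b}")
    case True
    then have "K s t = f' s * (indicator {s..b} t *\<^sub>R g' t)" for t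
      by (auto simp: K_def F_def G_def indicator_def)
    then have "(\<integral>t. K s t \<partial>lborel) = f' s * (LINT t:{s..b}|lborel. g' t)"
      by (simp only: integral_mult_right_zero set_lebesgue_integral_def)
    then show ?thesis
      using ac_derivD(3)[OF g, of s b] True by (simp add: F_def right_diff_distrib)
  next
    case False
    then have "F s = 0" by (auto simp: F_def indicator_def)
    with False show ?thesis by (simp add: K_def cong: if_cong)
  qed
  then have r: "(\<integral>s. (\<integral>t. K s t \<partial>lborel) \<partial>lborel) = (f b - f a) * g b - (LINT s:{a..b}|lborel. f' s * g s)"
    using 1 FG(1) iF by (simp add: set_integrable_def set_lebesgue_integral_def)
  show "f b * g b - f a * g a = (LINT x:{a..b}|lborel. f' x * g x + f x * g' x)"
    using fub l r set_integral_add(2)[OF 1 2] by (simp add: algebra_simps)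
qed

section \<open>Integrals of derivatives over half lines and over the real line\<close>

lemma ac_deriv_tendsto_0_at_top:
  assumes P: "ac_deriv P P'" and i: "integrable lborel P" "integrable lborel P'"
  shows "(P \<longlongrightarrow> 0) at_top"
proof -
  define L where "L = P 0 + (LINT x:{0..}|lborel. P' x)"
  have i0: "integrable lborel (\<lambda>x. indicator {0..} x *\<^sub>R P' x)"
    using i(2) by (rule integrable_mult_indicator[rotated]) simp
  have "((\<lambda>y. \<integral>x. indicator {..y} x *\<^sub>R (indicator {0..} x *\<^sub>R P' x) \<partial>lborel)
      \<longlongrightarrow> (LINT x:{0..}|lborel. P' x)) at_top"
    using tendsto_integral_at_top[OF _ i0] by (simp add: set_lebesgue_integral_def)
  then have "((\<lambda>y. P 0 + (\<integral>x. indicator {..y} x *\<^sub>R (indicator {0..} x *\<^sub>R P' x) \<partial>lborel)) \<longlongrightarrow> L) at_top"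
    unfolding L_def by (intro tendsto_intros)
  moreover have "P 0 + (\<integral>x. indicator {..y} x *\<^sub>R (indicator {0..} x *\<^sub>R P' x) \<partial>lborel) = P y" if "0 \<le> y" for y
  proof -
    have "(\<lambda>x. indicator {..y} x *\<^sub>R (indicator {0..} x *\<^sub>R P' x)) = (\<lambda>x. indicator {0..y} x *\<^sub>R P' x)"
      by (auto simp: indicator_def)
    then show ?thesis
      using ac_derivD(3)[OF P that] by (simp add: set_lebesgue_integral_def)
  qed
  ultimately have lim: "(P \<longlongrightarrow> L) at_top"
    by (rule Lim_transform_eventually[OF _ eventually_at_top_linorderI[of 0]]) 
  \<comment> \<open>A nonzero limit would keep \<open>norm (P x)\<close> above
    \<open>norm L / 2\<close> on a half line of infinite measure, against the integrability of
    \<open>P\<close>.\<close>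
  have "L = 0"
  proof (rule ccontr)
    assume "L \<noteq> 0"
    then have "eventually (\<lambda>x. dist (P x) L < norm L / 2) at_top"
      using lim by (intro tendstoD) auto
    then obtain N where N: "\<And>x. x \<ge> N \<Longrightarrow> dist (P x) L < norm L / 2"
      by (auto simp: eventually_at_top_linorder)
    have "norm L / 2 \<le> norm (P x)" if "x \<ge> N" for x
      using N[OF that] norm_triangle_ineq3[of L "P x"] norm_triangle_ineq2[of L "P x"] by (simp add: dist_norm norm_minus_commute)
    then have "integrable lborel (\<lambda>x. indicator {N..} x *\<^sub>R (norm L / 2))"
      by (intro Bochner_Integration.integrable_bound[OF i(1)]) (auto simp: indicator_def)
    then have "integrable lborel (\<lambda>x. (2 / norm L) *\<^sub>R (indicator {N..} x *\<^sub>R (norm L / 2)))"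
      by (rule integrable_scaleR_right)
    then have "integrable lborel (indicator {N..} :: real \<Rightarrow> real)"
      using \<open>L \<noteq> 0\<close> by simp
    then have "emeasure lborel {N..} < \<infinity>"
      by (simp add: integrable_indicator_iff)
    moreover have "emeasure lborel {N..} \<ge> ennreal (real n)" for n :: nat
      using emeasure_mono[of "{N..N + real n}" "{N..}" lborel] by simp
    ultimately show False
      by (metis ennreal_of_nat_eq_real_of_nat infinity_ennreal_def leD ennreal_Ex_less_of_nat)
  qed
  with lim show ?thesis by simp
qed

lemma integral_ac_deriv_atLeast:
  assumes P: "ac_deriv P P'" and i: "integrable lborel P" "integrable lborel P'"
  shows "(LINT x:{a..}|lborel. P' x) = - P a"
proof -
  have i0: "integrable lborel (\<lambda>x. indicator {a..} x *\<^sub>R P' x)"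
    using i(2) by (rule integrable_mult_indicator[rotated]) simp
  have 1: "((\<lambda>y. \<integral>x. indicator {..y} x *\<^sub>R (indicator {a..} x *\<^sub>R P' x) \<partial>lborel)
      \<longlongrightarrow> (LINT x:{a..}|lborel. P' x)) at_top"
    using tendsto_integral_at_top[OF _ i0] by (simp add: set_lebesgue_integral_def)
  have "((\<lambda>y. P y - P a) \<longlongrightarrow> 0 - P a) at_top"
    by (intro tendsto_intros ac_deriv_tendsto_0_at_top[OF assms])
  moreover have "P y - P a = (\<integral>x. indicator {..y} x *\<^sub>R (indicator {a..} x *\<^sub>R P' x) \<partial>lborel)" if "a \<le> y" for y
  proof -
    have "(\<lambda>x. indicator {..y} x *\<^sub>R (indicator {a..} x *\<^sub>R P' x)) = (\<lambda>x. indicator {a..y} x *\<^sub>R P' x)"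
      by (auto simp: indicator_def)
    then show ?thesis
      using ac_derivD(3)[OF P that] by (simp add: set_lebesgue_integral_def)
  qed
  ultimately have "((\<lambda>y. \<integral>x. indicator {..y} x *\<^sub>R (indicator {a..} x *\<^sub>R P' x) \<partial>lborel) \<longlongrightarrow> 0 - P a) at_top"
    by (rule Lim_transform_eventually[OF _ eventually_at_top_linorderI[of a]])
  with 1 have "(LINT x:{a..}|lborel. P' x) = 0 - P a"
    by (rule tendsto_unique[OF trivial_limit_at_top_linorder])
  then show ?thesis by simp
qed

text \<open>The left half line is reflected onto the right one, and the two boundary values at 0
  cancel. Combined with the product rule this yields integration by parts over the whole line
  without boundary terms.\<close>

lemma integral_ac_deriv:
  assumes P: "ac_deriv P P'" and i: "integrable lborel P" "integrable lborel P'"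
  shows "(\<integral>x. P' x \<partial>lborel) = 0"
proof -
  let ?A = "\<lambda>x. indicator {0..} x *\<^sub>R P' x" and ?B = "\<lambda>x. indicator {0..} x *\<^sub>R - P' (- x)"
  have r: "integrable lborel (\<lambda>x. f (- x))" if "integrable lborel f" for f :: "real \<Rightarrow> complex"
    using lborel_integrable_real_affine[OF that, of "-1" 0] by simp
  have "(LINT x:{0..}|lborel. - P' (- x)) = - P (- 0)"
    using i by (intro integral_ac_deriv_atLeast[OF ac_deriv_reflect[OF P]])
      (auto intro: r)
  then have B: "(\<integral>x. ?B x \<partial>lborel) = - P 0" by (simp add: set_lebesgue_integral_def)
  have A: "(\<integral>x. ?A x \<partial>lborel) = - P 0"
    using integral_ac_deriv_atLeast[OF assms, of 0] by (simp add: set_lebesgue_integral_def)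
  have iA: "integrable lborel ?A"
    using i(2) by (rule integrable_mult_indicator[rotated]) simp
  have iB: "integrable lborel ?B"
    by (rule integrable_mult_indicator) (use r[OF i(2)] in auto)
  have "(\<integral>x. P' x \<partial>lborel) = (\<integral>x. ?A x - ?B (- x) \<partial>lborel)"
  proof (rule integral_cong_AE)
    show "P' \<in> borel_measurable lborel" "(\<lambda>x. ?A x - ?B (- x)) \<in> borel_measurable lborel"
      using ac_derivD(1)[OF P] by auto
    have "AE x in lborel. x \<noteq> (0::real)" by (rule AE_lborel_singleton)
    then show "AE x in lborel. P' x = ?A x - ?B (- x)"
      by eventually_elim (auto simp: indicator_def)
  qed
  also have "\<dots> = (\<integral>x. ?A x \<partial>lborel) - (\<integral>x. ?B (- x) \<partial>lborel)"
    by (rule Bochner_Integration.integral_diff[OF iA r[OF iB]])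
  also have "(\<integral>x. ?B (- x) \<partial>lborel) = (\<integral>x. ?B x \<partial>lborel)"
    using lborel_integral_real_affine[of "-1" ?B 0] by simp
  finally show ?thesis using A B by simp
qed

section \<open>Test functions and weak derivatives\<close>

text \<open>Functions \<open>p (1/x) exp (- 1/x)\<close> with a polynomial \<open>p\<close>, extended by \<open>0\<close> to \<open>x \<le> 0\<close>: this class is closed
  under differentiation, which makes its members smooth.\<close>

definition flat :: "real poly \<Rightarrow> real \<Rightarrow> real" where
  "flat p x = (if x > 0 then poly p (1 / x) * exp (- 1 / x) else 0)"

lemma poly_div_exp_tendsto_0: "((\<lambda>y. poly p y * exp (- y)) \<longlongrightarrow> (0 :: real)) at_top"
proof -
  have "((\<lambda>y. \<Sum>i\<le>degree p. coeff p i * (y ^ i / exp y)) \<longlongrightarrow> (\<Sum>i\<le>degree p. coeff p i * 0)) at_top"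
    by (intro tendsto_intros tendsto_power_div_exp_0)
  then show ?thesis
    by (simp add: poly_altdef exp_minus divide_inverse sum_distrib_right mult.assoc)
qed

lemma flat_tendsto_0: "(flat p \<longlongrightarrow> 0) (at 0)"
proof -
  have "((\<lambda>x. poly p (inverse x) * exp (- inverse x)) \<longlongrightarrow> 0) (at_right (0 :: real))"
    by (rule filterlim_compose[OF poly_div_exp_tendsto_0 filterlim_inverse_at_top_right])
  then have "(flat p \<longlongrightarrow> 0) (at_right 0)"
    by (rule Lim_transform_eventually)
      (auto simp: flat_def eventually_at_filter divide_inverse)
  moreover have "(flat p \<longlongrightarrow> 0) (at_left 0)"
    by (rule tendsto_eventually) (auto simp: flat_def eventually_at_filter)
  ultimately show ?thesis
    by (simp add: filterlim_split_at)
qed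

text \<open>With \<open>t = 1 / x\<close>, differentiating \<open>p t * exp (- t)\<close> in
  \<open>t\<close> gives \<open>(p' - p) t * exp (- t)\<close>, and
  \<open>dt/dx = - t\<^sup>2\<close>; the two leading zero coefficients encode the factor
  \<open>t\<^sup>2\<close>.\<close>

lemma DERIV_flat: "DERIV (flat p) x :> flat (pCons 0 (pCons 0 (p - pderiv p))) x"
proof (cases x "0 :: real" rule: linorder_cases)
  case less
  have "DERIV (\<lambda>x. 0 :: real) x :> 0" by simp
  moreover have "eventually (\<lambda>y. flat p y = 0) (nhds x)"
    using eventually_nhds_in_open[of "{..<0}" x] less by (auto elim!: eventually_mono simp: flat_def)
  ultimately show ?thesis
    using less by (subst DERIV_cong_ev[OF refl _ refl, where g = "\<lambda>x. 0"]) (auto simp: flat_def)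
next
  case equal
  \<comment> \<open>The difference quotient at 0 is itself flat: division by \<open>h\<close> shifts
    the coefficients of \<open>p\<close> by one.\<close>
  have "((\<lambda>h. flat (pCons 0 p) h) \<longlongrightarrow> 0) (at 0)"
    by (rule flat_tendsto_0)
  moreover have "flat (pCons 0 p) = (\<lambda>h. (flat p (0 + h) - flat p 0) / h)"
    by (auto simp: flat_def)
  ultimately show ?thesis
    using equal by (simp add: DERIV_def flat_def)
next
  case greater
  have "DERIV (\<lambda>x. poly p (1 / x) * exp (- 1 / x)) x :> flat (pCons 0 (pCons 0 (p - pderiv p))) x"
    using greater
    by (auto intro!: derivative_eq_intros poly_DERIV[THEN DERIV_chain2] simp: flat_def field_simps power2_eq_square)
  moreover have "eventually (\<lambda>y. flat p y = poly p (1 / y) * exp (- 1 / y)) (nhds x)"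
    using eventually_nhds_in_open[of "{0<..}" x] greater by (auto elim!: eventually_mono simp: flat_def)
  ultimately show ?thesis
    by (subst DERIV_cong_ev[OF refl _ refl]) auto
qed

text \<open>Two flat functions facing each other confine the support to the interval from
  \<open>a\<close> to \<open>b\<close>; adding sums makes the class closed under differentiation by
  the product rule. The scale \<open>k\<close> permits steep flanks, which \<open>bump\<close>
  exploits.\<close>

inductive_set cutoffs :: "(real \<Rightarrow> real) set" where
  base: "(\<lambda>x. flat p (k * (x - a)) * flat q (k * (b - x))) \<in> cutoffs" if "k > 0"
| sum: "(\<lambda>x. f x + g x) \<in> cutoffs" if "f \<in> cutoffs" "g \<in> cutoffs"

lemma cutoffs_cmult: "f \<in> cutoffs \<Longrightarrow> (\<lambda>x. c * f x) \<in> cutoffs"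
proof (induction rule: cutoffs.induct)
  case (base k p a q b)
  have "(\<lambda>x. c * (flat p (k * (x - a)) * flat q (k * (b - x))))
      = (\<lambda>x. flat (smult c p) (k * (x - a)) * flat q (k * (b - x)))"
    by (auto simp: flat_def)
  then show ?case using cutoffs.base[OF base, of "smult c p"] by simp
next
  case (sum f g)
  then show ?case using cutoffs.sum[OF sum.IH] by (simp add: distrib_left)
qed

lemma cutoffs_deriv: "f \<in> cutoffs \<Longrightarrow> \<exists>f'\<in>cutoffs. \<forall>x. DERIV f x :> f' x"
proof (induction rule: cutoffs.induct)
  case (base k p a q b)
  define D where "D = (\<lambda>p :: real poly. pCons 0 (pCons 0 (p - pderiv p)))"
  let ?g = "\<lambda>x. flat (smult k (D p)) (k * (x - a)) * flat q (k * (b - x)) +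
      flat (smult (- k) p) (k * (x - a)) * flat (D q) (k * (b - x))"
  have "?g \<in> cutoffs"
    by (rule cutoffs.sum[OF cutoffs.base[OF base] cutoffs.base[OF base]])
  moreover have "DERIV (\<lambda>x. flat p (k * (x - a)) * flat q (k * (b - x))) x :> ?g x" for x
  proof -
    have sm: "flat (smult c p) u = c * flat p u" for c p u by (simp add: flat_def)
    show ?thesis
      unfolding sm D_def
      by (rule derivative_eq_intros DERIV_flat[THEN DERIV_chain2] refl)+ (simp add: algebra_simps)
  qed
  ultimately show ?case by (intro bexI[of _ ?g]) auto
next
  case (sum f g)
  then obtain f' g' where "f' \<in> cutoffs" "g' \<in> cutoffs" "\<forall>x. DERIV f x :> f' x" "\<forall>x. DERIV g x :> g' x"
    by blast
  then show ?case
    by (intro bexI[of _ "\<lambda>x. f' x + g' x"]) (auto intro: cutoffs.sum DERIV_add)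
qed

lemma cutoffs_support: "f \<in> cutoffs \<Longrightarrow> \<exists>M>0. \<forall>x. \<bar>x\<bar> \<ge> M \<longrightarrow> f x = 0"
proof (induction rule: cutoffs.induct)
  case (base k p a q b)
  have "flat p (k * (x - a)) * flat q (k * (b - x)) = 0" if "\<bar>x\<bar> \<ge> \<bar>a\<bar> + \<bar>b\<bar> + 1" for x
  proof -
    have "x \<le> a \<or> b \<le> x" using that by linarith
    then have "k * (x - a) \<le> 0 \<or> k * (b - x) \<le> 0"
      using base by (auto simp: mult_nonneg_nonpos)
    then show ?thesis by (auto simp: flat_def)
  qed
  then show ?case by (intro exI[of _ "\<bar>a\<bar> + \<bar>b\<bar> + 1"]) auto
next
  case (sum f g)
  then obtain M N where "M > 0" "N > 0" "\<forall>x. \<bar>x\<bar> \<ge> M \<longrightarrow> f x = 0" "\<forall>x. \<bar>x\<bar> \<ge> N \<longrightarrow> g x = 0"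
    by blast
  then show ?case by (intro exI[of _ "max M N"]) auto
qed

lemma cutoffs_continuous: "f \<in> cutoffs \<Longrightarrow> continuous_on A f"
  using cutoffs_deriv[of f] by (auto intro!: continuous_at_imp_continuous_on DERIV_isCont)

lemma cutoffs_higher_deriv: "f \<in> cutoffs \<Longrightarrow> (deriv ^^ n) f \<in> cutoffs"
proof (induction n)
  case (Suc n)
  then obtain f' where f': "f' \<in> cutoffs" "\<forall>x. DERIV ((deriv ^^ n) f) x :> f' x"
    using cutoffs_deriv by blast
  then have "(deriv ^^ Suc n) f = f'" by (auto intro!: DERIV_imp_deriv)
  with f' show ?case by simp
qed simp

lemma cutoffs_differentiable: "f \<in> cutoffs \<Longrightarrow> f differentiable at x"
  using cutoffs_deriv[of f] real_differentiable_def by blast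

lemma compact_closure_support:
  fixes f :: "real \<Rightarrow> real"
  assumes "\<And>x. \<bar>x\<bar> \<ge> M \<Longrightarrow> f x = 0"
  shows "compact (closure {x. f x \<noteq> 0})"
proof -
  have "{x. f x \<noteq> 0} \<subseteq> {-M..M}"
  proof
    fix x assume "x \<in> {x. f x \<noteq> 0}"
    with assms[of x] have "\<not> M \<le> \<bar>x\<bar>" by auto
    then show "x \<in> {-M..M}" by auto
  qed
  then show ?thesis
    by (meson bounded_closed_interval bounded_subset compact_closure)
qed

lemma cutoffs_integrable:
  assumes "f \<in> cutoffs" shows "integrable lborel f"
proof -
  obtain M where M: "\<forall>x. \<bar>x\<bar> \<ge> M \<longrightarrow> f x = 0" using cutoffs_support[OF assms] by blast
  have "integrable lborel (\<lambda>x. indicator {-M..M} x *\<^sub>R f x)"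
    by (intro borel_integrable_compact cutoffs_continuous[OF assms]) auto
  moreover have "(\<lambda>x. indicator {-M..M} x *\<^sub>R f x) = f"
  proof
    fix x show "indicator {-M..M} x *\<^sub>R f x = f x"
      using M[rule_format, of x] by (cases "x \<in> {-M..M}") auto
  qed
  ultimately show ?thesis by simp
qed

text \<open>Vanishing total mass gives a primitive the same value on both sides of the support of
  \<open>f\<close>; subtracting this value makes the support compact.\<close>

lemma cutoffs_primitive:
  assumes f: "f \<in> cutoffs" and 0: "(\<integral>x. f x \<partial>lborel) = 0"
  obtains \<phi> where "test_function \<phi>" "deriv \<phi> = f"
proof -
  obtain M where M: "M > 0" "\<And>x. \<bar>x\<bar> \<ge> M \<Longrightarrow> f x = 0" using cutoffs_support[OF f] by blast
  have "\<exists>F. \<forall>x::real. (-\<infinity> :: ereal) < x \<longrightarrow> x < (\<infinity> :: ereal) \<longrightarrow> (F has_vector_derivative f x) (at x)"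
    by (intro einterval_antiderivative)
      (use cutoffs_continuous[OF f, of UNIV] in \<open>auto simp: continuous_on_eq_continuous_at\<close>)
  then obtain F where F: "\<And>x. DERIV F x :> f x"
    by (auto simp: has_real_derivative_iff_has_vector_derivative)
  have int: "(f has_integral F b - F a) {a..b}" if "a \<le> b" for a b
    using that F by (intro fundamental_theorem_of_calculus)
      (auto simp: has_real_derivative_iff_has_vector_derivative intro: has_vector_derivative_at_within)
  have left: "F x = F (- M)" if "x \<le> - M" for x
  proof -
    have "(f has_integral 0) {x..- M}"
      by (rule has_integral_is_0) (use M in auto)
    with int[OF that] show ?thesis by (auto dest: has_integral_unique)
  qed
  have right: "F x = F M" if "M \<le> x" for x
  proof -
    have "(f has_integral 0) {M..x}"
      by (rule has_integral_is_0) (use M in auto)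
    with int[OF that] show ?thesis by (auto dest: has_integral_unique)
  qed
  have "F M = F (- M)"
  proof -
    have "(f has_integral 0) UNIV"
      using has_integral_integral_lborel[OF cutoffs_integrable[OF f]] 0 by simp
    moreover have "f x = 0" if "x \<notin> {- M..M}" for x
      using M(2)[of x] that by auto
    then have "(\<lambda>x. if x \<in> {- M..M} then f x else 0) = f" by auto
    ultimately have "(f has_integral 0) {- M..M}"
      using has_integral_restrict_UNIV[of "{- M..M}" f 0] by simp
    with int[of "- M" M] M(1) show ?thesis by (auto dest: has_integral_unique)
  qed
  define \<phi> where "\<phi> = (\<lambda>x. F x - F (- M))"
  have d: "DERIV \<phi> x :> f x" for x
    unfolding \<phi>_def using F by (auto intro!: derivative_eq_intros)
  then have df: "deriv \<phi> = f" by (auto intro!: DERIV_imp_deriv)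
  have "\<phi> x = 0" if "\<bar>x\<bar> \<ge> M" for x
    using that left[of x] right[of x] \<open>F M = F (- M)\<close> by (auto simp: \<phi>_def abs_if split: if_splits)
  then have "compact (closure {x. \<phi> x \<noteq> 0})" by (rule compact_closure_support)
  moreover have "(deriv ^^ n) \<phi> differentiable at x" for n x
  proof (cases n)
    case 0
    then show ?thesis using d real_differentiable_def by auto
  next
    case (Suc k)
    then have "(deriv ^^ n) \<phi> = (deriv ^^ k) f" by (simp add: funpow_Suc_right df del: funpow.simps)
    then show ?thesis using cutoffs_differentiable[OF cutoffs_higher_deriv[OF f]] by simp
  qed
  ultimately show ?thesis using that[of \<phi>] df by (auto simp: test_function_def)
qed

definition bump :: "real \<Rightarrow> real \<Rightarrow> nat \<Rightarrow> real \<Rightarrow> real" where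
  "bump a b n x = flat 1 (real (Suc n) * (x - a)) * flat 1 (real (Suc n) * (b - x))"

lemma bump_cutoff: "bump a b n \<in> cutoffs"
  unfolding bump_def by (rule cutoffs.base) simp

lemma bump_bound: "0 \<le> bump a b n x" "bump a b n x \<le> indicator {a..b} x"
proof -
  have "0 \<le> flat 1 y" "flat 1 y \<le> 1" for y by (auto simp: flat_def)
  then show "0 \<le> bump a b n x" "bump a b n x \<le> indicator {a..b} x"
    by (auto simp: bump_def indicator_def mult_le_one flat_def zero_less_mult_iff)
qed

lemma bump_tendsto: "(\<lambda>n. bump a b n x) \<longlonglongrightarrow> indicator {a<..<b} x"
proof (cases "x \<in> {a<..<b}")
  case True
  have "(\<lambda>n. flat 1 (real (Suc n) * y)) \<longlonglongrightarrow> 1" if "y > 0" for y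
  proof -
    have "(\<lambda>n. exp (- (1 / y) * inverse (real (Suc n)))) \<longlonglongrightarrow> exp (- (1 / y) * 0)"
      by (intro tendsto_intros LIMSEQ_inverse_real_of_nat)
    moreover have "flat 1 (real (Suc n) * y) = exp (- (1 / y) * inverse (real (Suc n)))" for n
    proof -
      have "0 < real (Suc n) * y" using that by simp
      then show ?thesis using that by (simp add: flat_def divide_simps)
    qed
    ultimately show ?thesis by simp
  qed
  from tendsto_mult[OF this this, of "x - a" "b - x"] True show ?thesis by (simp add: bump_def)
next
  case False
  then have "bump a b n x = 0" for n
    by (auto simp: bump_def flat_def zero_less_mult_iff)
  with False show ?thesis by simp
qed

section \<open>Integration by parts against test functions\<close>

lemma test_function_C1:
  assumes "test_function \<phi>"
  shows "DERIV \<phi> x :> deriv \<phi> x" "continuous_on A \<phi>" "continuous_on A (deriv \<phi>)"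
proof -
  have "(deriv ^^ 0) \<phi> differentiable at x" "(deriv ^^ Suc 0) \<phi> differentiable at x" for x
    using assms unfolding test_function_def by blast+
  then have d: "\<phi> differentiable at x" "deriv \<phi> differentiable at x" for x by simp_all
  then show D: "DERIV \<phi> x :> deriv \<phi> x" for x
    by (simp add: DERIV_deriv_iff_real_differentiable)
  show "continuous_on A \<phi>" "continuous_on A (deriv \<phi>)"
    using d by (auto intro!: continuous_at_imp_continuous_on differentiable_imp_continuous_within)
qed

lemma test_function_support:
  assumes "test_function \<phi>"
  obtains M where "M > 0" "\<And>x. \<bar>x\<bar> \<ge> M \<Longrightarrow> \<phi> x = 0 \<and> deriv \<phi> x = 0"
proof -
  have "bounded {x. \<phi> x \<noteq> 0}"
    using assms bounded_closure_image[of id] closure_subset compact_imp_bounded bounded_subset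
    unfolding test_function_def by metis
  then obtain M where M: "M > 0" "\<And>x. \<phi> x \<noteq> 0 \<Longrightarrow> \<bar>x\<bar> \<le> M"
    by (auto simp: bounded_pos)
  have "deriv \<phi> x = 0" if "\<bar>x\<bar> > M" for x
  proof -
    have "eventually (\<lambda>y. y \<in> - {-M..M}) (nhds x)"
      using that by (intro eventually_nhds_in_open) auto
    then have "eventually (\<lambda>y. \<phi> y = 0) (nhds x)"
      by eventually_elim (use M(2) in force)
    then have "deriv \<phi> x = deriv (\<lambda>x. 0) x" by (rule deriv_cong_ev) simp
    then show ?thesis by simp
  qed
  \<comment> \<open>The vanishing is known only for \<open>\<bar>x\<bar>\<close> strictly larger
    than \<open>M\<close>, hence the radius \<open>M + 1\<close>.\<close>
  with M that[of "M + 1"] show ?thesis by force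
qed

lemma ac_deriv_test_function:
  assumes "test_function \<phi>"
  shows "ac_deriv (\<lambda>x. of_real (\<phi> x)) (\<lambda>x. of_real (deriv \<phi> x))"
proof (rule ac_deriv_C1)
  show "((\<lambda>x. complex_of_real (\<phi> x)) has_vector_derivative of_real (deriv \<phi> x)) (at x)" for x
    using test_function_C1(1)[OF assms]
    by (auto intro!: has_vector_derivative_of_real simp: has_real_derivative_iff_has_vector_derivative)
  show "continuous_on UNIV (\<lambda>x. complex_of_real (deriv \<phi> x))"
    using test_function_C1(3)[OF assms] by (auto intro!: continuous_intros)
qed

lemma integrable_mult_compact_support:
  fixes f :: "real \<Rightarrow> complex"
  assumes "\<And>x. \<bar>x\<bar> \<ge> M \<Longrightarrow> \<psi> x = (0 :: real)" "continuous_on UNIV \<psi>"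
    "set_integrable lborel {-M..M} f" "f \<in> borel_measurable lborel"
  shows "integrable lborel (\<lambda>x. of_real (\<psi> x) * f x)"
proof -
  have "set_integrable lborel {-M..M} (\<lambda>x. f x * of_real (\<psi> x))"
  proof (intro set_integrable_mult_continuous assms)
    show "continuous_on {-M..M} (\<lambda>x. complex_of_real (\<psi> x))"
      by (intro continuous_intros continuous_on_subset[OF assms(2)]) simp
    have "(\<lambda>x. complex_of_real (\<psi> x)) \<in> borel_measurable borel"
      by (intro borel_measurable_continuous_onI continuous_intros assms(2))
    then show "(\<lambda>x. complex_of_real (\<psi> x)) \<in> borel_measurable lborel" by simp
  qed
  moreover have "(\<lambda>x. indicator {-M..M} x *\<^sub>R (f x * of_real (\<psi> x))) = (\<lambda>x. of_real (\<psi> x) * f x)"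
  proof
    fix x show "indicator {-M..M} x *\<^sub>R (f x * of_real (\<psi> x)) = of_real (\<psi> x) * f x"
      using assms(1)[of x] by (cases "x \<in> {-M..M}") auto
  qed
  ultimately show ?thesis by (simp add: set_integrable_def)
qed

lemma ac_deriv_imp_weak:
  assumes \<phi>: "test_function \<phi>" and f: "ac_deriv f f'"
  shows "(\<integral>x. of_real (deriv \<phi> x) * f x \<partial>lborel) = - (\<integral>x. of_real (\<phi> x) * f' x \<partial>lborel)"
proof -
  obtain M where M: "\<And>x. \<bar>x\<bar> \<ge> M \<Longrightarrow> \<phi> x = 0 \<and> deriv \<phi> x = 0"
    using test_function_support[OF \<phi>] by blast
  have sf: "set_integrable lborel {-M..M} f"
    by (intro borel_integrable_atLeastAtMost' ac_deriv_continuous[OF f])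
  have i1: "integrable lborel (\<lambda>x. of_real (deriv \<phi> x) * f x)"
    using M test_function_C1(3)[OF \<phi>] sf ac_deriv_measurable[OF f]
    by (intro integrable_mult_compact_support) auto
  have i2: "integrable lborel (\<lambda>x. of_real (\<phi> x) * f' x)"
    using M test_function_C1(2)[OF \<phi>] ac_derivD[OF f]
    by (intro integrable_mult_compact_support) auto
  have i3: "integrable lborel (\<lambda>x. of_real (\<phi> x) * f x)"
    using M test_function_C1(2)[OF \<phi>] sf ac_deriv_measurable[OF f]
    by (intro integrable_mult_compact_support) auto
  have "(\<integral>x. of_real (deriv \<phi> x) * f x + of_real (\<phi> x) * f' x \<partial>lborel) = 0"
    by (rule integral_ac_deriv[OF ac_deriv_mult[OF ac_deriv_test_function[OF \<phi>] f] i3])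
      (intro Bochner_Integration.integrable_add i1 i2)
  then show ?thesis using i1 i2 by (simp add: eq_neg_iff_add_eq_0)
qed

section \<open>From weak derivatives to absolutely continuous representatives\<close>

lemma AE_zero_if_interval_integrals_zero:
  fixes h :: "real \<Rightarrow> complex"
  assumes h: "integrable lborel h" and 0: "\<And>a. (LINT x:{..a}|lborel. h x) = 0"
  shows "AE x in lborel. h x = 0"
proof (rule sigma_finite_measure.density_zero[OF lborel.sigma_finite_measure_axioms h])
  \<comment> \<open>Half lines generate the Borel sets and are stable under intersection, so a
    Dynkin argument applies. Its complement step needs the total integral, which is a limit of
    half-line integrals.\<close>
  have UNIV: "(\<integral>x. h x \<partial>lborel) = 0"
  proof -
    have "((\<lambda>a. LINT x:{..a}|lborel. h x) \<longlongrightarrow> (\<integral>x. h x \<partial>lborel)) at_top"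
      using tendsto_integral_at_top[OF _ h] by (simp add: set_lebesgue_integral_def)
    then show ?thesis by (simp add: 0 tendsto_const_iff)
  qed
  have si: "set_integrable lborel A h" if "A \<in> sets borel" for A
    using h that unfolding set_integrable_def by (intro integrable_mult_indicator) auto
  fix A :: "real set" assume "A \<in> sets lborel"
  then have A: "A \<in> sigma_sets UNIV (range (\<lambda>a. {..a}))"
    by (simp add: borel_eq_atMost)
  have "Int_stable (range (\<lambda>a::real. {..a}))"
    by (auto simp: Int_stable_def)
  moreover have "range (\<lambda>a::real. {..a}) \<subseteq> Pow UNIV" by simp
  ultimately show "set_lebesgue_integral lborel A h = 0"
    using A
  proof (induction rule: sigma_sets_induct_disjoint)
    case (basic A)
    then show ?case using 0 by auto
  next
    case empty
    show ?case by (simp add: set_lebesgue_integral_def)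
  next
    case (compl A)
    then have A: "A \<in> sets borel" by (simp add: borel_eq_atMost)
    then have "set_lebesgue_integral lborel (A \<union> (UNIV - A)) h
        = set_lebesgue_integral lborel A h + set_lebesgue_integral lborel (UNIV - A) h"
      by (intro set_integral_Un si) auto
    then show ?case using compl UNIV by (simp add: set_lebesgue_integral_def)
  next
    case (union A)
    then have A: "A i \<in> sets borel" for i by (auto simp: borel_eq_atMost)
    have "set_lebesgue_integral lborel (\<Union>i. A i) h = (\<Sum>i. set_lebesgue_integral lborel (A i) h)"
      using A union(1) by (intro lebesgue_integral_countable_add si) (auto simp: disjoint_family_on_def)
    then show ?case using union by simp
  qed
qed

lemma exists_ac_primitive:
  assumes "V \<in> borel_measurable lborel" "\<And>a b. set_integrable lborel {a..b} V"
  obtains G where "ac_deriv G V"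
proof
  define G where "G = (\<lambda>x. if 0 \<le> x then LINT t:{0..x}|lborel. V t else - (LINT t:{x..0}|lborel. V t))"
  have split: "(LINT t:{a..c}|lborel. V t) = (LINT t:{a..b}|lborel. V t) + (LINT t:{b..c}|lborel. V t)"
    if "a \<le> b" "b \<le> c" for a b c
    using Henstock_Kurzweil_Integration.integral_combine[OF that set_borel_integral_eq_integral(1)[OF assms(2)]]
      set_borel_integral_eq_integral(2)[OF assms(2)] by simp
  show "ac_deriv G V"
    unfolding ac_deriv_def
  proof (intro conjI allI impI assms)
    fix a b :: real assume "a \<le> b"
    then show "G b - G a = (LINT x:{a..b}|lborel. V x)"
      using split[of 0 a b] split[of a b 0] split[of a 0 b] by (auto simp: G_def)
  qed
qed

text \<open>The lemma of du Bois-Reymond.\<close>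

lemma weak_deriv_imp_ac:
  fixes U V :: "real \<Rightarrow> complex"
  assumes U: "U \<in> borel_measurable lborel" "\<And>a b. set_integrable lborel {a..b} U"
    and V: "V \<in> borel_measurable lborel" "\<And>a b. set_integrable lborel {a..b} V"
    and weak: "\<And>\<phi>. test_function \<phi> \<Longrightarrow>
      (\<integral>x. of_real (deriv \<phi> x) * U x \<partial>lborel) = - (\<integral>x. of_real (\<phi> x) * V x \<partial>lborel)"
  obtains f where "ac_deriv f V" "AE x in lborel. U x = f x"
proof -
  obtain G where G: "ac_deriv G V" using exists_ac_primitive[OF V] by blast
  define H where "H = (\<lambda>x. U x - G x)"
  have sG: "set_integrable lborel {a..b} G" for a b
    by (intro borel_integrable_atLeastAtMost' ac_deriv_continuous[OF G])
  have mG: "G \<in> borel_measurable lborel" by (rule ac_deriv_measurable[OF G])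
  have mH: "H \<in> borel_measurable lborel" unfolding H_def using U(1) mG by simp
  have sH: "set_integrable lborel {a..b} H" for a b
    unfolding H_def using U(2) sG by (rule set_integral_diff)
  have iw: "integrable lborel (\<lambda>x. of_real (\<psi> x) * h x)"
    if \<psi>: "\<psi> \<in> cutoffs" and h: "h \<in> borel_measurable lborel" "\<And>a b. set_integrable lborel {a..b} h" for \<psi> and h :: "real \<Rightarrow> complex"
  proof -
    obtain M where M: "\<And>x. \<bar>x\<bar> \<ge> M \<Longrightarrow> \<psi> x = 0" using cutoffs_support[OF \<psi>] by blast
    show ?thesis
      by (rule integrable_mult_compact_support[OF M cutoffs_continuous[OF \<psi>] h(2) h(1)])
  qed
  \<comment> \<open>A cutoff of mean zero is the derivative of a test function, so the weak
    identities for \<open>U\<close> and for its candidate \<open>G\<close> have the same right-hand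
    side. It remains to see that \<open>H\<close> is constant.\<close>
  have zero: "(\<integral>x. of_real (\<psi> x) * H x \<partial>lborel) = 0"
    if \<psi>: "\<psi> \<in> cutoffs" and i0: "(\<integral>x. \<psi> x \<partial>lborel) = 0" for \<psi>
  proof -
    obtain \<phi> where \<phi>: "test_function \<phi>" "deriv \<phi> = \<psi>" by (rule cutoffs_primitive[OF \<psi> i0])
    have "(\<integral>x. of_real (\<psi> x) * H x \<partial>lborel)
        = (\<integral>x. of_real (\<psi> x) * U x \<partial>lborel) - (\<integral>x. of_real (\<psi> x) * G x \<partial>lborel)"
      unfolding H_def using iw[OF \<psi> U] iw[OF \<psi> mG sG] by (simp add: right_diff_distrib)
    then show ?thesis
      using weak[OF \<phi>(1)] ac_deriv_imp_weak[OF \<phi>(1) G] \<phi>(2) by simp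
  qed
  define \<psi>0 where "\<psi>0 = bump 0 1 0"
  have \<psi>0: "\<psi>0 \<in> cutoffs" unfolding \<psi>0_def by (rule bump_cutoff)
  define I where "I = (\<integral>x. \<psi>0 x \<partial>lborel)"
  have "I \<noteq> 0"
  proof
    assume "I = 0"
    then have "AE x in lborel. \<psi>0 x = 0"
      unfolding I_def using integral_nonneg_eq_0_iff_AE[OF cutoffs_integrable[OF \<psi>0]]
      by (auto simp: \<psi>0_def bump_bound)
    then have "AE x in lborel. x \<notin> {0<..<1::real}"
      by eventually_elim (auto simp: \<psi>0_def bump_def flat_def)
    then have "emeasure lborel {0<..<1::real} = 0"
      by (subst (asm) AE_iff_measurable[OF _ refl]) (auto simp: greaterThanLessThan_def Int_def)
    then show False by simp
  qed
  define c where "c = (\<integral>x. of_real (\<psi>0 x) * H x \<partial>lborel) / of_real I"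
  \<comment> \<open>Subtracting a multiple of the reference bump \<open>\<psi>0\<close> reduces to
    mean zero; integration against \<open>H\<close> is therefore integration against the constant
    \<open>c\<close>.\<close>
  have const: "(\<integral>x. of_real (\<psi> x) * H x \<partial>lborel) = c * of_real (\<integral>x. \<psi> x \<partial>lborel)" if \<psi>: "\<psi> \<in> cutoffs" for \<psi>
  proof -
    let ?r = "- (\<integral>x. \<psi> x \<partial>lborel) / I"
    have m: "(\<lambda>x. ?r * \<psi>0 x) \<in> cutoffs" by (rule cutoffs_cmult[OF \<psi>0])
    have "(\<integral>x. \<psi> x + ?r * \<psi>0 x \<partial>lborel) = 0"
      using cutoffs_integrable[OF \<psi>] cutoffs_integrable[OF \<psi>0] \<open>I \<noteq> 0\<close>
      by (simp add: I_def[symmetric])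
    then have "(\<integral>x. of_real (\<psi> x + ?r * \<psi>0 x) * H x \<partial>lborel) = 0"
      by (rule zero[OF cutoffs.sum[OF \<psi> m]])
    moreover have "(\<integral>x. of_real (\<psi> x + ?r * \<psi>0 x) * H x \<partial>lborel)
        = (\<integral>x. of_real (\<psi> x) * H x + of_real ?r * (of_real (\<psi>0 x) * H x) \<partial>lborel)"
      by (simp only: of_real_add of_real_mult distrib_right mult.assoc)
    ultimately have "(\<integral>x. of_real (\<psi> x) * H x \<partial>lborel) + of_real ?r * (\<integral>x. of_real (\<psi>0 x) * H x \<partial>lborel) = 0"
      using iw[OF \<psi> mH sH] iw[OF \<psi>0 mH sH] by simp
    then show ?thesis using \<open>I \<noteq> 0\<close> by (simp add: c_def field_simps)
  qed
  define h where "h = (\<lambda>x. H x - c)"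
  have mh: "h \<in> borel_measurable lborel" unfolding h_def using mH by simp
  have sh: "set_integrable lborel {a..b} h" for a b
    unfolding h_def using sH by (rule set_integral_diff) (simp add: borel_integrable_atLeastAtMost')
  have h0: "(\<integral>x. of_real (bump a b n x) * h x \<partial>lborel) = 0" for a b n
  proof -
    have "(\<integral>x. of_real (bump a b n x) * h x \<partial>lborel)
        = (\<integral>x. of_real (bump a b n x) * H x \<partial>lborel) - (\<integral>x. of_real (bump a b n x) * c \<partial>lborel)"
      unfolding h_def using iw[OF bump_cutoff mH sH] cutoffs_integrable[OF bump_cutoff]
      by (simp add: right_diff_distrib)
    then show ?thesis using const[OF bump_cutoff] by (simp add: mult.commute)
  qed
  have int0: "(LINT x:{a..b}|lborel. h x) = 0" for a b
  proof -
    have "(\<lambda>n. \<integral>x. of_real (bump a b n x) * h x \<partial>lborel) \<longlonglongrightarrow> (\<integral>x. of_real (indicator {a<..<b} x) * h x \<partial>lborel)"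
    proof (rule integral_dominated_convergence)
      show "integrable lborel (\<lambda>x. norm (indicator {a..b} x *\<^sub>R h x))"
        using sh unfolding set_integrable_def by (rule integrable_norm)
      show "(\<lambda>x. of_real (indicator {a<..<b} x) * h x) \<in> borel_measurable lborel"
        using mh by simp
      show "(\<lambda>x. of_real (bump a b n x) * h x) \<in> borel_measurable lborel" for n
        by (rule borel_measurable_integrable[OF iw[OF bump_cutoff mh sh]])
      show "AE x in lborel. (\<lambda>n. of_real (bump a b n x) * h x) \<longlonglongrightarrow> of_real (indicator {a<..<b} x) * h x"
        by (auto intro!: tendsto_intros bump_tendsto)
      show "AE x in lborel. norm (of_real (bump a b n x) * h x) \<le> norm (indicator {a..b} x *\<^sub>R h x)" for n
        using bump_bound[of a b n] by (auto simp: norm_mult intro!: mult_right_mono)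
    qed
    then have "(\<integral>x. of_real (indicator {a<..<b} x) * h x \<partial>lborel) = 0"
      by (simp add: h0 LIMSEQ_const_iff)
    moreover have "(LINT x:{a..b}|lborel. h x) = (\<integral>x. of_real (indicator {a<..<b} x) * h x \<partial>lborel)"
      unfolding set_lebesgue_integral_def
    proof (rule integral_cong_AE)
      have "AE x in lborel. x \<noteq> a" "AE x in lborel. x \<noteq> b" by (rule AE_lborel_singleton)+
      then show "AE x in lborel. indicator {a..b} x *\<^sub>R h x = of_real (indicator {a<..<b} x) * h x"
        by eventually_elim (auto simp: indicator_def)
    qed (use mh in auto)
    ultimately show ?thesis by simp
  qed
  \<comment> \<open>\<open>h\<close> is only locally integrable, so it is truncated to
    \<open>{- N..N}\<close> before the vanishing interval integrals are used; countably many
    \<open>N\<close> cover the line.\<close>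
  have "AE x in lborel. indicator {- real N..real N} x *\<^sub>R h x = 0" for N :: nat
  proof (rule AE_zero_if_interval_integrals_zero)
    show "integrable lborel (\<lambda>x. indicator {- real N..real N} x *\<^sub>R h x)"
      using sh unfolding set_integrable_def .
    fix a
    have "(\<lambda>x. indicator {..a} x *\<^sub>R (indicator {- real N..real N} x *\<^sub>R h x))
        = (\<lambda>x. indicator {- real N..min a (real N)} x *\<^sub>R h x)"
      by (auto simp: indicator_def)
    then show "(LINT x:{..a}|lborel. indicator {- real N..real N} x *\<^sub>R h x) = 0"
      using int0 by (simp add: set_lebesgue_integral_def)
  qed
  then have "AE x in lborel. \<forall>N::nat. indicator {- real N..real N} x *\<^sub>R h x = 0"
    unfolding AE_all_countable by blast
  then have "AE x in lborel. U x = c + G x"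
  proof eventually_elim
    case (elim x)
    obtain N :: nat where "\<bar>x\<bar> \<le> real N" using real_arch_simple by blast
    with elim[rule_format, of N] have "h x = 0" by (auto simp: indicator_def)
    then show ?case by (simp add: h_def H_def algebra_simps)
  qed
  moreover have "ac_deriv (\<lambda>x. c + G x) V"
    using ac_deriv_add[OF ac_deriv_const[of c] G] by simp
  ultimately show ?thesis by (rule that[rotated])
qed

section \<open>The operators $D_+$ and $D_-$\<close>

text \<open>\<open>f\<close> is the continuous representative of an element of $H^1 \cap Dom(x)$ and \<open>f'\<close> is its derivative.\<close>

definition wsob :: "(real \<Rightarrow> complex) \<Rightarrow> (real \<Rightarrow> complex) \<Rightarrow> bool" where
  "wsob f f' \<longleftrightarrow> in_l2 f \<and> in_l2 f' \<and> in_l2 (\<lambda>x. of_real x * f x) \<and> ac_deriv f f'"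

definition zeta :: "real \<Rightarrow> real \<Rightarrow> complex" where
  "zeta l x = of_real x + \<i> * of_real l"

text \<open>The derivative is passed as a separate argument because \<open>ac_deriv\<close> fixes it
  only almost everywhere; in use it is the companion of \<open>f\<close> in
  \<open>wsob\<close>.\<close>

definition dminus :: "real \<Rightarrow> (real \<Rightarrow> complex) \<Rightarrow> (real \<Rightarrow> complex) \<Rightarrow> real \<Rightarrow> complex" where
  "dminus l f f' x = f' x - zeta l x * f x"

definition dplus :: "real \<Rightarrow> (real \<Rightarrow> complex) \<Rightarrow> (real \<Rightarrow> complex) \<Rightarrow> real \<Rightarrow> complex" where
  "dplus l f f' x = f' x + zeta l x * f x"

lemma wsobD:
  assumes "wsob f f'"
  shows "in_l2 f" "in_l2 f'" "in_l2 (\<lambda>x. of_real x * f x)" "ac_deriv f f'"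
  using assms by (auto simp: wsob_def)

lemma in_l2_zeta:
  assumes "in_l2 f" "in_l2 (\<lambda>x. of_real x * f x)"
  shows "in_l2 (\<lambda>x. zeta l x * f x)"
  unfolding zeta_def distrib_right mult.assoc using assms by (intro in_l2_add in_l2_cmult)

lemma in_l2_dminus [intro]: "wsob f f' \<Longrightarrow> in_l2 (dminus l f f')"
  unfolding dminus_def by (intro in_l2_diff in_l2_zeta) (simp_all add: wsob_def)

lemma in_l2_dplus [intro]: "wsob f f' \<Longrightarrow> in_l2 (dplus l f f')"
  unfolding dplus_def by (intro in_l2_add in_l2_zeta) (simp_all add: wsob_def)

lemma wsob_cmult: "wsob f f' \<Longrightarrow> wsob (\<lambda>x. c * f x) (\<lambda>x. c * f' x)"
  using in_l2_cmult[of "\<lambda>x. of_real x * f x" c] ac_deriv_cmult[of f f' c]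
  by (auto simp: wsob_def mult.left_commute)

lemma wsob_add:
  "wsob f f' \<Longrightarrow> wsob g g' \<Longrightarrow> wsob (\<lambda>x. f x + g x) (\<lambda>x. f' x + g' x)"
  using in_l2_add[of "\<lambda>x. of_real x * f x" "\<lambda>x. of_real x * g x"]
  by (auto simp: wsob_def distrib_left intro: ac_deriv_add)

lemma wsob_diff:
  "wsob f f' \<Longrightarrow> wsob g g' \<Longrightarrow> wsob (\<lambda>x. f x - g x) (\<lambda>x. f' x - g' x)"
  using wsob_add[of f f' "\<lambda>x. (-1) * g x" "\<lambda>x. (-1) * g' x"] wsob_cmult[of g g' "-1"] by simp

lemma wsob_cnj: "wsob f f' \<Longrightarrow> wsob (\<lambda>x. cnj (f x)) (\<lambda>x. cnj (f' x))"
  using in_l2_cnj[of "\<lambda>x. of_real x * f x"] by (auto simp: wsob_def intro: ac_deriv_cnj)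

lemma ac_deriv_of_real: "ac_deriv of_real (\<lambda>x. 1)"
  by (rule ac_deriv_C1) (auto intro!: derivative_eq_intros continuous_intros)

lemma wsob_parts:
  assumes a: "wsob a a'" and b: "wsob b b'"
  shows "pairing a' b = - pairing a b'"
proof -
  have i: "integrable lborel (\<lambda>x. a' x * b x)" "integrable lborel (\<lambda>x. a x * b' x)" "integrable lborel (\<lambda>x. a x * b x)"
    using a b by (auto intro: integrable_mult_l2 dest: wsobD)
  have "(\<integral>x. a' x * b x + a x * b' x \<partial>lborel) = 0"
    by (rule integral_ac_deriv[OF ac_deriv_mult[OF wsobD(4)[OF a] wsobD(4)[OF b]] i(3)])
      (intro Bochner_Integration.integrable_add i)
  then show ?thesis using i by (simp add: pairing_def eq_neg_iff_add_eq_0)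
qed

text \<open>The derivative of \<open>x * a x * b x\<close> has integral zero. The term free of
  derivatives is the commutator of \<open>d/dx\<close> with \<open>x\<close> and the source of the 2
  in the commutation relation.\<close>

lemma wsob_parts_x:
  assumes a: "wsob a a'" and b: "wsob b b'"
  shows "pairing a' (\<lambda>x. of_real x * b x) + pairing (\<lambda>x. of_real x * a x) b' = - pairing a b"
proof -
  have i: "integrable lborel (\<lambda>x. a x * b x)" "integrable lborel (\<lambda>x. a' x * (of_real x * b x))"
    "integrable lborel (\<lambda>x. (of_real x * a x) * b' x)" "integrable lborel (\<lambda>x. (of_real x * a x) * b x)"
    using a b by (auto intro: integrable_mult_l2 dest: wsobD)
  have e: "(\<lambda>x. (1 * a x + of_real x * a' x) * b x + (of_real x * a x) * b' x)
      = (\<lambda>x. a x * b x + a' x * (of_real x * b x) + (of_real x * a x) * b' x)"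
    by (simp add: algebra_simps)
  have "(\<integral>x. (1 * a x + of_real x * a' x) * b x + (of_real x * a x) * b' x \<partial>lborel) = 0"
  proof (rule integral_ac_deriv)
    show "ac_deriv (\<lambda>x. (of_real x * a x) * b x) (\<lambda>x. (1 * a x + of_real x * a' x) * b x + (of_real x * a x) * b' x)"
      by (intro ac_deriv_mult ac_deriv_of_real wsobD(4)[OF a] wsobD(4)[OF b])
    show "integrable lborel (\<lambda>x. (1 * a x + of_real x * a' x) * b x + (of_real x * a x) * b' x)"
      unfolding e by (intro Bochner_Integration.integrable_add i)
  qed (rule i)
  then show ?thesis
    unfolding e using i by (simp add: pairing_def eq_neg_iff_add_eq_0 algebra_simps)
qed

lemma pairing_dminus:
  assumes a: "wsob a a'" and b: "wsob b b'"
  shows "pairing (dminus l a a') b = - pairing a (dplus l b b')"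
proof -
  have "pairing (dminus l a a') b = pairing a' b - pairing (\<lambda>x. zeta l x * a x) b"
    unfolding dminus_def using wsobD[OF a] wsobD[OF b] by (intro pairing_diff_left in_l2_zeta)
  moreover have "pairing a (dplus l b b') = pairing a b' + pairing a (\<lambda>x. zeta l x * b x)"
    unfolding dplus_def using wsobD[OF a] wsobD[OF b] by (intro pairing_add_right in_l2_zeta)
  moreover have "pairing (\<lambda>x. zeta l x * a x) b = pairing a (\<lambda>x. zeta l x * b x)"
    by (simp add: pairing_def mult.assoc mult.left_commute)
  ultimately show ?thesis using wsob_parts[OF a b] by simp
qed

lemma pairing_dplus:
  assumes a: "wsob a a'" and b: "wsob b b'"
  shows "pairing (dplus l a a') b = - pairing a (dminus l b b')"
  using pairing_dminus[OF b a, of l] by (simp add: pairing_commute)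

text \<open>The commutation relation \<open>D\<^sub>+ D\<^sub>- = D\<^sub>- D\<^sub>+ - 2\<close> in weak form.\<close>

lemma pairing_dminus_dminus:
  assumes a: "wsob a a'" and b: "wsob b b'"
  shows "pairing (dminus l a a') (dminus l b b') = pairing (dplus l a a') (dplus l b b') + 2 * pairing a b"
proof -
  note A = wsobD(1-3)[OF a] and B = wsobD(1-3)[OF b]
  define za where "za = (\<lambda>x. zeta l x * a x)"
  define zb where "zb = (\<lambda>x. zeta l x * b x)"
  have z: "in_l2 za" "in_l2 zb" unfolding za_def zb_def using A B by (auto intro: in_l2_zeta)
  have m: "dminus l a a' = (\<lambda>x. a' x - za x)" "dminus l b b' = (\<lambda>x. b' x - zb x)"
    "dplus l a a' = (\<lambda>x. a' x + za x)" "dplus l b b' = (\<lambda>x. b' x + zb x)"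
    by (auto simp: dminus_def dplus_def za_def zb_def)
  have "pairing (dminus l a a') (dminus l b b')
      = pairing a' b' - pairing a' zb - (pairing za b' - pairing za zb)"
    unfolding m using A B z by (subst pairing_diff_left) (auto simp: pairing_diff_right)
  moreover have "pairing (dplus l a a') (dplus l b b')
      = pairing a' b' + pairing a' zb + (pairing za b' + pairing za zb)"
    unfolding m using A B z by (subst pairing_add_left) (auto simp: pairing_add_right)
  moreover have "pairing a' zb = pairing a' (\<lambda>x. of_real x * b x) + \<i> * l * pairing a' b"
    unfolding zb_def zeta_def distrib_right using A B
    by (subst pairing_add_right) (auto intro: in_l2_cmult)
  moreover have "pairing za b' = pairing (\<lambda>x. of_real x * a x) b' + \<i> * l * pairing a b'"
    unfolding za_def zeta_def distrib_right using A B
    by (subst pairing_add_left) (auto intro: in_l2_cmult)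
  ultimately show ?thesis
    using wsob_parts[OF a b] wsob_parts_x[OF a b] by (simp add: algebra_simps)
qed

lemma l2norm_add_power2:
  assumes "in_l2 f" "in_l2 g"
  shows "(l2norm (\<lambda>x. f x + g x))\<^sup>2 = (l2norm f)\<^sup>2 + (l2norm g)\<^sup>2 + 2 * Re (pairing f (\<lambda>x. cnj (g x)))"
proof -
  have i: "integrable lborel (\<lambda>x. f x * cnj (g x))"
    using assms by (intro integrable_mult_l2 in_l2_cnj)
  have "(l2norm (\<lambda>x. f x + g x))\<^sup>2
      = (\<integral>x. (norm (f x))\<^sup>2 + (norm (g x))\<^sup>2 + 2 * Re (f x * cnj (g x)) \<partial>lborel)"
    unfolding l2norm_power2
    by (intro Bochner_Integration.integral_cong)
      (simp_all only: cmod_power2, simp_all add: power2_eq_square algebra_simps)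
  also have "\<dots> = (l2norm f)\<^sup>2 + (l2norm g)\<^sup>2 + 2 * Re (pairing f (\<lambda>x. cnj (g x)))"
  proof -
    have "integrable lborel (\<lambda>x. 2 * Re (f x * cnj (g x)))"
      using integrable_Re[OF i] by (rule integrable_mult_right)
    moreover have "integrable lborel (\<lambda>x. (norm (f x))\<^sup>2)" "integrable lborel (\<lambda>x. (norm (g x))\<^sup>2)"
      using assms by (auto simp: in_l2_def)
    ultimately show ?thesis
      unfolding l2norm_power2 pairing_def
      by (simp only: Bochner_Integration.integral_add Bochner_Integration.integrable_add
          integral_mult_right_zero integral_Re[OF i])
  qed
  finally show ?thesis .
qed

text \<open>With \<open>p = v' - i l v\<close> and \<open>q = x v\<close> the two functions are
  \<open>p - q\<close> and \<open>p + q\<close>, whose squared norms differ by four times the real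
  part of the Hermitian product of \<open>p\<close> and \<open>q\<close>. There \<open>l\<close>
  drops out because \<open>v\<close> against \<open>x v\<close> is real, and integration by parts
  turns the rest into \<open>- \<bar>v\<bar>\<^sup>2 / 2\<close>. Hence \<open>D\<^sub>-\<close> is
  bounded below for every real \<open>l\<close>.\<close>

lemma l2norm_dminus:
  assumes v: "wsob v v'"
  shows "(l2norm (dminus l v v'))\<^sup>2 = (l2norm (\<lambda>x. dplus l v v' x - 2 * \<i> * l * v x))\<^sup>2 + 2 * (l2norm v)\<^sup>2"
proof -
  note V = wsobD(1-3)[OF v]
  define p where "p = (\<lambda>x. v' x - \<i> * l * v x)"
  define q where "q = (\<lambda>x. of_real x * v x)"
  have pq: "in_l2 p" "in_l2 q" unfolding p_def q_def using V by auto
  have m: "dminus l v v' = (\<lambda>x. p x + - q x)" "(\<lambda>x. dplus l v v' x - 2 * \<i> * l * v x) = (\<lambda>x. p x + q x)"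
    by (auto simp: dminus_def dplus_def p_def q_def zeta_def algebra_simps)
  have 1: "pairing p (\<lambda>x. cnj (q x)) = pairing v' (\<lambda>x. of_real x * cnj (v x)) - \<i> * l * pairing v (\<lambda>x. cnj (q x))"
  proof -
    have "in_l2 (\<lambda>x. cnj (q x))" using pq by auto
    moreover have "(\<lambda>x. cnj (q x)) = (\<lambda>x. of_real x * cnj (v x))" by (simp add: q_def)
    ultimately show ?thesis
      unfolding p_def using V by (subst pairing_diff_left) auto
  qed
  have "pairing v (\<lambda>x. cnj (q x)) = cnj (pairing v (\<lambda>x. cnj (q x)))"
    unfolding pairing_cnj by (simp add: pairing_def q_def algebra_simps)
  then have "Im (pairing v (\<lambda>x. cnj (q x))) = 0" by (simp add: complex_eq_iff)
  then have 2: "Re (pairing p (\<lambda>x. cnj (q x))) = Re (pairing v' (\<lambda>x. of_real x * cnj (v x)))"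
    unfolding 1 by simp
  have "pairing q (\<lambda>x. cnj (v' x)) = cnj (pairing v' (\<lambda>x. of_real x * cnj (v x)))"
    unfolding pairing_cnj by (simp add: pairing_def q_def algebra_simps)
  then have "2 * Re (pairing v' (\<lambda>x. of_real x * cnj (v x))) = - (l2norm v)\<^sup>2"
    using arg_cong[OF wsob_parts_x[OF v wsob_cnj[OF v]], of Re]
    by (simp add: pairing_cnj_self q_def)
  with 2 show ?thesis
    unfolding m using l2norm_add_power2[OF pq] l2norm_add_power2[OF pq(1) in_l2_uminus[OF pq(2)]] by simp
qed

lemma l2norm_le_dminus: "wsob v v' \<Longrightarrow> l2norm v \<le> l2norm (dminus l v v')"
  by (rule power2_le_imp_le) (simp_all add: l2norm_dminus)

lemma l2norm_dminus_le:
  assumes v: "wsob v v'"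
  shows "l2norm (dminus l v v') \<le> l2norm (dplus l v v') + (2 * \<bar>l\<bar> + 2) * l2norm v"
proof -
  define s where "s = l2norm (\<lambda>x. dplus l v v' x - 2 * \<i> * l * v x)"
  have "(l2norm (dminus l v v'))\<^sup>2 \<le> (s + 2 * l2norm v)\<^sup>2"
    unfolding l2norm_dminus[OF v] s_def[symmetric] by (simp add: power2_eq_square algebra_simps s_def)
  then have "l2norm (dminus l v v') \<le> s + 2 * l2norm v"
    by (rule power2_le_imp_le) (simp add: s_def)
  moreover have "s \<le> l2norm (dplus l v v') + l2norm (\<lambda>x. (2 * \<i> * l) * v x)"
    unfolding s_def using in_l2_dplus[OF v] wsobD(1)[OF v] by (intro l2norm_diff_triangle) auto
  moreover have "l2norm (\<lambda>x. (2 * \<i> * l) * v x) = 2 * \<bar>l\<bar> * l2norm v"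
    by (simp only: l2norm_cmult) (simp add: norm_mult)
  ultimately have "l2norm (dminus l v v') \<le> l2norm (dplus l v v') + 2 * \<bar>l\<bar> * l2norm v + 2 * l2norm v"
    by linarith
  then show ?thesis by (simp add: distrib_right mult.assoc)
qed

lemma dplus_cnj: "dplus l (\<lambda>x. cnj (w x)) (\<lambda>x. cnj (w' x)) x = cnj (dplus l w w' x - 2 * \<i> * l * w x)"
  by (simp add: dplus_def zeta_def algebra_simps)

lemma dminus_cnj: "dminus l (\<lambda>x. cnj (v x)) (\<lambda>x. cnj (v' x)) x = cnj (dminus l v v' x + 2 * \<i> * l * v x)"
  by (simp add: dminus_def zeta_def algebra_simps)

text \<open>In the variables \<open>v = u\<^sub>1 + u\<^sub>2\<close>, \<open>w = u\<^sub>1 - u\<^sub>2\<close> the operator \<open>A\<^sub>m - l\<close> becomes the pair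
  \<open>(- i D\<^sub>- v + m w, i D\<^sub>+ w + m v)\<close>.\<close>

definition op1 :: "real \<Rightarrow> real \<Rightarrow> (real \<Rightarrow> complex) \<Rightarrow> (real \<Rightarrow> complex) \<Rightarrow> (real \<Rightarrow> complex) \<Rightarrow> real \<Rightarrow> complex" where
  "op1 m l v v' w x = - \<i> * dminus l v v' x + of_real m * w x"

definition op2 :: "real \<Rightarrow> real \<Rightarrow> (real \<Rightarrow> complex) \<Rightarrow> (real \<Rightarrow> complex) \<Rightarrow> (real \<Rightarrow> complex) \<Rightarrow> real \<Rightarrow> complex" where
  "op2 m l v w w' x = \<i> * dplus l w w' x + of_real m * v x"

lemma in_l2_op [intro]:
  "wsob v v' \<Longrightarrow> wsob w w' \<Longrightarrow> in_l2 (op1 m l v v' w)"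
  "wsob v v' \<Longrightarrow> wsob w w' \<Longrightarrow> in_l2 (op2 m l v w w')"
  unfolding op1_def op2_def by (auto intro!: in_l2_add in_l2_cmult dest: wsobD)

text \<open>For \<open>l = 0\<close> the cross terms of the two expanded squares cancel. In general
  conjugation reverses the sign of \<open>l\<close>, and what survives is \<open>- 4 X\<close>,
  estimated by Cauchy-Schwarz and \<open>2 a b \<le> a\<^sup>2 + b\<^sup>2\<close>.\<close>

lemma op_coercive:
  assumes v: "wsob v v'" and w: "wsob w w'" and m: "m \<ge> 0"
  shows "(m\<^sup>2 - 2 * m * \<bar>l\<bar>) * ((l2norm v)\<^sup>2 + (l2norm w)\<^sup>2)
    \<le> (l2norm (op1 m l v v' w))\<^sup>2 + (l2norm (op2 m l v w w'))\<^sup>2"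
proof -
  note V = wsobD(1-3)[OF v] in_l2_dminus[OF v, of l] and W = wsobD(1-3)[OF w] in_l2_dplus[OF w, of l]
  define P where "P = pairing (dminus l v v') (\<lambda>x. cnj (w x))"
  define Q where "Q = pairing (dplus l w w') (\<lambda>x. cnj (v x))"
  define X where "X = m * l * Re (pairing w (\<lambda>x. cnj (v x)))"
  have 1: "(l2norm (op1 m l v v' w))\<^sup>2 = (l2norm (dminus l v v'))\<^sup>2 + m\<^sup>2 * (l2norm w)\<^sup>2 + 2 * Re (- \<i> * (m * P))"
    unfolding op1_def using V W
    by (subst l2norm_add_power2) (auto simp: P_def power_mult_distrib)
  have 2: "(l2norm (op2 m l v w w'))\<^sup>2 = (l2norm (dplus l w w'))\<^sup>2 + m\<^sup>2 * (l2norm v)\<^sup>2 + 2 * Re (\<i> * (m * Q))"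
    unfolding op2_def using V W
    by (subst l2norm_add_power2) (auto simp: Q_def power_mult_distrib)
  have "Q = - pairing w (dminus l (\<lambda>x. cnj (v x)) (\<lambda>x. cnj (v' x)))"
    unfolding Q_def by (rule pairing_dplus[OF w wsob_cnj[OF v]])
  also have "dminus l (\<lambda>x. cnj (v x)) (\<lambda>x. cnj (v' x)) = (\<lambda>x. cnj (dminus l v v' x) + (- 2 * \<i> * l) * cnj (v x))"
    by (rule ext) (simp add: dminus_cnj)
  also have "pairing w \<dots> = cnj P + (- 2 * \<i> * l) * pairing w (\<lambda>x. cnj (v x))"
    unfolding P_def pairing_cnj using V W
    by (subst pairing_add_right[OF in_l2_cnj in_l2_cmult[OF in_l2_cnj]]) (simp_all add: pairing_commute)
  finally have "Im Q = Im P + 2 * l * Re (pairing w (\<lambda>x. cnj (v x)))"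
    by simp
  then have Q: "Re (\<i> * (m * Q)) = - Re (- \<i> * (m * P)) - 2 * X"
    by (simp add: algebra_simps X_def)
  have "\<bar>Re (pairing w (\<lambda>x. cnj (v x)))\<bar> \<le> l2norm w * l2norm v"
    using pairing_bound[OF W(1) in_l2_cnj[OF V(1)]] abs_Re_le_cmod order_trans by fastforce
  then have "\<bar>X\<bar> \<le> m * \<bar>l\<bar> * (l2norm w * l2norm v)"
    using m by (simp add: X_def abs_mult mult_left_mono)
  moreover have "m * \<bar>l\<bar> * (2 * (l2norm w * l2norm v)) \<le> m * \<bar>l\<bar> * ((l2norm v)\<^sup>2 + (l2norm w)\<^sup>2)"
    using m sum_squares_bound[of "l2norm w" "l2norm v"] by (intro mult_left_mono) auto
  ultimately have X: "4 * X \<le> 2 * (m * \<bar>l\<bar> * ((l2norm v)\<^sup>2 + (l2norm w)\<^sup>2))"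
    by linarith
  define r where "r = Re (- \<i> * (of_real m * P))"
  have "(m\<^sup>2 - 2 * m * \<bar>l\<bar>) * ((l2norm v)\<^sup>2 + (l2norm w)\<^sup>2)
      = m\<^sup>2 * (l2norm w)\<^sup>2 + m\<^sup>2 * (l2norm v)\<^sup>2 - 2 * (m * \<bar>l\<bar> * ((l2norm v)\<^sup>2 + (l2norm w)\<^sup>2))"
    by (simp add: algebra_simps)
  also have "\<dots> \<le> ((l2norm (dminus l v v'))\<^sup>2 + m\<^sup>2 * (l2norm w)\<^sup>2 + 2 * r)
      + ((l2norm (dplus l w w'))\<^sup>2 + m\<^sup>2 * (l2norm v)\<^sup>2 + 2 * (- r - 2 * X))"
    using X zero_le_power2[of "l2norm (dminus l v v')"] zero_le_power2[of "l2norm (dplus l w w')"]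
    by argo
  finally show ?thesis
    unfolding 1 2 Q r_def .
qed

section \<open>Decay and regularity of weak solutions of first-order equations\<close>

lemma in_l2_set_integrable:
  assumes "in_l2 f" shows "set_integrable lborel {a..b} f"
proof -
  have "in_l2 (\<lambda>x. of_real (indicator {a..b} x))"
  proof -
    have "(\<lambda>x. (norm (of_real (indicator {a..b} x) :: complex))\<^sup>2) = (indicator {a..b} :: real \<Rightarrow> real)"
      by (auto simp: indicator_def)
    moreover have "integrable lborel (indicator {a..b} :: real \<Rightarrow> real)"
      by (simp add: integrable_indicator_iff emeasure_lborel_Icc_eq)
    ultimately have "integrable lborel (\<lambda>x. (norm (of_real (indicator {a..b} x) :: complex))\<^sup>2)"
      by (simp only:)
    then show ?thesis by (simp add: in_l2_def)
  qed
  from integrable_mult_l2[OF this assms] show ?thesis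
    by (simp add: set_integrable_def scaleR_conv_of_real)
qed

text \<open>Multiplying the equation by \<open>\<rho> (cnj f)\<close> with the cut-off weight \<open>\<rho> x = x (1 - x\<^sup>2 / N\<^sup>2)\<close> bounds
  the integral of \<open>x\<^sup>2 \<bar>f\<bar>\<^sup>2\<close> over \<open>\<bar>x\<bar> \<le> N / 2\<close> independently of \<open>N\<close>.\<close>

lemma in_l2_times_x:
  assumes f: "in_l2 f" and k: "in_l2 k" and s: "s = 1 \<or> s = (-1 :: real)"
    and ac: "ac_deriv f (\<lambda>x. k x + of_real s * (zeta l x * f x))"
  shows "in_l2 (\<lambda>x. of_real x * f x)"
proof -
  have [measurable]: "f \<in> borel_measurable borel" "k \<in> borel_measurable borel"
    using f k by (auto simp: in_l2_def)
  define C where "C = (4/3) * (\<integral>x. 2 * (norm (f x))\<^sup>2 + (norm (k x))\<^sup>2 \<partial>lborel)"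
  define F where "F = (\<lambda>N x. indicator {- real N / 2..real N / 2} x * (x\<^sup>2 * (norm (f x))\<^sup>2))"
  have ifk: "integrable lborel (\<lambda>x. 2 * (norm (f x))\<^sup>2 + (norm (k x))\<^sup>2)"
    using f k by (auto simp: in_l2_def)
  have iF: "integrable lborel (F N)" for N
  proof -
    have "integrable lborel (\<lambda>x. indicator {- real N / 2..real N / 2} x *\<^sub>R (x\<^sup>2 * (norm (f x))\<^sup>2))"
      by (intro borel_integrable_compact) (auto intro!: continuous_intros ac_deriv_continuous[OF ac])
    then show ?thesis by (simp add: F_def)
  qed
  have bound: "(\<integral>x. F N x \<partial>lborel) \<le> C" if N0: "N > 0" for N
  proof -
    \<comment> \<open>\<open>\<rho>\<close> vanishes at \<open>N\<close> and \<open>- N\<close>, so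
      there are no boundary terms. With \<open>t = x\<^sup>2 / N\<^sup>2\<close> one has
      \<open>x * \<rho> x = x\<^sup>2 * (1 - t)\<close>, which is nonnegative for
      \<open>\<bar>x\<bar> \<le> N\<close> and at least \<open>(3/4) * x\<^sup>2\<close> for
      \<open>\<bar>x\<bar> \<le> N / 2\<close>, while \<open>\<rho>' = 1 - 3 * t\<close> stays
      between -2 and 1 however large \<open>N\<close> is.\<close>
    define \<rho> where "\<rho> = (\<lambda>x. x - x ^ 3 / (real N)\<^sup>2)"
    define \<rho>' where "\<rho>' = (\<lambda>x. 1 - 3 * x\<^sup>2 / (real N)\<^sup>2)"
    define V where "V = (\<lambda>x. k x + of_real s * (zeta l x * f x))"
    define P where "P = (\<lambda>x. of_real (\<rho> x) * (f x * cnj (f x)))"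
    define P' where "P' = (\<lambda>x. of_real (\<rho>' x) * (f x * cnj (f x)) + of_real (\<rho> x) * (V x * cnj (f x) + f x * cnj (V x)))"
    have "ac_deriv (\<lambda>x. of_real (\<rho> x)) (\<lambda>x. of_real (\<rho>' x))"
    proof (rule ac_deriv_C1)
      fix x
      have "(\<rho> has_real_derivative \<rho>' x) (at x)"
        unfolding \<rho>_def \<rho>'_def using N0
        by (auto intro!: derivative_eq_intros simp: power4_eq_xxxx power2_eq_square)
      then show "((\<lambda>x. complex_of_real (\<rho> x)) has_vector_derivative of_real (\<rho>' x)) (at x)"
        by (intro has_vector_derivative_of_real) (simp add: has_real_derivative_iff_has_vector_derivative)
    qed (use N0 in \<open>auto simp: \<rho>'_def intro!: continuous_intros\<close>)
    then have acP: "ac_deriv P P'"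
      unfolding P_def P'_def using ac[folded V_def] by (intro ac_deriv_mult ac_deriv_cnj)
    have P0: "P (real N) = 0" "P (- real N) = 0"
      using N0 by (auto simp: P_def \<rho>_def power2_eq_square power3_eq_cube)
    have iP: "integrable lborel (\<lambda>x. indicator {- real N..real N} x *\<^sub>R P' x)"
      using ac_derivD(2)[OF acP] by (simp add: set_integrable_def)
    have "(\<integral>x. indicator {- real N..real N} x *\<^sub>R P' x \<partial>lborel) = 0"
      using ac_derivD(3)[OF acP, of "- real N" "real N"] P0 by (simp add: set_lebesgue_integral_def)
    \<comment> \<open>The factor \<open>s\<close> makes the dominant term
      \<open>2 * s * (x * \<rho> x * n)\<close> of the derivative positive for both signs of the
      equation.\<close>
    then have z: "(\<integral>x. s * Re (indicator {- real N..real N} x *\<^sub>R P' x) \<partial>lborel) = 0"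
      by (simp only: integral_mult_right_zero integral_Re[OF iP]) simp
    have iPs: "integrable lborel (\<lambda>x. s * Re (indicator {- real N..real N} x *\<^sub>R P' x))"
      using integrable_Re[OF iP] by (rule integrable_mult_right)
    have le: "(3/4) * F N x \<le> s * Re (indicator {- real N..real N} x *\<^sub>R P' x) + (2 * (norm (f x))\<^sup>2 + (norm (k x))\<^sup>2)" for x
    proof (cases "x \<in> {- real N..real N}")
      case False
      then have "x \<notin> {- real N / 2..real N / 2}" using N0 by auto
      with False show ?thesis by (simp add: F_def)
    next
      case True
      define t where "t = x\<^sup>2 / (real N)\<^sup>2"
      have x2: "x\<^sup>2 \<le> (real N)\<^sup>2" using True by (intro power2_le_iff_abs_le[THEN iffD2]) auto
      then have t: "0 \<le> t" "t \<le> 1" using N0 by (auto simp: t_def)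
      have \<rho>: "\<rho> x = x * (1 - t)" "\<rho>' x = 1 - 3 * t"
        by (auto simp: \<rho>_def \<rho>'_def t_def field_simps power2_eq_square power3_eq_cube)
      define A where "A = Re (P' x)"
      define n where "n = (norm (f x))\<^sup>2"
      have n0: "n \<ge> 0" by (simp add: n_def)
      have "x * \<rho> x * n = (x * x) * ((1 - t) * n)" by (simp add: \<rho> mult_ac)
      then have pos: "0 \<le> x * \<rho> x * n" using t n0 by (simp only:) simp
      have A: "A = \<rho>' x * n + 2 * \<rho> x * Re (k x * cnj (f x)) + 2 * s * (x * \<rho> x * n)"
      proof -
        have n: "n = Re (f x) * Re (f x) + Im (f x) * Im (f x)"
          by (simp only: n_def cmod_power2) (simp add: power2_eq_square)
        show ?thesis
          unfolding n by (simp add: A_def P'_def V_def zeta_def algebra_simps)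
      qed
      have b1: "s * (\<rho>' x * n) \<ge> - 2 * n"
      proof -
        have "\<bar>s * \<rho>' x\<bar> \<le> 2" using s t by (auto simp: \<rho> abs_le_iff)
        then have "- 2 \<le> s * \<rho>' x" by (simp add: abs_le_iff)
        then have "- 2 * n \<le> s * \<rho>' x * n" using n0 by (rule mult_right_mono)
        then show ?thesis by (simp add: mult.assoc)
      qed
      \<comment> \<open>Young's inequality leaves \<open>(\<rho> x)\<^sup>2 * n\<close>, which
        equals \<open>x * \<rho> x * n * (1 - t)\<close>; it uses up one of the two copies of
        \<open>x * \<rho> x * n\<close> and leaves the other for the estimate.\<close>
      have b2: "s * (2 * \<rho> x * Re (k x * cnj (f x))) \<ge> - (norm (k x))\<^sup>2 - x * \<rho> x * n"
      proof -
        define r where "r = Re (k x * cnj (f x))"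
        have "\<bar>r\<bar> \<le> norm (k x) * norm (f x)"
          unfolding r_def using abs_Re_le_cmod[of "k x * cnj (f x)"] by (simp only: norm_mult complex_mod_cnj)
        then have "2 * (\<bar>\<rho> x\<bar> * \<bar>r\<bar>) \<le> 2 * (\<bar>\<rho> x\<bar> * (norm (k x) * norm (f x)))"
          by (intro mult_left_mono) auto
        moreover have "\<bar>s * (2 * \<rho> x * r)\<bar> = 2 * (\<bar>\<rho> x\<bar> * \<bar>r\<bar>)"
          using s by (auto simp: abs_mult)
        ultimately have "\<bar>s * (2 * \<rho> x * r)\<bar> \<le> 2 * norm (k x) * (\<bar>\<rho> x\<bar> * norm (f x))"
          by (simp add: mult_ac)
        also have "\<dots> \<le> (norm (k x))\<^sup>2 + (\<bar>\<rho> x\<bar> * norm (f x))\<^sup>2"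
          by (rule sum_squares_bound)
        also have "(\<bar>\<rho> x\<bar> * norm (f x))\<^sup>2 = (x * \<rho> x * n) * (1 - t)"
          by (simp add: power_mult_distrib \<rho> n_def power2_eq_square)
        also have "\<dots> \<le> (x * \<rho> x * n) * 1"
          using t pos by (intro mult_left_mono) auto
        finally show ?thesis unfolding r_def by (simp only: abs_le_iff) linarith
      qed
      have "s * (2 * s * (x * \<rho> x * n)) = 2 * (x * \<rho> x * n)" using s by auto
      with b1 b2 have main: "x * \<rho> x * n \<le> s * A + 2 * n + (norm (k x))\<^sup>2"
        unfolding A distrib_left by argo
      have "(3/4) * F N x \<le> x * \<rho> x * n"
      proof (cases "x \<in> {- real N / 2..real N / 2}")
        case True
        then have "x\<^sup>2 \<le> (real N / 2)\<^sup>2" by (intro power2_le_iff_abs_le[THEN iffD2]) auto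
        then have "t \<le> 1 / 4" using N0 by (simp add: t_def field_simps power2_eq_square)
        then have "(3/4) * (x\<^sup>2 * n) \<le> (1 - t) * (x\<^sup>2 * n)"
          using n0 by (intro mult_right_mono) auto
        then show ?thesis using True by (simp add: F_def \<rho> n_def power2_eq_square algebra_simps)
      next
        case False
        then show ?thesis using pos by (simp add: F_def)
      qed
      with main show ?thesis using True by (simp add: A_def n_def)
    qed
    have "(\<integral>x. (3/4) * F N x \<partial>lborel)
        \<le> (\<integral>x. s * Re (indicator {- real N..real N} x *\<^sub>R P' x) + (2 * (norm (f x))\<^sup>2 + (norm (k x))\<^sup>2) \<partial>lborel)"
      by (intro integral_mono le Bochner_Integration.integrable_add iPs ifk integrable_mult_right iF)
    also have "\<dots> = (\<integral>x. 2 * (norm (f x))\<^sup>2 + (norm (k x))\<^sup>2 \<partial>lborel)"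
      by (simp only: Bochner_Integration.integral_add[OF iPs ifk] z add_0)
    finally show ?thesis by (simp add: C_def)
  qed
  have mono: "F N x \<le> F M x" if "N \<le> M" for N M x
    using that by (auto simp: F_def indicator_def)
  have "incseq (\<lambda>N. \<integral>x. F (Suc N) x \<partial>lborel)"
    by (intro incseq_SucI integral_mono iF mono) simp
  moreover have "\<forall>N. (\<integral>x. F (Suc N) x \<partial>lborel) \<le> C" using bound by simp
  ultimately obtain L where L: "(\<lambda>N. \<integral>x. F (Suc N) x \<partial>lborel) \<longlonglongrightarrow> L"
    using incseq_convergent by blast
  have "integrable lborel (\<lambda>x. x\<^sup>2 * (norm (f x))\<^sup>2)"
  proof (rule integrable_monotone_convergence[OF _ _ _ L])
    show "AE x in lborel. mono (\<lambda>N. F (Suc N) x)"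
      by (intro AE_I2 monoI mono) simp
    show "AE x in lborel. (\<lambda>N. F (Suc N) x) \<longlonglongrightarrow> x\<^sup>2 * (norm (f x))\<^sup>2"
    proof (rule AE_I2, rule tendsto_eventually)
      fix x :: real
      obtain N0 where "2 * \<bar>x\<bar> \<le> real N0" using real_arch_simple by blast
      then have "- real (Suc N) / 2 \<le> x \<and> x \<le> real (Suc N) / 2" if "N \<ge> N0" for N
        using of_nat_mono[OF that, where 'a = real] by (simp, arith)
      then have "indicator {- real (Suc N) / 2..real (Suc N) / 2} x = (1 :: real)" if "N \<ge> N0" for N
        using that by (simp only: indicator_def atLeastAtMost_iff) simp
      then have "F (Suc N) x = x\<^sup>2 * (norm (f x))\<^sup>2" if "N \<ge> N0" for N
        using that by (simp only: F_def mult_1)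
      then show "\<forall>\<^sub>F N in sequentially. F (Suc N) x = x\<^sup>2 * (norm (f x))\<^sup>2"
        by (auto simp: eventually_sequentially)
    qed
  qed (use iF in auto)
  then show ?thesis by (simp add: in_l2_def norm_mult power_mult_distrib)
qed

lemma ac_deriv_cong_AE:
  assumes "ac_deriv f f'" "AE x in lborel. f' x = g' x" "g' \<in> borel_measurable lborel"
  shows "ac_deriv f g'"
proof -
  have ae: "AE x in lborel. indicator {a..b} x *\<^sub>R f' x = indicator {a..b} x *\<^sub>R g' x" for a b :: real
    using assms(2) by eventually_elim simp
  note m = ac_derivD(1)[OF assms(1)] assms(3)
  have "integrable lborel (\<lambda>x. indicator {a..b} x *\<^sub>R f' x) = integrable lborel (\<lambda>x. indicator {a..b} x *\<^sub>R g' x)" for a b :: real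
    using m by (intro integrable_cong_AE ae) auto
  moreover have "(\<integral>x. indicator {a..b} x *\<^sub>R f' x \<partial>lborel) = (\<integral>x. indicator {a..b} x *\<^sub>R g' x \<partial>lborel)" for a b :: real
    using m by (intro integral_cong_AE ae) auto
  ultimately show ?thesis
    using assms unfolding ac_deriv_def set_integrable_def set_lebesgue_integral_def by auto
qed

lemma zeta_measurable [measurable]: "zeta l \<in> borel_measurable borel"
  unfolding zeta_def by measurable

text \<open>The right-hand side is locally integrable, so du Bois-Reymond supplies a continuous
  representative. Decay then gives \<open>x f\<close> in \<open>L2\<close>, and reading the equation
  backwards puts the derivative in \<open>L2\<close> too.\<close>

lemma weak_solution_imp_wsob:
  assumes f: "in_l2 f" and k: "in_l2 k" and s: "s = 1 \<or> s = (-1 :: real)"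
    and weak: "\<And>\<phi>. test_function \<phi> \<Longrightarrow> (\<integral>x. of_real (deriv \<phi> x) * f x \<partial>lborel)
      = - (\<integral>x. of_real (\<phi> x) * (k x + of_real s * (zeta l x * f x)) \<partial>lborel)"
  obtains g where "wsob g (\<lambda>x. k x + of_real s * (zeta l x * g x))" "AE x in lborel. f x = g x"
proof -
  have [measurable]: "f \<in> borel_measurable borel" "k \<in> borel_measurable borel"
    using f k by (auto simp: in_l2_def)
  define V where "V = (\<lambda>x. k x + of_real s * (zeta l x * f x))"
  have mV: "V \<in> borel_measurable lborel" unfolding V_def by measurable
  have "set_integrable lborel {a..b} V" for a b
  proof -
    have "set_integrable lborel {a..b} (\<lambda>x. f x * zeta l x)"
      using f by (intro set_integrable_mult_continuous in_l2_set_integrable)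
        (auto simp: zeta_def intro!: continuous_intros)
    then show ?thesis
      unfolding V_def using in_l2_set_integrable[OF k]
      by (intro set_integral_add set_integrable_mult_right) (auto simp: mult.commute)
  qed
  then obtain g where g: "ac_deriv g V" "AE x in lborel. f x = g x"
    using weak_deriv_imp_ac[of f V] mV in_l2_measurable[OF f] in_l2_set_integrable[OF f] weak
    unfolding V_def by blast
  have mg [measurable]: "g \<in> borel_measurable borel" using ac_deriv_measurable[OF g(1)] by simp
  have g2: "in_l2 g"
  proof (rule in_l2_bound[OF f])
    show "AE x in lborel. norm (g x) \<le> norm (f x)"
      using g(2) by eventually_elim simp
  qed simp
  have ac: "ac_deriv g (\<lambda>x. k x + of_real s * (zeta l x * g x))"
  proof (rule ac_deriv_cong_AE[OF g(1)])
    show "AE x in lborel. V x = k x + of_real s * (zeta l x * g x)"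
      using g(2) by eventually_elim (simp add: V_def)
  qed simp
  have "in_l2 (\<lambda>x. of_real x * g x)" by (rule in_l2_times_x[OF g2 k s ac])
  with ac g2 k have "wsob g (\<lambda>x. k x + of_real s * (zeta l x * g x))"
    unfolding wsob_def by (intro conjI in_l2_add in_l2_cmult in_l2_zeta)
  with g(2) show ?thesis by (rule that[rotated])
qed

lemma wsob_test_function:
  assumes \<phi>: "test_function \<phi>"
  shows "wsob (\<lambda>x. of_real (\<phi> x)) (\<lambda>x. of_real (deriv \<phi> x))"
proof -
  obtain M where M: "\<And>x. \<bar>x\<bar> \<ge> M \<Longrightarrow> \<phi> x = 0 \<and> deriv \<phi> x = 0"
    using test_function_support[OF \<phi>] by blast
  have l2: "in_l2 (\<lambda>x. of_real (h x))" if "continuous_on UNIV h" "\<And>x. \<bar>x\<bar> \<ge> M \<Longrightarrow> h x = 0" for h :: "real \<Rightarrow> real"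
  proof -
    have m: "h \<in> borel_measurable borel" using that(1) by (rule borel_measurable_continuous_onI)
    have "integrable lborel (\<lambda>x. indicator {-M..M} x *\<^sub>R (h x)\<^sup>2)"
      by (intro borel_integrable_compact) (auto intro!: continuous_intros continuous_on_subset[OF that(1)])
    moreover have "(\<lambda>x. indicator {-M..M} x *\<^sub>R (h x)\<^sup>2) = (\<lambda>x. (h x)\<^sup>2)"
    proof
      fix x show "indicator {-M..M} x *\<^sub>R (h x)\<^sup>2 = (h x)\<^sup>2"
        using that(2)[of x] by (cases "x \<in> {-M..M}") auto
    qed
    ultimately show ?thesis using m by (simp add: in_l2_def)
  qed
  have "in_l2 (\<lambda>x. of_real (x * \<phi> x))"
    using M test_function_C1[OF \<phi>] by (intro l2) (auto intro!: continuous_intros)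
  then show ?thesis
    using l2[of \<phi>] l2[of "deriv \<phi>"] M test_function_C1[OF \<phi>] ac_deriv_test_function[OF \<phi>]
    by (simp add: wsob_def)
qed

section \<open>Hilbert space preliminaries\<close>

text \<open>A point of the range nearest to \<open>G\<close> exists: a minimising sequence is
  Cauchy, the lower bound carries this over to the preimages, and closedness of \<open>T\<close>
  keeps the limit in the range. The residual is orthogonal to the range and hence zero.\<close>

lemma hilbert_surjective:
  fixes T :: "'a :: {real_inner, complete_space} \<Rightarrow> 'a"
  assumes D0: "0 \<in> D" and D_add: "\<And>u v. u \<in> D \<Longrightarrow> v \<in> D \<Longrightarrow> u + v \<in> D"
    and D_scale: "\<And>c u. u \<in> D \<Longrightarrow> c *\<^sub>R u \<in> D"
    and T_add: "\<And>u v. u \<in> D \<Longrightarrow> v \<in> D \<Longrightarrow> T (u + v) = T u + T v"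
    and T_scale: "\<And>c u. u \<in> D \<Longrightarrow> T (c *\<^sub>R u) = c *\<^sub>R T u"
    and bound: "\<And>u. u \<in> D \<Longrightarrow> norm u \<le> C * norm (T u)"
    and closed: "\<And>X U F. (\<And>n::nat. X n \<in> D) \<Longrightarrow> X \<longlonglongrightarrow> U \<Longrightarrow> (\<lambda>n. T (X n)) \<longlonglongrightarrow> F \<Longrightarrow> U \<in> D \<and> T U = F"
    and orth: "\<And>F. (\<And>u. u \<in> D \<Longrightarrow> inner F (T u) = 0) \<Longrightarrow> F = 0"
  shows "\<exists>u\<in>D. T u = G"
proof -
  have D_diff: "u - v \<in> D" and T_diff: "T (u - v) = T u - T v" if "u \<in> D" "v \<in> D" for u v
    using D_add[OF that(1) D_scale[OF that(2), of "-1"]] T_add[OF that(1) D_scale[OF that(2), of "-1"]]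
      T_scale[OF that(2), of "-1"] by simp_all
  define d where "d = (INF u\<in>D. norm (G - T u))"
  have bdd: "bdd_below ((\<lambda>u. norm (G - T u)) ` D)" by (intro bdd_belowI[of _ 0]) auto
  have d_le: "d \<le> norm (G - T u)" if "u \<in> D" for u
    unfolding d_def using bdd that by (rule cINF_lower)
  have d0: "0 \<le> d" unfolding d_def using D0 by (intro cINF_greatest) auto
  have "\<exists>u\<in>D. norm (G - T u) < d + e" if "e > 0" for e
  proof (rule ccontr)
    assume "\<not> ?thesis"
    then have "d + e \<le> d" unfolding d_def[symmetric]
      using D0 by (subst (2) d_def) (auto intro!: cINF_greatest simp: not_less)
    with that show False by simp
  qed
  then have "\<forall>n. \<exists>u\<in>D. norm (G - T u) < d + inverse (real (Suc n))" by simp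
  then obtain X where X: "\<And>n. X n \<in> D" "\<And>n. norm (G - T (X n)) < d + inverse (real (Suc n))"
    by metis
  \<comment> \<open>Parallelogram law: the midpoint of \<open>T (X n)\<close> and
    \<open>T (X m)\<close> lies in the range, so \<open>norm (?a + ?b) \<ge> 2 * d\<close>. This
    bounds the squared distance by \<open>4 * ((d + ?e)\<^sup>2 - d\<^sup>2)\<close>, and
    \<open>?e \<le> 1\<close> makes the result linear in \<open>?e\<close>.\<close>
  have para: "(norm (T (X n) - T (X m)))\<^sup>2 \<le> (8 * d + 4) * inverse (real (Suc N))" if "n \<ge> N" "m \<ge> N" for n m N
  proof -
    let ?a = "G - T (X n)" and ?b = "G - T (X m)" and ?e = "inverse (real (Suc N))"
    have e: "0 < ?e" "?e \<le> 1" by (auto simp: inverse_eq_divide)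
    have le: "norm (G - T (X k)) \<le> d + ?e" if "k \<ge> N" for k
    proof -
      have "inverse (real (Suc k)) \<le> ?e" using that by (intro le_imp_inverse_le) auto
      with X(2)[of k] show ?thesis by linarith
    qed
    have "2 * d \<le> 2 * norm (G - T ((1/2) *\<^sub>R (X n + X m)))"
      using d_le D_scale D_add X(1) by simp
    also have "\<dots> = norm (2 *\<^sub>R (G - T ((1/2) *\<^sub>R (X n + X m))))" by simp
    also have "2 *\<^sub>R (G - T ((1/2) *\<^sub>R (X n + X m))) = ?a + ?b"
      using T_scale[OF D_add[OF X(1) X(1)], of "1/2" n m] T_add[OF X(1) X(1), of n m]
      by (simp add: scaleR_diff_right scaleR_2)
    finally have "(2 * d)\<^sup>2 \<le> (norm (?a + ?b))\<^sup>2" using d0 by (intro power_mono) auto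
    moreover have "(norm (?a + ?b))\<^sup>2 + (norm (?a - ?b))\<^sup>2 = 2 * (norm ?a)\<^sup>2 + 2 * (norm ?b)\<^sup>2"
      by (simp only: power2_norm_eq_inner) (simp add: inner_add_left inner_add_right inner_diff_left inner_diff_right inner_commute)
    moreover have "(norm ?a)\<^sup>2 \<le> (d + ?e)\<^sup>2" "(norm ?b)\<^sup>2 \<le> (d + ?e)\<^sup>2"
      using le that by (auto intro!: power_mono)
    moreover have "(norm (?a - ?b))\<^sup>2 = (norm (T (X n) - T (X m)))\<^sup>2" by (simp add: norm_minus_commute)
    moreover have "(d + ?e)\<^sup>2 \<le> d\<^sup>2 + (2 * d + 1) * ?e"
      using e mult_left_le[of ?e ?e] by (simp only: power2_sum) (simp add: power2_eq_square algebra_simps)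
    moreover have "(2 * d)\<^sup>2 = 4 * d\<^sup>2" by (simp add: power_mult_distrib)
    ultimately have "(norm (T (X n) - T (X m)))\<^sup>2 \<le> 4 * ((2 * d + 1) * ?e)" by linarith
    then show ?thesis by (simp add: algebra_simps)
  qed
  have CT: "Cauchy (\<lambda>n. T (X n))"
  proof (rule metric_CauchyI)
    fix e :: real assume e: "e > 0"
    obtain N where N: "(8 * d + 4) / e\<^sup>2 < real N" using reals_Archimedean2 by blast
    then have "(8 * d + 4) / e\<^sup>2 < real (Suc N)" by simp
    then have small: "(8 * d + 4) * inverse (real (Suc N)) < e\<^sup>2"
      using e by (simp add: divide_simps mult.commute del: of_nat_Suc)
    have "dist (T (X m)) (T (X n)) < e" if "m \<ge> N" "n \<ge> N" for m n
      using order_le_less_trans[OF para[OF that] small] e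
      by (auto simp: dist_norm intro: power2_less_imp_less)
    then show "\<exists>M. \<forall>m\<ge>M. \<forall>n\<ge>M. dist (T (X m)) (T (X n)) < e" by blast
  qed
  then obtain F where F: "(\<lambda>n. T (X n)) \<longlonglongrightarrow> F"
    using Cauchy_convergent convergent_def by blast
  have "Cauchy X"
  proof (rule metric_CauchyI)
    fix e :: real assume e: "e > 0"
    obtain M where M: "\<forall>m\<ge>M. \<forall>n\<ge>M. dist (T (X m)) (T (X n)) < e / (\<bar>C\<bar> + 1)"
      using metric_CauchyD[OF CT, of "e / (\<bar>C\<bar> + 1)"] e by auto
    have "dist (X m) (X n) < e" if "m \<ge> M" "n \<ge> M" for m n
    proof -
      have "dist (X m) (X n) \<le> C * dist (T (X m)) (T (X n))"
        using bound[OF D_diff[OF X(1) X(1)], of m n] T_diff[OF X(1) X(1)] by (simp add: dist_norm)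
      also have "\<dots> \<le> (\<bar>C\<bar> + 1) * dist (T (X m)) (T (X n))" by (intro mult_right_mono) auto
      also have "\<dots> < e" using M that e by (simp add: pos_less_divide_eq mult.commute)
      finally show ?thesis .
    qed
    then show "\<exists>M. \<forall>m\<ge>M. \<forall>n\<ge>M. dist (X m) (X n) < e" by blast
  qed
  then obtain U where U: "X \<longlonglongrightarrow> U"
    using Cauchy_convergent convergent_def by blast
  have UF: "U \<in> D" "T U = F" using closed[OF X(1) U F] by auto
  define E where "E = G - F"
  have E_le: "norm E \<le> d"
  proof (rule LIMSEQ_le)
    show "(\<lambda>n. norm (G - T (X n))) \<longlonglongrightarrow> norm E" unfolding E_def by (intro tendsto_intros F)
    show "(\<lambda>n. d + inverse (real (Suc n))) \<longlonglongrightarrow> d"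
      using tendsto_add[OF tendsto_const LIMSEQ_inverse_real_of_nat, of d] by simp
  qed (use X(2) in \<open>auto intro: less_imp_le\<close>)
  have "inner E (T v) = 0" if v: "v \<in> D" for v
  proof (cases "T v = 0")
    case False
    \<comment> \<open>\<open>t\<close> is the coefficient of the projection of \<open>E\<close> on
      \<open>T v\<close>. Removing this projection would shorten \<open>E\<close> below the distance
      \<open>d\<close> unless the inner product vanishes.\<close>
    define t where "t = inner E (T v) / (norm (T v))\<^sup>2"
    have n: "(norm (T v))\<^sup>2 > 0" using False by simp
    have "norm E \<le> norm (E - t *\<^sub>R T v)"
      using E_le d_le[OF D_add[OF UF(1) D_scale[OF v, of t]]] T_add[OF UF(1) D_scale[OF v]] T_scale[OF v] UF(2)
      by (simp add: E_def algebra_simps)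
    then have "(norm E)\<^sup>2 \<le> (norm (E - t *\<^sub>R T v))\<^sup>2" by (intro power_mono) auto
    also have "\<dots> = (norm E)\<^sup>2 - 2 * t * inner E (T v) + t\<^sup>2 * (norm (T v))\<^sup>2"
      by (simp only: power2_norm_eq_inner)
        (simp add: inner_diff_left inner_diff_right inner_commute power2_eq_square algebra_simps)
    also have "\<dots> = (norm E)\<^sup>2 - (inner E (T v))\<^sup>2 / (norm (T v))\<^sup>2"
      using n by (simp add: t_def power2_eq_square field_simps)
    finally have "(inner E (T v))\<^sup>2 / (norm (T v))\<^sup>2 \<le> 0" by simp
    then show ?thesis using n by (simp add: divide_le_0_iff)
  qed simp
  then have "E = 0" by (rule orth)
  with UF show ?thesis by (intro bexI[of _ U]) (auto simp: E_def)
qed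

section \<open>Completeness of the space of square integrable functions\<close>

lemma AE_rep_L2_diff: "AE x in lborel. rep_L2 (U - V) x = rep_L2 U x - rep_L2 V x"
proof -
  have m: "square_integrable (\<lambda>x. (- 1) *\<^sub>R rep_L2 V x)"
    by (intro square_integrable_scaleR square_integrable_rep_L2)
  have s: "square_integrable (\<lambda>x. rep_L2 U x + (- 1) *\<^sub>R rep_L2 V x)"
    by (intro square_integrable_add square_integrable_rep_L2 m)
  have "(- 1) *\<^sub>R abs_L2 (rep_L2 V) = abs_L2 (\<lambda>x. (- 1) *\<^sub>R rep_L2 V x)"
    by (rule scaleR_L2.abs_eq) (simp add: square_integrable_rep_L2)
  moreover have "abs_L2 (rep_L2 U) + abs_L2 (\<lambda>x. (- 1) *\<^sub>R rep_L2 V x) = abs_L2 (\<lambda>x. rep_L2 U x + (- 1) *\<^sub>R rep_L2 V x)"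
    by (rule plus_L2.abs_eq) (use m in \<open>auto simp: square_integrable_rep_L2\<close>)
  ultimately have "U + (- 1) *\<^sub>R V = abs_L2 (\<lambda>x. rep_L2 U x + (- 1) *\<^sub>R rep_L2 V x)"
    by (simp only: abs_rep_L2)
  then have "U - V = abs_L2 (\<lambda>x. rep_L2 U x + (- 1) *\<^sub>R rep_L2 V x)"
    by simp
  with rep_abs_L2[OF s] show ?thesis by simp
qed

lemma nn_integral_norm_L2:
  assumes "square_integrable u"
  shows "(\<integral>\<^sup>+x. ennreal ((norm (u x))\<^sup>2) \<partial>lborel) = ennreal ((norm (abs_L2 u))\<^sup>2)"
proof -
  have "(norm (abs_L2 u))\<^sup>2 = (\<integral>x. (norm (u x))\<^sup>2 \<partial>lborel)"
    using assms by (simp only: power2_norm_eq_inner inner_abs_L2)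
  moreover have "integrable lborel (\<lambda>x. (norm (u x))\<^sup>2)"
    using assms by (simp add: square_integrable_def)
  ultimately show ?thesis by (simp add: nn_integral_eq_integral)
qed

lemma nn_integral_norm_L2_diff:
  "(\<integral>\<^sup>+x. ennreal ((norm (rep_L2 U x - rep_L2 V x))\<^sup>2) \<partial>lborel) = ennreal ((norm (U - V))\<^sup>2)"
proof -
  have "(\<integral>\<^sup>+x. ennreal ((norm (rep_L2 U x - rep_L2 V x))\<^sup>2) \<partial>lborel)
      = (\<integral>\<^sup>+x. ennreal ((norm (rep_L2 (U - V) x))\<^sup>2) \<partial>lborel)"
    by (rule nn_integral_cong_AE) (use AE_rep_L2_diff[of U V] in \<open>eventually_elim, simp\<close>)
  also have "\<dots> = ennreal ((norm (U - V))\<^sup>2)"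
    using nn_integral_norm_L2[OF square_integrable_rep_L2, of "U - V"] by (simp add: abs_rep_L2)
  finally show ?thesis .
qed

lemma rep_L2_measurable [measurable]: "rep_L2 U \<in> borel_measurable borel"
  using square_integrable_rep_L2[of U] by (simp add: square_integrable_def)

text \<open>From \<open>2 * d k \<le> (1/2) ^ k + 2 ^ k * (d k)\<^sup>2\<close>, the inequality of
  the means. Weighted squares are what an \<open>L2\<close> bound controls, plain summability is
  what pointwise convergence needs.\<close>

lemma summable_weighted_squares:
  fixes d :: "nat \<Rightarrow> real"
  assumes "\<And>k. 0 \<le> d k" "summable (\<lambda>k. 2 ^ k * (d k)\<^sup>2)"
  shows "summable d"
proof (rule summable_comparison_test')
  show "summable (\<lambda>k. (1/2) ^ k + 2 ^ k * (d k)\<^sup>2)"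
    using assms(2) by (intro summable_add summable_geometric) auto
  fix k :: nat
  have "0 \<le> ((1/2) ^ k - d k)\<^sup>2 * 2 ^ k" by simp
  also have "\<dots> = (1/2) ^ k - 2 * d k + 2 ^ k * (d k)\<^sup>2"
    by (simp add: power2_eq_square field_simps power_divide)
  finally show "norm (d k) \<le> (1/2) ^ k + 2 ^ k * (d k)\<^sup>2" using assms(1)[of k] by simp
qed

text \<open>Riesz--Fischer: a sequence with \<open>\<parallel>X (k + 1) - X k\<parallel> < 4\<^sup>-\<^sup>k\<close> converges almost everywhere, and by
  Fatou's lemma the pointwise limit is also the limit in norm.\<close>

lemma L2_fast_Cauchy_convergent:
  fixes Y :: "nat \<Rightarrow> L2"
  assumes fast: "\<And>k. norm (Y (Suc k) - Y k) < (1/4) ^ k" and C: "Cauchy Y"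
  shows "convergent Y"
proof -
  define y where "y = (\<lambda>k. rep_L2 (Y k))"
  have [measurable]: "y k \<in> borel_measurable borel" for k by (simp add: y_def)
  define d where "d = (\<lambda>k x. norm (y (Suc k) x - y k x))"
  have [measurable]: "d k \<in> borel_measurable borel" for k unfolding d_def by measurable
  \<comment> \<open>The weight \<open>2 ^ k\<close> is affordable because
    \<open>2 ^ k * ((1/4) ^ k)\<^sup>2 = (1/8) ^ k\<close>, and it allows passing from summable
    squares to summable increments at almost every point.\<close>
  have "(\<integral>\<^sup>+x. (\<Sum>k. ennreal (2 ^ k * (d k x)\<^sup>2)) \<partial>lborel) = (\<Sum>k. \<integral>\<^sup>+x. ennreal (2 ^ k * (d k x)\<^sup>2) \<partial>lborel)"
    by (intro nn_integral_suminf) measurable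
  also have "\<dots> = (\<Sum>k. ennreal (2 ^ k * (norm (Y (Suc k) - Y k))\<^sup>2))"
  proof (rule suminf_cong)
    fix k
    have "(\<integral>\<^sup>+x. ennreal (2 ^ k * (d k x)\<^sup>2) \<partial>lborel) = (\<integral>\<^sup>+x. ennreal (2 ^ k) * ennreal ((d k x)\<^sup>2) \<partial>lborel)"
      by (simp add: ennreal_mult)
    also have "\<dots> = ennreal (2 ^ k) * (\<integral>\<^sup>+x. ennreal ((d k x)\<^sup>2) \<partial>lborel)"
      by (intro nn_integral_cmult) measurable
    also have "\<dots> = ennreal (2 ^ k * (norm (Y (Suc k) - Y k))\<^sup>2)"
      unfolding d_def y_def nn_integral_norm_L2_diff by (simp add: ennreal_mult)
    finally show "(\<integral>\<^sup>+x. ennreal (2 ^ k * (d k x)\<^sup>2) \<partial>lborel) = ennreal (2 ^ k * (norm (Y (Suc k) - Y k))\<^sup>2)" .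
  qed
  also have "\<dots> < \<infinity>"
  proof -
    have "2 ^ k * (norm (Y (Suc k) - Y k))\<^sup>2 \<le> (1/8) ^ k" for k
    proof -
      have "(norm (Y (Suc k) - Y k))\<^sup>2 \<le> ((1/4) ^ k)\<^sup>2"
        using fast[of k] by (intro power_mono) auto
      then have "2 ^ k * (norm (Y (Suc k) - Y k))\<^sup>2 \<le> 2 ^ k * ((1/4) ^ k)\<^sup>2"
        by (rule mult_left_mono) simp
      also have "\<dots> = (2 * (1/4) * (1/4)) ^ k" by (simp only: power2_eq_square power_mult_distrib mult.assoc)
      finally show ?thesis by simp
    qed
    then have le: "norm (2 ^ k * (norm (Y (Suc k) - Y k))\<^sup>2) \<le> (1/8) ^ k" for k
      by simp
    have "summable (\<lambda>k. (1/8 :: real) ^ k)" by (rule summable_geometric) simp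
    then have "summable (\<lambda>k. 2 ^ k * (norm (Y (Suc k) - Y k))\<^sup>2)"
      by (rule summable_comparison_test') (rule le)
    then show ?thesis by (simp add: suminf_ennreal2)
  qed
  finally have "AE x in lborel. (\<Sum>k. ennreal (2 ^ k * (d k x)\<^sup>2)) \<noteq> \<infinity>"
    by (intro nn_integral_PInf_AE) auto
  then have conv: "AE x in lborel. convergent (\<lambda>k. y k x)"
  proof eventually_elim
    case (elim x)
    then have "summable (\<lambda>k. 2 ^ k * (d k x)\<^sup>2)"
      by (intro summable_suminf_not_top) (simp_all add: infinity_ennreal_def)
    then have "summable (\<lambda>k. d k x)"
      by (rule summable_weighted_squares[rotated]) (simp add: d_def)
    then have "summable (\<lambda>k. y (Suc k) x - y k x)"
      unfolding d_def by (rule summable_norm_cancel)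
    then have "(\<lambda>n. y 0 x + (\<Sum>k<n. y (Suc k) x - y k x)) \<longlonglongrightarrow> y 0 x + (\<Sum>k. y (Suc k) x - y k x)"
      by (intro tendsto_add tendsto_const summable_LIMSEQ)
    then have "(\<lambda>n. y n x) \<longlonglongrightarrow> y 0 x + (\<Sum>k. y (Suc k) x - y k x)"
      using sum_lessThan_telescope[of "\<lambda>k. y k x"] by simp
    then show ?case unfolding convergent_def by blast
  qed
  define f where "f = (\<lambda>x. lim (\<lambda>k. y k x))"
  have [measurable]: "f \<in> borel_measurable borel"
    unfolding f_def by (intro borel_measurable_lim_metric) measurable
  have fatou: "(\<integral>\<^sup>+x. ennreal ((norm (f x - y j x))\<^sup>2) \<partial>lborel) \<le> ennreal (e\<^sup>2)"
    if e: "e > 0" "\<And>k. k \<ge> j \<Longrightarrow> norm (Y k - Y j) \<le> e" for j e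
  proof -
    have "(\<integral>\<^sup>+x. ennreal ((norm (f x - y j x))\<^sup>2) \<partial>lborel)
        = (\<integral>\<^sup>+x. liminf (\<lambda>k. ennreal ((norm (y k x - y j x))\<^sup>2)) \<partial>lborel)"
    proof (rule nn_integral_cong_AE)
      show "AE x in lborel. ennreal ((norm (f x - y j x))\<^sup>2) = liminf (\<lambda>k. ennreal ((norm (y k x - y j x))\<^sup>2))"
        using conv
      proof eventually_elim
        case (elim x)
        then have "(\<lambda>k. y k x) \<longlonglongrightarrow> f x" by (simp add: f_def convergent_LIMSEQ_iff)
        then have "(\<lambda>k. ennreal ((norm (y k x - y j x))\<^sup>2)) \<longlonglongrightarrow> ennreal ((norm (f x - y j x))\<^sup>2)"
          by (intro tendsto_intros)
        then show ?case by (rule lim_imp_Liminf[OF sequentially_bot, symmetric])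
      qed
    qed
    also have "\<dots> \<le> liminf (\<lambda>k. \<integral>\<^sup>+x. ennreal ((norm (y k x - y j x))\<^sup>2) \<partial>lborel)"
      by (intro nn_integral_liminf) measurable
    also have "\<dots> = liminf (\<lambda>k. ennreal ((norm (Y k - Y j))\<^sup>2))"
      unfolding y_def nn_integral_norm_L2_diff ..
    also have "\<dots> \<le> ennreal (e\<^sup>2)"
    proof -
      have "\<forall>\<^sub>F k in sequentially. ennreal ((norm (Y k - Y j))\<^sup>2) \<le> ennreal (e\<^sup>2)"
        using e by (auto simp: eventually_sequentially intro!: exI[of _ j] ennreal_leI power_mono)
      then show ?thesis
        by (rule order_trans[OF Liminf_le_Limsup[OF sequentially_bot] Limsup_bounded])
    qed
    finally show ?thesis .
  qed
  obtain j0 where j0: "\<forall>m\<ge>j0. \<forall>n\<ge>j0. dist (Y m) (Y n) < 1"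
    using metric_CauchyD[OF C, of 1] by auto
  have "square_integrable (\<lambda>x. f x - y j0 x)"
  proof -
    have "(\<integral>\<^sup>+x. ennreal ((norm (f x - y j0 x))\<^sup>2) \<partial>lborel) \<le> ennreal (1\<^sup>2)"
      using j0 by (intro fatou) (auto simp: dist_norm intro: less_imp_le)
    also have "\<dots> < \<infinity>" by simp
    finally show ?thesis
      unfolding square_integrable_def by (auto intro!: integrableI_nonneg)
  qed
  from square_integrable_add[OF this square_integrable_rep_L2[of "Y j0"]]
  have sf: "square_integrable f" by (simp add: y_def)
  define U where "U = abs_L2 f"
  have "Y \<longlonglongrightarrow> U"
  proof (rule metric_LIMSEQ_I)
    fix e :: real assume e: "e > 0"
    obtain M where M: "\<forall>m\<ge>M. \<forall>n\<ge>M. dist (Y m) (Y n) < e / 2"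
      using metric_CauchyD[OF C, of "e / 2"] e by auto
    have "dist (Y j) U < e" if "j \<ge> M" for j
    proof -
      have "ennreal ((norm (U - Y j))\<^sup>2) = (\<integral>\<^sup>+x. ennreal ((norm (rep_L2 U x - y j x))\<^sup>2) \<partial>lborel)"
        unfolding y_def nn_integral_norm_L2_diff ..
      also have "\<dots> = (\<integral>\<^sup>+x. ennreal ((norm (f x - y j x))\<^sup>2) \<partial>lborel)"
        by (rule nn_integral_cong_AE) (use rep_abs_L2[OF sf] in \<open>unfold U_def, eventually_elim, simp\<close>)
      also have "\<dots> \<le> ennreal ((e / 2)\<^sup>2)"
        using M that e by (intro fatou) (auto simp: dist_norm intro: less_imp_le)
      finally have "(norm (U - Y j))\<^sup>2 \<le> (e / 2)\<^sup>2" by (simp add: ennreal_le_iff)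
      then have "norm (U - Y j) \<le> e / 2" by (rule power2_le_imp_le) (use e in simp)
      then show ?thesis using e by (simp add: dist_norm norm_minus_commute)
    qed
    then show "\<exists>no. \<forall>n\<ge>no. dist (Y n) U < e" by blast
  qed
  then show ?thesis by (auto simp: convergent_def)
qed

instance L2 :: complete_space
proof
  fix X :: "nat \<Rightarrow> L2" assume C: "Cauchy X"
  have "\<forall>k. \<exists>N. \<forall>m\<ge>N. \<forall>n\<ge>N. dist (X m) (X n) < (1/4) ^ k"
    using metric_CauchyD[OF C] by simp
  then obtain N where N: "\<And>k m n. m \<ge> N k \<Longrightarrow> n \<ge> N k \<Longrightarrow> dist (X m) (X n) < (1/4) ^ k"
    by metis
  \<comment> \<open>The running maximum keeps \<open>r k\<close> at least \<open>N k\<close>, and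
    the added \<open>k\<close> makes \<open>r\<close> strictly increasing.\<close>
  define r where "r = (\<lambda>k. k + Max (N ` {..k}))"
  have rN: "r k \<ge> N k" for k
    unfolding r_def by (rule trans_le_add2, rule Max_ge) auto
  have sm: "strict_mono r"
  proof (rule strict_monoI_Suc)
    fix k
    have "Max (N ` {..k}) \<le> Max (N ` {..Suc k})"
      by (rule Max_mono) auto
    then show "r k < r (Suc k)" unfolding r_def by linarith
  qed
  then have "r (Suc k) \<ge> N k" for k
    using rN[of k] strict_monoD[OF sm, of k "Suc k"] by simp
  then have fast: "norm (X (r (Suc k)) - X (r k)) < (1/4) ^ k" for k
    using N[of k "r (Suc k)" "r k"] rN[of k] by (simp add: dist_norm)
  have "convergent (\<lambda>k. X (r k))"
    using L2_fast_Cauchy_convergent[of "\<lambda>k. X (r k)"] fast Cauchy_subseq_Cauchy[OF C sm] by (simp add: o_def)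
  then obtain U where "(X \<circ> r) \<longlonglongrightarrow> U" by (auto simp: convergent_def o_def)
  then have "X \<longlonglongrightarrow> U" by (rule Cauchy_converges_subseq[OF C sm])
  then show "convergent X" unfolding convergent_def by blast
qed

section \<open>The Dirac operator in the variables $v$, $w$\<close>

text \<open>Inverse of the change to \<open>v = u\<^sub>1 + u\<^sub>2\<close>,
  \<open>w = u\<^sub>1 - u\<^sub>2\<close>. It is an isometry up to the factor
  \<open>1 / sqrt 2\<close>, which solution and data share, so that the resolvent norm can be read
  off from pairs.\<close>

definition pack :: "(real \<Rightarrow> complex) \<Rightarrow> (real \<Rightarrow> complex) \<Rightarrow> L2" where
  "pack v w = abs_L2 (\<lambda>x. vector [(v x + w x) / 2, (v x - w x) / 2])"

definition vpart :: "L2 \<Rightarrow> real \<Rightarrow> complex" where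
  "vpart U x = rep_L2 U x $ 1 + rep_L2 U x $ 2"

definition wpart :: "L2 \<Rightarrow> real \<Rightarrow> complex" where
  "wpart U x = rep_L2 U x $ 1 - rep_L2 U x $ 2"

lemma in_l2_divide: "in_l2 f \<Longrightarrow> in_l2 (\<lambda>x. f x / c)"
  using in_l2_cmult[of f "inverse c"] by (simp add: divide_inverse mult.commute)

lemma square_integrable_pack:
  assumes "in_l2 v" "in_l2 w"
  shows "square_integrable (\<lambda>x. vector [(v x + w x) / 2, (v x - w x) / 2])"
  unfolding square_integrable_iff vector_2 using assms by (intro conjI in_l2_divide in_l2_add in_l2_diff)

lemma in_l2_parts: "in_l2 (vpart U)" "in_l2 (wpart U)"
  using square_integrable_rep_L2[of U] unfolding square_integrable_iff vpart_def wpart_def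
  by (auto intro: in_l2_add in_l2_diff)

lemma pack_parts: "pack (vpart U) (wpart U) = U"
proof -
  have "(\<lambda>x. vector [(vpart U x + wpart U x) / 2, (vpart U x - wpart U x) / 2]) = rep_L2 U"
    by (auto simp: vpart_def wpart_def vec_eq_iff forall_2)
  then show ?thesis by (simp add: pack_def abs_rep_L2)
qed

lemma parts_pack:
  assumes "in_l2 v" "in_l2 w"
  shows "AE x in lborel. vpart (pack v w) x = v x" "AE x in lborel. wpart (pack v w) x = w x"
proof -
  have ae: "AE x in lborel. rep_L2 (pack v w) x = vector [(v x + w x) / 2, (v x - w x) / 2]"
    unfolding pack_def by (rule rep_abs_L2[OF square_integrable_pack[OF assms]])
  show "AE x in lborel. vpart (pack v w) x = v x"
    using ae by eventually_elim (simp add: vpart_def field_simps)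
  show "AE x in lborel. wpart (pack v w) x = w x"
    using ae by eventually_elim (simp add: wpart_def field_simps)
qed

lemma pack_cong:
  assumes "in_l2 v" "in_l2 w" "in_l2 v2" "in_l2 w2"
    "AE x in lborel. v x = v2 x" "AE x in lborel. w x = w2 x"
  shows "pack v w = pack v2 w2"
  unfolding pack_def
proof (subst abs_L2_eq_iff)
  show "AE x in lborel. vector [(v x + w x) / 2, (v x - w x) / 2] = (vector [(v2 x + w2 x) / 2, (v2 x - w2 x) / 2] :: complex^2)"
    using assms(5,6) by eventually_elim simp
qed (use assms in \<open>simp_all add: square_integrable_pack\<close>)

lemma norm_pack:
  assumes "in_l2 v" "in_l2 w"
  shows "(norm (pack v w))\<^sup>2 = ((l2norm v)\<^sup>2 + (l2norm w)\<^sup>2) / 2"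
proof -
  have avg: "(a + b + 2 * r) / 4 + (a + b - 2 * r) / 4 = (a + b) / 2" for a b r :: real
    by (simp add: field_simps)
  have "(norm (pack v w))\<^sup>2 = (l2norm (\<lambda>x. (1/2) * (v x + w x)))\<^sup>2 + (l2norm (\<lambda>x. (1/2) * (v x + - w x)))\<^sup>2"
    unfolding pack_def norm_abs_L2[OF square_integrable_pack[OF assms]] by simp
  also have "\<dots> = ((l2norm v)\<^sup>2 + (l2norm w)\<^sup>2) / 2"
    unfolding l2norm_cmult power_mult_distrib
      l2norm_add_power2[OF assms] l2norm_add_power2[OF assms(1) in_l2_uminus[OF assms(2)]]
    by (simp add: avg power_divide)
  finally show ?thesis .
qed

lemma pack_add:
  assumes "in_l2 v" "in_l2 w" "in_l2 v2" "in_l2 w2"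
  shows "pack v w + pack v2 w2 = pack (\<lambda>x. v x + v2 x) (\<lambda>x. w x + w2 x)"
proof -
  have "(\<lambda>x. vector [(v x + w x) / 2, (v x - w x) / 2] + vector [(v2 x + w2 x) / 2, (v2 x - w2 x) / 2] :: complex^2)
      = (\<lambda>x. vector [((v x + v2 x) + (w x + w2 x)) / 2, ((v x + v2 x) - (w x + w2 x)) / 2])"
    by (auto simp: vec_eq_iff forall_2 field_simps)
  then show ?thesis
    using assms by (simp add: pack_def plus_L2.abs_eq square_integrable_pack)
qed

lemma pack_scaleR:
  assumes "in_l2 v" "in_l2 w"
  shows "c *\<^sub>R pack v w = pack (\<lambda>x. of_real c * v x) (\<lambda>x. of_real c * w x)"
proof -
  have "(\<lambda>x. c *\<^sub>R vector [(v x + w x) / 2, (v x - w x) / 2] :: complex^2)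
      = (\<lambda>x. vector [(of_real c * v x + of_real c * w x) / 2, (of_real c * v x - of_real c * w x) / 2])"
    by (simp add: fun_eq_iff vec_eq_iff forall_2) (simp add: scaleR_conv_of_real field_simps)
  then show ?thesis
    using assms by (simp add: pack_def scaleR_L2.abs_eq square_integrable_pack)
qed

lemma pack_diff:
  assumes "in_l2 v" "in_l2 w" "in_l2 v2" "in_l2 w2"
  shows "pack v w - pack v2 w2 = pack (\<lambda>x. v x - v2 x) (\<lambda>x. w x - w2 x)"
proof -
  have "pack v w - pack v2 w2 = pack v w + (-1) *\<^sub>R pack v2 w2" by simp
  also have "\<dots> = pack (\<lambda>x. v x - v2 x) (\<lambda>x. w x - w2 x)"
    unfolding pack_scaleR[OF assms(3,4)]
    using pack_add[OF assms(1,2) in_l2_cmult[OF assms(3)] in_l2_cmult[OF assms(4)], of "-1" "-1"] by simp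
  finally show ?thesis .
qed

lemma inner_pack:
  assumes "in_l2 p" "in_l2 q" "in_l2 g" "in_l2 h"
  shows "inner (pack p q) (pack g h) = Re (pairing p (\<lambda>x. cnj (g x)) + pairing q (\<lambda>x. cnj (h x))) / 2"
proof -
  have i: "integrable lborel (\<lambda>x. p x * cnj (g x))" "integrable lborel (\<lambda>x. q x * cnj (h x))"
    using assms by (auto intro!: integrable_mult_l2)
  have "inner (pack p q) (pack g h)
      = (\<integral>x. Re ((1/2) * (p x * cnj (g x) + q x * cnj (h x))) \<partial>lborel)"
    unfolding pack_def
      inner_abs_L2[OF square_integrable_pack[OF assms(1,2)] square_integrable_pack[OF assms(3,4)]]
    by (intro Bochner_Integration.integral_cong) (simp_all add: inner_complex2 field_simps)
  also have "\<dots> = Re (\<integral>x. (1/2) * (p x * cnj (g x) + q x * cnj (h x)) \<partial>lborel)"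
    by (intro integral_Re integrable_mult_right Bochner_Integration.integrable_add i)
  also have "\<dots> = Re ((1/2) * (pairing p (\<lambda>x. cnj (g x)) + pairing q (\<lambda>x. cnj (h x))))"
    unfolding pairing_def
    by (simp only: integral_mult_right_zero Bochner_Integration.integral_add[OF i])
  finally show ?thesis by simp
qed

lemma pairing_parts_pack:
  assumes "in_l2 v" "in_l2 w" "in_l2 \<psi>"
  shows "pairing \<psi> (vpart (pack v w)) = pairing \<psi> v" "pairing \<psi> (wpart (pack v w)) = pairing \<psi> w"
  using pairing_cong_AE[OF in_l2_parts(1) assms(1,3) parts_pack(1)[OF assms(1,2)]]
    pairing_cong_AE[OF in_l2_parts(2) assms(2,3) parts_pack(2)[OF assms(1,2)]]
  by (simp_all add: pairing_commute)

lemma l2norm_parts_le: "l2norm (vpart U) \<le> 2 * norm U" "l2norm (wpart U) \<le> 2 * norm U"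
proof -
  have "(l2norm (vpart U))\<^sup>2 + (l2norm (wpart U))\<^sup>2 = 2 * (norm U)\<^sup>2"
    using norm_pack[OF in_l2_parts, of U U] by (simp add: pack_parts)
  then have "(l2norm (vpart U))\<^sup>2 \<le> 4 * (norm U)\<^sup>2" "(l2norm (wpart U))\<^sup>2 \<le> 4 * (norm U)\<^sup>2"
    using zero_le_power2[of "l2norm (vpart U)"] zero_le_power2[of "l2norm (wpart U)"] zero_le_power2[of "norm U"]
    by linarith+
  then have "(l2norm (vpart U))\<^sup>2 \<le> (2 * norm U)\<^sup>2" "(l2norm (wpart U))\<^sup>2 \<le> (2 * norm U)\<^sup>2"
    unfolding power_mult_distrib by simp_all
  then show "l2norm (vpart U) \<le> 2 * norm U" "l2norm (wpart U) \<le> 2 * norm U"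
    by (auto intro: power2_le_imp_le)
qed

lemma pairing_parts_tendsto:
  assumes "X \<longlonglongrightarrow> U" and \<psi>: "in_l2 \<psi>"
  shows "(\<lambda>n. pairing \<psi> (vpart (X n))) \<longlonglongrightarrow> pairing \<psi> (vpart U)"
    "(\<lambda>n. pairing \<psi> (wpart (X n))) \<longlonglongrightarrow> pairing \<psi> (wpart U)"
proof -
  have e: "pack (\<lambda>x. vpart (X n) x - vpart U x) (\<lambda>x. wpart (X n) x - wpart U x) = X n - U" for n
    using pack_diff[OF in_l2_parts in_l2_parts, of "X n" "X n" U U] by (simp add: pack_parts)
  have b: "norm (pairing \<psi> (vpart (X n)) - pairing \<psi> (vpart U)) \<le> norm (X n - U) * (2 * l2norm \<psi>)"
    "norm (pairing \<psi> (wpart (X n)) - pairing \<psi> (wpart U)) \<le> norm (X n - U) * (2 * l2norm \<psi>)" for n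
  proof -
    have p: "pairing \<psi> (vpart (X n - U)) = pairing \<psi> (vpart (X n)) - pairing \<psi> (vpart U)"
      "pairing \<psi> (wpart (X n - U)) = pairing \<psi> (wpart (X n)) - pairing \<psi> (wpart U)"
      unfolding e[symmetric] using in_l2_parts \<psi>
      by (simp_all add: pairing_parts_pack in_l2_diff pairing_diff_right)
    show "norm (pairing \<psi> (vpart (X n)) - pairing \<psi> (vpart U)) \<le> norm (X n - U) * (2 * l2norm \<psi>)"
      unfolding p[symmetric]
      using pairing_bound[OF \<psi> in_l2_parts(1), of "X n - U"]
        mult_left_mono[OF l2norm_parts_le(1)[of "X n - U"] l2norm_nonneg[of \<psi>]] by (simp add: mult_ac)
    show "norm (pairing \<psi> (wpart (X n)) - pairing \<psi> (wpart U)) \<le> norm (X n - U) * (2 * l2norm \<psi>)"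
      unfolding p[symmetric]
      using pairing_bound[OF \<psi> in_l2_parts(2), of "X n - U"]
        mult_left_mono[OF l2norm_parts_le(2)[of "X n - U"] l2norm_nonneg[of \<psi>]] by (simp add: mult_ac)
  qed
  have "(\<lambda>n. norm (X n - U) * (2 * l2norm \<psi>)) \<longlonglongrightarrow> 0"
    using assms(1) by (intro tendsto_mult_left_zero tendsto_norm_zero LIM_zero)
  then show "(\<lambda>n. pairing \<psi> (vpart (X n))) \<longlonglongrightarrow> pairing \<psi> (vpart U)"
    "(\<lambda>n. pairing \<psi> (wpart (X n))) \<longlonglongrightarrow> pairing \<psi> (wpart U)"
    using b by (auto intro!: LIM_zero_cancel elim!: Lim_null_comparison[rotated])
qed

section \<open>Weak derivatives and the domain in terms of the two parts\<close>

lemma vec_integral_nth: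
  fixes f :: "real \<Rightarrow> complex^2"
  assumes "integrable lborel f"
  shows "(\<integral>x. f x \<partial>lborel) $ k = (\<integral>x. f x $ k \<partial>lborel)"
  using integral_bounded_linear[OF bounded_linear_vec_nth assms, of k] by simp

lemma has_weak_deriv_iff:
  "has_weak_deriv U V \<longleftrightarrow> (\<forall>\<phi>. test_function \<phi> \<longrightarrow>
     pairing (\<lambda>x. of_real (deriv \<phi> x)) (vpart U) = - pairing (\<lambda>x. of_real (\<phi> x)) (vpart V) \<and>
     pairing (\<lambda>x. of_real (deriv \<phi> x)) (wpart U) = - pairing (\<lambda>x. of_real (\<phi> x)) (wpart V))"
proof -
  have "((\<integral>x. deriv \<phi> x *\<^sub>R rep_L2 U x \<partial>lborel) = - (\<integral>x. \<phi> x *\<^sub>R rep_L2 V x \<partial>lborel)) \<longleftrightarrow>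
     (pairing (\<lambda>x. of_real (deriv \<phi> x)) (vpart U) = - pairing (\<lambda>x. of_real (\<phi> x)) (vpart V) \<and>
     pairing (\<lambda>x. of_real (deriv \<phi> x)) (wpart U) = - pairing (\<lambda>x. of_real (\<phi> x)) (wpart V))"
    if \<phi>: "test_function \<phi>" for \<phi>
  proof -
    note w = wsob_test_function[OF \<phi>]
    have r: "in_l2 (\<lambda>x. rep_L2 U x $ k)" for U and k :: 2
      using square_integrable_rep_L2[of U] exhaust_2[of k] by (auto simp: square_integrable_iff)
    have comp: "(\<integral>x. \<psi> x *\<^sub>R rep_L2 U x \<partial>lborel) $ k = pairing (\<lambda>x. of_real (\<psi> x)) (\<lambda>x. rep_L2 U x $ k)"
      if \<psi>: "in_l2 (\<lambda>x. of_real (\<psi> x))" for \<psi> U k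
    proof (subst vec_integral_nth)
      have m: "\<psi> \<in> borel_measurable borel" "integrable lborel (\<lambda>x. (\<psi> x)\<^sup>2)"
        using \<psi> measurable_compose[of "\<lambda>x. complex_of_real (\<psi> x)" borel borel Re borel] borel_measurable_Re
        by (auto simp: in_l2_def)
      show "integrable lborel (\<lambda>x. \<psi> x *\<^sub>R rep_L2 U x)"
      proof (rule Bochner_Integration.integrable_bound)
        show "integrable lborel (\<lambda>x. (\<psi> x)\<^sup>2 + (norm (rep_L2 U x))\<^sup>2)"
          using m(2) square_integrable_rep_L2[of U] by (simp add: square_integrable_def)
        show "(\<lambda>x. \<psi> x *\<^sub>R rep_L2 U x) \<in> borel_measurable lborel"
          using m(1) by simp
        have "\<bar>a\<bar> * b \<le> a\<^sup>2 + b\<^sup>2" if "b \<ge> 0" for a b :: real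
          using sum_squares_bound[of "\<bar>a\<bar>" b] mult_nonneg_nonneg[of "\<bar>a\<bar>" b] that
          unfolding power2_abs by linarith
        then show "AE x in lborel. norm (\<psi> x *\<^sub>R rep_L2 U x) \<le> norm ((\<psi> x)\<^sup>2 + (norm (rep_L2 U x))\<^sup>2)"
          by auto
      qed
    qed (simp add: pairing_def scaleR_conv_of_real[where 'a = complex])
    have "pairing \<psi> (vpart U) = pairing \<psi> (\<lambda>x. rep_L2 U x $ 1) + pairing \<psi> (\<lambda>x. rep_L2 U x $ 2)"
      "pairing \<psi> (wpart U) = pairing \<psi> (\<lambda>x. rep_L2 U x $ 1) - pairing \<psi> (\<lambda>x. rep_L2 U x $ 2)"
      if "in_l2 \<psi>" for \<psi> U
      unfolding vpart_def wpart_def using that r by (simp_all add: pairing_add_right pairing_diff_right)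
    note parts = this[OF wsobD(1)[OF w]] this[OF wsobD(2)[OF w]]
    have arith: "(a = - c \<and> b = - d) \<longleftrightarrow> (a + b = - (c + d) \<and> a - b = - (c - d))" for a b c d :: complex
    proof
      assume *: "a + b = - (c + d) \<and> a - b = - (c - d)"
      have "2 * a = (a + b) + (a - b)" by simp
      also have "\<dots> = 2 * - c" using * by (simp only:) simp
      finally have "a = - c" by simp
      with * show "a = - c \<and> b = - d" by (auto simp: algebra_simps)
    qed (auto simp: algebra_simps)
    show ?thesis
      unfolding vec_eq_iff forall_2 parts using comp wsobD(1,2)[OF w] arith by simp
  qed
  then show ?thesis unfolding has_weak_deriv_def by blast
qed

lemma test_function_deriv: "test_function \<phi> \<Longrightarrow> test_function (deriv \<phi>)"
proof -
  assume \<phi>: "test_function \<phi>"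
  obtain M where M: "\<And>x. \<bar>x\<bar> \<ge> M \<Longrightarrow> \<phi> x = 0 \<and> deriv \<phi> x = 0"
    using test_function_support[OF \<phi>] by blast
  have "(deriv ^^ n) (deriv \<phi>) differentiable at x" for n x
  proof -
    have "(deriv ^^ Suc n) \<phi> differentiable at x" using \<phi> unfolding test_function_def by blast
    then show ?thesis by (simp only: funpow_Suc_right o_def)
  qed
  moreover have "compact (closure {x. deriv \<phi> x \<noteq> 0})"
    using M by (intro compact_closure_support[of M]) auto
  ultimately show ?thesis by (simp add: test_function_def)
qed

lemma in_l2_const_zero:
  assumes "in_l2 (\<lambda>x. c)" shows "c = 0"
proof -
  have "integrable lborel (\<lambda>x::real. of_real ((norm c)\<^sup>2) :: complex)"
    using assms unfolding in_l2_def by (intro integrable_of_real) auto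
  then have "((\<lambda>x::real. of_real ((norm c)\<^sup>2) :: complex) \<longlongrightarrow> 0) at_top"
    by (intro ac_deriv_tendsto_0_at_top[OF ac_deriv_const]) auto
  then have "(of_real ((norm c)\<^sup>2) :: complex) = 0"
    by (simp add: tendsto_const_iff)
  then show ?thesis by simp
qed

text \<open>Derivatives of test functions are test functions, so \<open>d\<close> has weak
  derivative zero and agrees almost everywhere with a constant; the only square integrable constant
  is zero.\<close>

lemma pairing_test_functions_zero:
  assumes d: "in_l2 d" and 0: "\<And>\<phi>. test_function \<phi> \<Longrightarrow> pairing (\<lambda>x. of_real (\<phi> x)) d = 0"
  shows "AE x in lborel. d x = 0"
proof -
  obtain f where f: "ac_deriv f (\<lambda>x. 0)" "AE x in lborel. d x = f x"
  proof (rule weak_deriv_imp_ac[OF in_l2_measurable[OF d] in_l2_set_integrable[OF d]])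
    show "(\<integral>x. of_real (deriv \<phi> x) * d x \<partial>lborel) = - (\<integral>x. of_real (\<phi> x) * 0 \<partial>lborel)"
      if "test_function \<phi>" for \<phi>
      using 0[OF test_function_deriv[OF that]] by (simp add: pairing_def)
  qed (auto simp: set_integrable_def)
  have "f b = f a" if "a \<le> b" for a b
    using ac_derivD(3)[OF f(1) that] by (simp add: set_lebesgue_integral_def)
  then have const: "f x = f 0" for x
    by (cases "x \<le> 0") (auto simp: not_le less_imp_le)
  have "in_l2 (\<lambda>x. f 0)"
  proof (rule in_l2_bound[OF d])
    show "AE x in lborel. norm (f 0) \<le> norm (d x)"
      using f(2)
    proof eventually_elim
      case (elim x)
      then show ?case using const[of x] by simp
    qed
  qed simp
  then have "f 0 = 0" by (rule in_l2_const_zero)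
  with f(2) const show ?thesis by simp
qed

lemma has_weak_deriv_unique:
  assumes "has_weak_deriv U V" "has_weak_deriv U W"
  shows "V = W"
proof -
  have z: "pairing (\<lambda>x. of_real (\<phi> x)) (\<lambda>x. vpart V x - vpart W x) = 0"
    "pairing (\<lambda>x. of_real (\<phi> x)) (\<lambda>x. wpart V x - wpart W x) = 0" if \<phi>: "test_function \<phi>" for \<phi>
    using assms \<phi> wsobD(1)[OF wsob_test_function[OF \<phi>]] in_l2_parts unfolding has_weak_deriv_iff
    by (simp_all add: pairing_diff_right)
  have "AE x in lborel. vpart V x - vpart W x = 0"
    by (rule pairing_test_functions_zero[OF in_l2_diff[OF in_l2_parts(1) in_l2_parts(1)] z(1)])
  moreover have "AE x in lborel. wpart V x - wpart W x = 0"
    by (rule pairing_test_functions_zero[OF in_l2_diff[OF in_l2_parts(2) in_l2_parts(2)] z(2)])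
  ultimately have "pack (vpart V) (wpart V) = pack (vpart W) (wpart W)"
    by (intro pack_cong in_l2_parts) auto
  then show ?thesis by (simp add: pack_parts)
qed

lemma weak_deriv_eq: "has_weak_deriv U V \<Longrightarrow> weak_deriv U = V"
  unfolding weak_deriv_def by (rule the_equality) (auto intro: has_weak_deriv_unique)

lemma has_weak_deriv_pack:
  assumes v: "wsob v v'" and w: "wsob w w'"
  shows "has_weak_deriv (pack v w) (pack v' w')"
  unfolding has_weak_deriv_iff
proof (intro allI impI)
  fix \<phi> assume \<phi>: "test_function \<phi>"
  note W = wsobD(1,2)[OF v] wsobD(1,2)[OF w] wsobD(1,2)[OF wsob_test_function[OF \<phi>]]
  show "pairing (\<lambda>x. of_real (deriv \<phi> x)) (vpart (pack v w)) = - pairing (\<lambda>x. of_real (\<phi> x)) (vpart (pack v' w')) \<and>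
     pairing (\<lambda>x. of_real (deriv \<phi> x)) (wpart (pack v w)) = - pairing (\<lambda>x. of_real (\<phi> x)) (wpart (pack v' w'))"
    using W wsob_parts[OF wsob_test_function[OF \<phi>] v] wsob_parts[OF wsob_test_function[OF \<phi>] w]
    by (simp add: pairing_parts_pack)
qed

lemma AE_rep_pack:
  assumes "in_l2 v" "in_l2 w"
  shows "AE x in lborel. rep_L2 (pack v w) x = vector [(v x + w x) / 2, (v x - w x) / 2]"
  unfolding pack_def by (rule rep_abs_L2[OF square_integrable_pack[OF assms]])

lemma pack_in_dom:
  assumes v: "wsob v v'" and w: "wsob w w'"
  shows "pack v w \<in> dom_airy_dirac"
proof -
  have ae: "AE x in lborel. rep_L2 (pack v w) x = vector [(v x + w x) / 2, (v x - w x) / 2]"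
    using wsobD(1) v w by (intro AE_rep_pack)
  have "in_l2 (\<lambda>x. of_real x * ((v x + w x) / 2))" "in_l2 (\<lambda>x. of_real x * ((v x - w x) / 2))"
    using in_l2_divide[OF in_l2_add[OF wsobD(3)[OF v] wsobD(3)[OF w]], of 2]
      in_l2_divide[OF in_l2_diff[OF wsobD(3)[OF v] wsobD(3)[OF w]], of 2]
    by (simp_all add: algebra_simps)
  then have "in_l2 (\<lambda>x. (x *\<^sub>R rep_L2 (pack v w) x) $ 1)" "in_l2 (\<lambda>x. (x *\<^sub>R rep_L2 (pack v w) x) $ 2)"
  proof -
    assume 1: "in_l2 (\<lambda>x. of_real x * ((v x + w x) / 2))"
    show "in_l2 (\<lambda>x. (x *\<^sub>R rep_L2 (pack v w) x) $ 1)"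
    proof (rule in_l2_bound[OF 1])
      show "AE x in lborel. norm ((x *\<^sub>R rep_L2 (pack v w) x) $ 1) \<le> norm (of_real x * ((v x + w x) / 2))"
        using ae by eventually_elim (simp add: norm_mult)
    qed measurable
  next
    assume 2: "in_l2 (\<lambda>x. of_real x * ((v x - w x) / 2))"
    show "in_l2 (\<lambda>x. (x *\<^sub>R rep_L2 (pack v w) x) $ 2)"
    proof (rule in_l2_bound[OF 2])
      show "AE x in lborel. norm ((x *\<^sub>R rep_L2 (pack v w) x) $ 2) \<le> norm (of_real x * ((v x - w x) / 2))"
        using ae by eventually_elim (simp add: norm_mult)
    qed measurable
  qed
  then have "pack v w \<in> dom_x"
    by (simp add: dom_x_def square_integrable_iff)
  with has_weak_deriv_pack[OF v w] show ?thesis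
    by (auto simp: dom_airy_dirac_def H1_def)
qed

lemma square_integrable_cong_AE:
  assumes v: "square_integrable v" and u: "u \<in> borel_measurable lborel" and ae: "AE x in lborel. u x = v x"
  shows "square_integrable u"
  unfolding square_integrable_def
proof (intro conjI u)
  have i: "integrable lborel (\<lambda>x. (norm (v x))\<^sup>2)" using v by (simp add: square_integrable_def)
  show "integrable lborel (\<lambda>x. (norm (u x))\<^sup>2)"
  proof (rule integrable_cong_AE_imp[OF i])
    show "(\<lambda>x. (norm (u x))\<^sup>2) \<in> borel_measurable lborel" using u by measurable
    show "AE x in lborel. (norm (v x))\<^sup>2 = (norm (u x))\<^sup>2" using ae by eventually_elim simp
  qed
qed

lemma airy_dirac_shift_pack:
  assumes v: "wsob v v'" and w: "wsob w w'"
  shows "airy_dirac_shift m l (pack v w) = pack (op1 m l v v' w) (op2 m l v w w')"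
proof -
  note V = wsobD(1-3)[OF v] and W = wsobD(1-3)[OF w]
  \<comment> \<open>\<open>g\<close> and \<open>h\<close> belong to the unshifted operator, hence
    the shift 0. Subtracting \<open>l\<close> times the function afterwards moves \<open>l\<close>
    into \<open>zeta\<close>.\<close>
  define g where "g = op1 m 0 v v' w"
  define h where "h = op2 m 0 v w w'"
  have gh: "in_l2 g" "in_l2 h" unfolding g_def h_def using v w by auto
  have ae1: "AE x in lborel. rep_L2 (pack v w) x = vector [(v x + w x) / 2, (v x - w x) / 2]"
    using V W by (intro AE_rep_pack)
  have ae2: "AE x in lborel. rep_L2 (pack v' w') x = vector [(v' x + w' x) / 2, (v' x - w' x) / 2]"
    using V W by (intro AE_rep_pack)
  let ?A = "\<lambda>x. (- \<i>) *s (sigma1 *v rep_L2 (weak_deriv (pack v w)) x)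
     + complex_of_real m *s (sigma3 *v rep_L2 (pack v w) x) + (\<i> * complex_of_real x) *s rep_L2 (pack v w) x"
  let ?B = "\<lambda>x. vector [(g x + h x) / 2, (g x - h x) / 2] :: complex^2"
  have ae: "AE x in lborel. ?A x = ?B x"
    using ae1 ae2 unfolding weak_deriv_eq[OF has_weak_deriv_pack[OF v w]]
  proof eventually_elim
    case (elim x)
    show ?case
      unfolding elim
      by (simp add: sigma1_mult sigma3_mult vec_eq_iff forall_2 g_def h_def op1_def op2_def dminus_def dplus_def
        zeta_def field_simps)
  qed
  have sB: "square_integrable ?B" by (rule square_integrable_pack[OF gh])
  \<comment> \<open>\<open>abs_L2\<close> identifies only square integrable functions, and agreeing
    with \<open>?B\<close> almost everywhere does not by itself make \<open>?A\<close> Borel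
    measurable.\<close>
  have "?A \<in> borel_measurable lborel"
  proof -
    have "(\<lambda>x. vector [- \<i> * (rep_L2 (weak_deriv (pack v w)) x $ 2) + of_real m * (rep_L2 (pack v w) x $ 1) + (\<i> * of_real x) * (rep_L2 (pack v w) x $ 1),
        - \<i> * (rep_L2 (weak_deriv (pack v w)) x $ 1) - of_real m * (rep_L2 (pack v w) x $ 2) + (\<i> * of_real x) * (rep_L2 (pack v w) x $ 2)] :: complex^2)
        \<in> borel_measurable lborel"
      by (intro measurable_vector2) measurable
    moreover have "(\<lambda>x. vector [- \<i> * (rep_L2 (weak_deriv (pack v w)) x $ 2) + of_real m * (rep_L2 (pack v w) x $ 1) + (\<i> * of_real x) * (rep_L2 (pack v w) x $ 1),
        - \<i> * (rep_L2 (weak_deriv (pack v w)) x $ 1) - of_real m * (rep_L2 (pack v w) x $ 2) + (\<i> * of_real x) * (rep_L2 (pack v w) x $ 2)]) = ?A"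
      by (auto simp: sigma1_mult sigma3_mult vec_eq_iff forall_2)
    ultimately show ?thesis by (simp only:)
  qed
  then have sA: "square_integrable ?A"
    by (rule square_integrable_cong_AE[OF sB _ ae])
  have "airy_dirac m (pack v w) = pack g h"
    unfolding airy_dirac_def pack_def[of g h] using abs_L2_eq_iff[OF sA sB] ae by blast
  then have "airy_dirac_shift m l (pack v w) = pack (\<lambda>x. g x - of_real l * v x) (\<lambda>x. h x - of_real l * w x)"
    unfolding airy_dirac_shift_def pack_scaleR[OF V(1) W(1)]
    using pack_diff[OF gh in_l2_cmult[OF V(1)] in_l2_cmult[OF W(1)]] by simp
  moreover have "(\<lambda>x. g x - of_real l * v x) = op1 m l v v' w" "(\<lambda>x. h x - of_real l * w x) = op2 m l v w w'"
    by (auto simp: g_def h_def op1_def op2_def dminus_def dplus_def zeta_def algebra_simps)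
  ultimately show ?thesis by simp
qed

text \<open>Du Bois-Reymond for both parts. It replaces abstract elements of the domain by
  absolutely continuous pairs, on which all estimates are carried out.\<close>

lemma dom_airy_diracE:
  assumes "U \<in> dom_airy_dirac"
  obtains v v' w w' where "wsob v v'" "wsob w w'" "U = pack v w"
proof -
  obtain V where V: "has_weak_deriv U V" and x: "square_integrable (\<lambda>x. x *\<^sub>R rep_L2 U x)"
    using assms by (auto simp: dom_airy_dirac_def H1_def dom_x_def)
  have ex: "\<exists>f. wsob f b \<and> (AE x in lborel. a x = f x)"
    if a: "in_l2 a" "in_l2 (\<lambda>x. of_real x * a x)" and b: "in_l2 b"
      and weak: "\<And>\<phi>. test_function \<phi> \<Longrightarrow> pairing (\<lambda>x. of_real (deriv \<phi> x)) a = - pairing (\<lambda>x. of_real (\<phi> x)) b" for a b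
  proof -
    obtain f where f: "ac_deriv f b" "AE x in lborel. a x = f x"
      using weak_deriv_imp_ac[OF in_l2_measurable[OF a(1)] in_l2_set_integrable[OF a(1)]
          in_l2_measurable[OF b] in_l2_set_integrable[OF b]] weak
      unfolding pairing_def by blast
    have m: "f \<in> borel_measurable borel" using ac_deriv_measurable[OF f(1)] by simp
    have "in_l2 f" by (rule in_l2_bound[OF a(1)]) (use f(2) m in \<open>auto elim!: eventually_mono\<close>)
    moreover have "in_l2 (\<lambda>x. of_real x * f x)"
      by (rule in_l2_bound[OF a(2)]) (use f(2) m in \<open>auto elim!: eventually_mono\<close>)
    ultimately show ?thesis using f b by (auto simp: wsob_def)
  qed
  have "in_l2 (\<lambda>x. of_real x * rep_L2 U x $ 1)" "in_l2 (\<lambda>x. of_real x * rep_L2 U x $ 2)"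
    using x by (simp_all add: square_integrable_iff scaleR_conv_of_real[where 'a = complex])
  then have xp: "in_l2 (\<lambda>x. of_real x * vpart U x)" "in_l2 (\<lambda>x. of_real x * wpart U x)"
    unfolding vpart_def wpart_def distrib_left right_diff_distrib by auto
  obtain v where v: "wsob v (vpart V)" "AE x in lborel. vpart U x = v x"
    using ex[OF in_l2_parts(1) xp(1) in_l2_parts(1)] V unfolding has_weak_deriv_iff by blast
  obtain w where w: "wsob w (wpart V)" "AE x in lborel. wpart U x = w x"
    using ex[OF in_l2_parts(2) xp(2) in_l2_parts(2)] V unfolding has_weak_deriv_iff by blast
  have "U = pack v w"
    using pack_cong[OF in_l2_parts wsobD(1)[OF v(1)] wsobD(1)[OF w(1)] v(2) w(2)] by (simp add: pack_parts)
  with v(1) w(1) show ?thesis by (rule that)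
qed

section \<open>Bounded invertibility\<close>

text \<open>Weak form of \<open>D\<^sub>- v = i (g - m w)\<close> and \<open>D\<^sub>+ w = - i (h - m v)\<close>, stated through pairings with fixed
  square integrable functions so that it passes to limits.\<close>

definition weak_system :: "real \<Rightarrow> real \<Rightarrow> L2 \<Rightarrow> L2 \<Rightarrow> bool" where
  "weak_system m l U F \<longleftrightarrow> (\<forall>\<phi>. test_function \<phi> \<longrightarrow>
     pairing (\<lambda>x. of_real (deriv \<phi> x)) (vpart U) =
       - (pairing (\<lambda>x. zeta l x * of_real (\<phi> x)) (vpart U)
          + \<i> * (pairing (\<lambda>x. of_real (\<phi> x)) (vpart F) - of_real m * pairing (\<lambda>x. of_real (\<phi> x)) (wpart U))) \<and>
     pairing (\<lambda>x. of_real (deriv \<phi> x)) (wpart U) =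
       pairing (\<lambda>x. zeta l x * of_real (\<phi> x)) (wpart U)
          + \<i> * (pairing (\<lambda>x. of_real (\<phi> x)) (wpart F) - of_real m * pairing (\<lambda>x. of_real (\<phi> x)) (vpart U)))"

lemma pairing_zeta: "pairing (\<lambda>x. zeta l x * f x) g = pairing f (\<lambda>x. zeta l x * g x)"
  by (simp add: pairing_def mult_ac)

lemma pairing_affine:
  assumes "in_l2 f" "in_l2 g" "in_l2 h"
  shows "pairing f (\<lambda>x. c * (g x - d * h x)) = c * (pairing f g - d * pairing f h)"
    "in_l2 (\<lambda>x. c * (g x - d * h x))"
proof -
  have "pairing f (\<lambda>x. g x - d * h x) = pairing f g - d * pairing f h"
    using pairing_diff_right[OF assms(2) in_l2_cmult[OF assms(3)] assms(1), of d] by simp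
  then show "pairing f (\<lambda>x. c * (g x - d * h x)) = c * (pairing f g - d * pairing f h)"
    by (simp only: pairing_cmult_right)
  show "in_l2 (\<lambda>x. c * (g x - d * h x))"
    by (rule in_l2_cmult[OF in_l2_diff[OF assms(2) in_l2_cmult[OF assms(3)]]])
qed

lemma weak_system_pack:
  assumes v: "wsob v v'" and w: "wsob w w'"
  shows "weak_system m l (pack v w) (pack (op1 m l v v' w) (op2 m l v w w'))"
  unfolding weak_system_def
proof (intro allI impI, goal_cases)
  case \<phi>: (1 \<phi>)
  note w\<phi> = wsob_test_function[OF \<phi>]
  note \<Phi> = wsobD(1,2)[OF w\<phi>] in_l2_zeta[OF wsobD(1,3)[OF w\<phi>]]
  note V = wsobD(1,2)[OF v] in_l2_zeta[OF wsobD(1,3)[OF v], of l]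
  note W = wsobD(1,2)[OF w] in_l2_zeta[OF wsobD(1,3)[OF w], of l]
  define g where "g = op1 m l v v' w"
  define h where "h = op2 m l v w w'"
  have gh: "in_l2 g" "in_l2 h" unfolding g_def h_def using v w by auto
  have v': "v' = (\<lambda>x. zeta l x * v x + \<i> * (g x - of_real m * w x))"
    by (auto simp: g_def op1_def dminus_def algebra_simps)
  have w': "w' = (\<lambda>x. - (zeta l x * w x) - \<i> * (h x - of_real m * v x))"
    by (auto simp: h_def op2_def dplus_def algebra_simps)
  let ?\<phi> = "\<lambda>x. complex_of_real (\<phi> x)"
  have 1: "pairing ?\<phi> v' = pairing ?\<phi> (\<lambda>x. zeta l x * v x) + \<i> * (pairing ?\<phi> g - of_real m * pairing ?\<phi> w)"
    unfolding v'
    by (simp only: pairing_add_right[OF V(3) pairing_affine(2)[OF \<Phi>(1) gh(1) W(1)] \<Phi>(1)]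
        pairing_affine(1)[OF \<Phi>(1) gh(1) W(1)])
  have 2: "pairing ?\<phi> w' = - pairing ?\<phi> (\<lambda>x. zeta l x * w x) - \<i> * (pairing ?\<phi> h - of_real m * pairing ?\<phi> v)"
    unfolding w'
    by (simp only: pairing_diff_right[OF in_l2_uminus[OF W(3)] pairing_affine(2)[OF \<Phi>(1) gh(2) V(1)] \<Phi>(1)]
        pairing_affine(1)[OF \<Phi>(1) gh(2) V(1)] pairing_uminus_right)
  show ?case
    unfolding g_def[symmetric] h_def[symmetric]
    unfolding pairing_parts_pack[OF V(1) W(1) \<Phi>(1)] pairing_parts_pack[OF V(1) W(1) \<Phi>(2)]
      pairing_parts_pack[OF V(1) W(1) \<Phi>(3)] pairing_parts_pack[OF gh \<Phi>(1)]
    using wsob_parts[OF w\<phi> v] wsob_parts[OF w\<phi> w] 1 2 by (simp add: pairing_zeta)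
qed

text \<open>The terms with \<open>F\<close> and with the other component form a square integrable
  source, so each part solves a scalar equation covered by \<open>weak_solution_imp_wsob\<close>,
  with sign 1 for \<open>v\<close> and -1 for \<open>w\<close>. Membership in the domain is a
  conclusion and not a hypothesis.\<close>

lemma weak_system_imp_solution:
  assumes ws: "weak_system m l U F"
  shows "U \<in> dom_airy_dirac \<and> airy_dirac_shift m l U = F"
proof -
  define k1 where "k1 = (\<lambda>x. \<i> * (vpart F x - of_real m * wpart U x))"
  define k2 where "k2 = (\<lambda>x. - (\<i> * (wpart F x - of_real m * vpart U x)))"
  have k: "in_l2 k1" "in_l2 k2"
    unfolding k1_def k2_def
    by (rule pairing_affine(2)[OF in_l2_parts(1,1,2)], rule in_l2_uminus, rule pairing_affine(2)[OF in_l2_parts(1,2,1)])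
  have loc: "pairing (\<lambda>x. of_real (\<phi> x)) (\<lambda>x. k x + of_real s * (zeta l x * f x))
      = pairing (\<lambda>x. of_real (\<phi> x)) k + of_real s * pairing (\<lambda>x. zeta l x * of_real (\<phi> x)) f"
    if \<phi>: "test_function \<phi>" and f: "in_l2 f" and k: "in_l2 k" for \<phi> f k and s :: real
  proof -
    note w = wsob_test_function[OF \<phi>]
    have "integrable lborel (\<lambda>x. of_real (\<phi> x) * k x)"
      by (rule integrable_mult_l2[OF wsobD(1)[OF w] k])
    moreover have "integrable lborel (\<lambda>x. of_real s * (zeta l x * of_real (\<phi> x) * f x))"
      by (intro integrable_mult_right integrable_mult_l2 in_l2_zeta wsobD(1,3)[OF w] f)
    ultimately have "(\<integral>x. of_real (\<phi> x) * k x + of_real s * (zeta l x * of_real (\<phi> x) * f x) \<partial>lborel)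
        = pairing (\<lambda>x. of_real (\<phi> x)) k + of_real s * pairing (\<lambda>x. zeta l x * of_real (\<phi> x)) f"
      unfolding pairing_def by (simp only: Bochner_Integration.integral_add integral_mult_right_zero)
    then show ?thesis by (simp add: pairing_def algebra_simps)
  qed
  have kp: "pairing \<psi> k1 = \<i> * (pairing \<psi> (vpart F) - of_real m * pairing \<psi> (wpart U))"
    "pairing \<psi> k2 = - (\<i> * (pairing \<psi> (wpart F) - of_real m * pairing \<psi> (vpart U)))" if "in_l2 \<psi>" for \<psi>
    unfolding k1_def k2_def pairing_uminus_right
    by (simp_all only: pairing_affine(1)[OF that in_l2_parts(1,2)] pairing_affine(1)[OF that in_l2_parts(2,1)])
  obtain v where v: "wsob v (\<lambda>x. k1 x + of_real 1 * (zeta l x * v x))" "AE x in lborel. vpart U x = v x"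
  proof (rule weak_solution_imp_wsob[OF in_l2_parts(1)[of U] k(1), of 1 l])
    fix \<phi> assume \<phi>: "test_function \<phi>"
    show "(\<integral>x. of_real (deriv \<phi> x) * vpart U x \<partial>lborel)
      = - (\<integral>x. of_real (\<phi> x) * (k1 x + of_real 1 * (zeta l x * vpart U x)) \<partial>lborel)"
      using ws \<phi> loc[OF \<phi> in_l2_parts(1)[of U] k(1), of 1] kp(1)[OF wsobD(1)[OF wsob_test_function[OF \<phi>]]]
      unfolding weak_system_def by (simp add: pairing_def)
  qed simp_all
  obtain w where w: "wsob w (\<lambda>x. k2 x + of_real (-1) * (zeta l x * w x))" "AE x in lborel. wpart U x = w x"
  proof (rule weak_solution_imp_wsob[OF in_l2_parts(2)[of U] k(2), of "-1" l])
    fix \<phi> assume \<phi>: "test_function \<phi>"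
    show "(\<integral>x. of_real (deriv \<phi> x) * wpart U x \<partial>lborel)
      = - (\<integral>x. of_real (\<phi> x) * (k2 x + of_real (-1) * (zeta l x * wpart U x)) \<partial>lborel)"
      using ws \<phi> loc[OF \<phi> in_l2_parts(2)[of U] k(2), of "-1"] kp(2)[OF wsobD(1)[OF wsob_test_function[OF \<phi>]]]
      unfolding weak_system_def by (simp add: pairing_def)
  qed simp_all
  have U: "U = pack v w"
    using pack_cong[OF in_l2_parts wsobD(1)[OF v(1)] wsobD(1)[OF w(1)] v(2) w(2)] by (simp add: pack_parts)
  have e: "op1 m l v (\<lambda>x. k1 x + of_real 1 * (zeta l x * v x)) w = (\<lambda>x. vpart F x + of_real m * (w x - wpart U x))"
    "op2 m l v w (\<lambda>x. k2 x + of_real (-1) * (zeta l x * w x)) = (\<lambda>x. wpart F x + of_real m * (v x - vpart U x))"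
    by (auto simp: op1_def op2_def dminus_def dplus_def k1_def k2_def algebra_simps)
  have "pack (op1 m l v (\<lambda>x. k1 x + of_real 1 * (zeta l x * v x)) w) (op2 m l v w (\<lambda>x. k2 x + of_real (-1) * (zeta l x * w x)))
      = pack (vpart F) (wpart F)"
  proof (rule pack_cong[OF in_l2_op(1)[OF v(1) w(1)] in_l2_op(2)[OF v(1) w(1)] in_l2_parts])
    show "AE x in lborel. op1 m l v (\<lambda>x. k1 x + of_real 1 * (zeta l x * v x)) w x = vpart F x"
      unfolding e using w(2) by eventually_elim simp
    show "AE x in lborel. op2 m l v w (\<lambda>x. k2 x + of_real (-1) * (zeta l x * w x)) x = wpart F x"
      unfolding e using v(2) by eventually_elim simp
  qed
  then show ?thesis
    using pack_in_dom[OF v(1) w(1)] airy_dirac_shift_pack[OF v(1) w(1), of m l] U by (simp add: pack_parts)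
qed

lemma solution_imp_weak_system:
  assumes "U \<in> dom_airy_dirac" shows "weak_system m l U (airy_dirac_shift m l U)"
  using assms
proof (rule dom_airy_diracE)
  fix v v' w w' assume "wsob v v'" "wsob w w'" "U = pack v w"
  then show ?thesis using weak_system_pack[of v v' w w' m l] airy_dirac_shift_pack[of v v' w w' m l] by simp
qed

text \<open>Together with \<open>weak_system_imp_solution\<close> this is closedness of the
  operator: every term pairs a part of \<open>X n\<close> or \<open>Y n\<close> with a fixed square
  integrable function and so converges.\<close>

lemma weak_system_limit:
  assumes X: "X \<longlonglongrightarrow> U" and Y: "Y \<longlonglongrightarrow> F" and ws: "\<And>n. weak_system m l (X n) (Y n)"
  shows "weak_system m l U F"
  unfolding weak_system_def
proof (intro allI impI, goal_cases)
  case \<phi>: (1 \<phi>)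
  note w\<phi> = wsob_test_function[OF \<phi>]
  note lim = pairing_parts_tendsto[OF X wsobD(1)[OF w\<phi>]] pairing_parts_tendsto[OF X wsobD(2)[OF w\<phi>]]
    pairing_parts_tendsto[OF X in_l2_zeta[OF wsobD(1,3)[OF w\<phi>], of l]] pairing_parts_tendsto[OF Y wsobD(1)[OF w\<phi>]]
  have "(\<lambda>n. pairing (\<lambda>x. of_real (deriv \<phi> x)) (vpart (X n))) \<longlonglongrightarrow>
     - (pairing (\<lambda>x. zeta l x * of_real (\<phi> x)) (vpart U)
        + \<i> * (pairing (\<lambda>x. of_real (\<phi> x)) (vpart F) - of_real m * pairing (\<lambda>x. of_real (\<phi> x)) (wpart U)))"
    using ws \<phi> unfolding weak_system_def by (simp add: tendsto_intros lim)
  note v = LIMSEQ_unique[OF lim(3) this]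
  have "(\<lambda>n. pairing (\<lambda>x. of_real (deriv \<phi> x)) (wpart (X n))) \<longlonglongrightarrow>
     pairing (\<lambda>x. zeta l x * of_real (\<phi> x)) (wpart U)
        + \<i> * (pairing (\<lambda>x. of_real (\<phi> x)) (wpart F) - of_real m * pairing (\<lambda>x. of_real (\<phi> x)) (vpart U))"
    using ws \<phi> unfolding weak_system_def by (simp add: tendsto_intros lim)
  note w = LIMSEQ_unique[OF lim(4) this]
  show ?case by (intro conjI v w)
qed

text \<open>The adjoint of the operator is its complex conjugate with the roles of \<open>v\<close> and \<open>w\<close> exchanged.\<close>

lemma orthogonal_imp_weak_system:
  assumes orth: "\<And>U. U \<in> dom_airy_dirac \<Longrightarrow> inner E (airy_dirac_shift m l U) = 0"
  shows "weak_system m l (pack (\<lambda>x. cnj (wpart E x)) (\<lambda>x. cnj (vpart E x))) (pack (\<lambda>x. 0) (\<lambda>x. 0))"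
  unfolding weak_system_def
proof (intro allI impI, goal_cases)
  case \<phi>: (1 \<phi>)
  note w\<phi> = wsob_test_function[OF \<phi>]
  let ?\<phi> = "\<lambda>x. complex_of_real (\<phi> x)" and ?\<phi>' = "\<lambda>x. complex_of_real (deriv \<phi> x)"
  note \<Phi> = wsobD(1,2)[OF w\<phi>] in_l2_zeta[OF wsobD(1,3)[OF w\<phi>], of l]
  define p where "p = vpart E"
  define q where "q = wpart E"
  have pq: "in_l2 p" "in_l2 q" "E = pack p q" by (simp_all add: p_def q_def in_l2_parts pack_parts)
  have z0: "wsob (\<lambda>x. 0) (\<lambda>x. 0)" using wsob_cmult[OF w\<phi>, of 0] by simp
  have cd: "cnj (pairing \<psi> f) = pairing (\<lambda>x. cnj (\<psi> x)) (\<lambda>x. cnj (f x))" for \<psi> f by (rule pairing_cnj)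
  let ?P = "\<lambda>x. cnj (p x)" and ?Q = "\<lambda>x. cnj (q x)"
  have 1: "- \<i> * (pairing ?\<phi>' ?P - pairing (\<lambda>x. zeta l x * ?\<phi> x) ?P) + of_real m * pairing ?\<phi> ?Q = 0" (is "?B = 0")
  proof -
    \<comment> \<open>\<open>inner\<close> sees real parts only. Multiplying the test function by a
      complex constant, with the values 1 and \<open>\<i>\<close>, recovers the whole complex
      identity.\<close>
    have "Re (c * ?B) = 0" for c
    proof -
      note wc = wsob_cmult[OF w\<phi>, of c]
      have "Re (pairing p (\<lambda>x. cnj (op1 m l (\<lambda>x. c * ?\<phi> x) (\<lambda>x. c * ?\<phi>' x) (\<lambda>x. 0) x))
          + pairing q (\<lambda>x. cnj (op2 m l (\<lambda>x. c * ?\<phi> x) (\<lambda>x. 0) (\<lambda>x. 0) x))) = 0"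
        using orth[OF pack_in_dom[OF wc z0]]
        unfolding airy_dirac_shift_pack[OF wc z0] pq(3)
          inner_pack[OF pq(1,2) in_l2_op[OF wc z0]] by simp
      moreover have "op1 m l (\<lambda>x. c * ?\<phi> x) (\<lambda>x. c * ?\<phi>' x) (\<lambda>x. 0) = (\<lambda>x. (c * - \<i>) * (?\<phi>' x - zeta l x * ?\<phi> x))"
        "op2 m l (\<lambda>x. c * ?\<phi> x) (\<lambda>x. 0) (\<lambda>x. 0) = (\<lambda>x. (c * of_real m) * ?\<phi> x)"
        by (auto simp: op1_def op2_def dminus_def dplus_def algebra_simps)
      moreover have "pairing (\<lambda>x. (c * - \<i>) * (?\<phi>' x - zeta l x * ?\<phi> x)) ?P
          = (c * - \<i>) * (pairing ?\<phi>' ?P - pairing (\<lambda>x. zeta l x * ?\<phi> x) ?P)"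
        using \<Phi> pq by (simp only: pairing_cmult_left) (simp add: pairing_diff_left in_l2_cnj)
      moreover have "pairing (\<lambda>x. (c * of_real m) * ?\<phi> x) ?Q = (c * of_real m) * pairing ?\<phi> ?Q"
        by (rule pairing_cmult_left)
      moreover have "Re (pairing p (\<lambda>x. cnj (a x)) + pairing q (\<lambda>x. cnj (b x))) = Re (pairing a ?P + pairing b ?Q)" for a b
        using arg_cong[OF cd[of a ?P], of Re] arg_cong[OF cd[of b ?Q], of Re] by (simp add: pairing_commute)
      ultimately have "Re ((c * - \<i>) * (pairing ?\<phi>' ?P - pairing (\<lambda>x. zeta l x * ?\<phi> x) ?P) + (c * of_real m) * pairing ?\<phi> ?Q) = 0"
        by (simp only:)
      then show ?thesis by (simp only: distrib_left mult.assoc)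
    qed
    from this[of 1] this[of "\<i>"] show ?thesis by (simp add: complex_eq_iff)
  qed
  have 2: "\<i> * (pairing ?\<phi>' ?Q + pairing (\<lambda>x. zeta l x * ?\<phi> x) ?Q) + of_real m * pairing ?\<phi> ?P = 0" (is "?B = 0")
  proof -
    have "Re (c * ?B) = 0" for c
    proof -
      note wc = wsob_cmult[OF w\<phi>, of c]
      have "Re (pairing p (\<lambda>x. cnj (op1 m l (\<lambda>x. 0) (\<lambda>x. 0) (\<lambda>x. c * ?\<phi> x) x))
          + pairing q (\<lambda>x. cnj (op2 m l (\<lambda>x. 0) (\<lambda>x. c * ?\<phi> x) (\<lambda>x. c * ?\<phi>' x) x))) = 0"
        using orth[OF pack_in_dom[OF z0 wc]]
        unfolding airy_dirac_shift_pack[OF z0 wc] pq(3)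
          inner_pack[OF pq(1,2) in_l2_op[OF z0 wc]] by simp
      moreover have "op2 m l (\<lambda>x. 0) (\<lambda>x. c * ?\<phi> x) (\<lambda>x. c * ?\<phi>' x) = (\<lambda>x. (c * \<i>) * (?\<phi>' x + zeta l x * ?\<phi> x))"
        "op1 m l (\<lambda>x. 0) (\<lambda>x. 0) (\<lambda>x. c * ?\<phi> x) = (\<lambda>x. (c * of_real m) * ?\<phi> x)"
        by (auto simp: op1_def op2_def dminus_def dplus_def algebra_simps)
      moreover have "pairing (\<lambda>x. (c * \<i>) * (?\<phi>' x + zeta l x * ?\<phi> x)) ?Q
          = (c * \<i>) * (pairing ?\<phi>' ?Q + pairing (\<lambda>x. zeta l x * ?\<phi> x) ?Q)"
        using \<Phi> pq by (simp only: pairing_cmult_left) (simp add: pairing_add_left in_l2_cnj)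
      moreover have "pairing (\<lambda>x. (c * of_real m) * ?\<phi> x) ?P = (c * of_real m) * pairing ?\<phi> ?P"
        by (rule pairing_cmult_left)
      moreover have "Re (pairing p (\<lambda>x. cnj (a x)) + pairing q (\<lambda>x. cnj (b x))) = Re (pairing b ?Q + pairing a ?P)" for a b
        using arg_cong[OF cd[of a ?P], of Re] arg_cong[OF cd[of b ?Q], of Re] by (simp add: pairing_commute)
      ultimately have "Re ((c * \<i>) * (pairing ?\<phi>' ?Q + pairing (\<lambda>x. zeta l x * ?\<phi> x) ?Q) + (c * of_real m) * pairing ?\<phi> ?P) = 0"
        by (simp only:)
      then show ?thesis by (simp only: distrib_left mult.assoc)
    qed
    from this[of 1] this[of "\<i>"] show ?thesis by (simp add: complex_eq_iff)
  qed
  have PQ: "in_l2 ?P" "in_l2 ?Q" using pq by auto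
  have z: "pairing ?\<phi> (\<lambda>x. 0) = 0" by (simp add: pairing_def)
  show ?case
    unfolding p_def[symmetric] q_def[symmetric] pairing_parts_pack[OF PQ(2,1) \<Phi>(1)] pairing_parts_pack[OF PQ(2,1) \<Phi>(2)]
      pairing_parts_pack[OF PQ(2,1) \<Phi>(3)] pairing_parts_pack[OF in_l2_zero in_l2_zero \<Phi>(1)] z
    using 1 2 by (auto simp: complex_eq_iff)
qed

section \<open>From a lower bound to a bounded inverse\<close>

lemma dom_airy_dirac_add:
  assumes "U \<in> dom_airy_dirac" "V \<in> dom_airy_dirac"
  shows "U + V \<in> dom_airy_dirac" "airy_dirac_shift m l (U + V) = airy_dirac_shift m l U + airy_dirac_shift m l V"
proof -
  obtain v v' w w' where U: "wsob v v'" "wsob w w'" "U = pack v w" using assms(1) by (rule dom_airy_diracE)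
  obtain a a' b b' where V: "wsob a a'" "wsob b b'" "V = pack a b" using assms(2) by (rule dom_airy_diracE)
  have e: "U + V = pack (\<lambda>x. v x + a x) (\<lambda>x. w x + b x)"
    using U V by (simp add: pack_add wsobD(1))
  note S = wsob_add[OF U(1) V(1)] wsob_add[OF U(2) V(2)]
  show "U + V \<in> dom_airy_dirac" unfolding e by (rule pack_in_dom[OF S])
  show "airy_dirac_shift m l (U + V) = airy_dirac_shift m l U + airy_dirac_shift m l V"
    unfolding e airy_dirac_shift_pack[OF S]
    unfolding U(3) V(3) airy_dirac_shift_pack[OF U(1,2)] airy_dirac_shift_pack[OF V(1,2)]
      pack_add[OF in_l2_op[OF U(1,2)] in_l2_op[OF V(1,2)]]
    by (simp add: op1_def[abs_def] op2_def[abs_def] dminus_def dplus_def algebra_simps)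
qed

lemma dom_airy_dirac_scaleR:
  assumes "U \<in> dom_airy_dirac"
  shows "c *\<^sub>R U \<in> dom_airy_dirac" "airy_dirac_shift m l (c *\<^sub>R U) = c *\<^sub>R airy_dirac_shift m l U"
proof -
  obtain v v' w w' where U: "wsob v v'" "wsob w w'" "U = pack v w" using assms(1) by (rule dom_airy_diracE)
  have e: "c *\<^sub>R U = pack (\<lambda>x. of_real c * v x) (\<lambda>x. of_real c * w x)"
    using U by (simp add: pack_scaleR wsobD(1))
  note S = wsob_cmult[OF U(1), of "of_real c"] wsob_cmult[OF U(2), of "of_real c"]
  show "c *\<^sub>R U \<in> dom_airy_dirac" unfolding e by (rule pack_in_dom[OF S])
  show "airy_dirac_shift m l (c *\<^sub>R U) = c *\<^sub>R airy_dirac_shift m l U"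
    unfolding e airy_dirac_shift_pack[OF S]
    unfolding U(3) airy_dirac_shift_pack[OF U(1,2)]
      pack_scaleR[OF in_l2_op[OF U(1,2)]]
    by (simp add: op1_def[abs_def] op2_def[abs_def] dminus_def dplus_def algebra_simps)
qed

definition dirac_bound :: "real \<Rightarrow> real \<Rightarrow> real \<Rightarrow> bool" where
  "dirac_bound m l C \<longleftrightarrow> (\<forall>U\<in>dom_airy_dirac. norm U \<le> C * norm (airy_dirac_shift m l U))"

text \<open>One lower bound gives injectivity and surjectivity at once: conjugation and exchange of
  the parts send a vector orthogonal to the range, without changing its norm, into the kernel of the
  same operator with the same \<open>l\<close>.\<close>

lemma dirac_surjective:
  assumes b: "dirac_bound m l C"
  shows "\<exists>U\<in>dom_airy_dirac. airy_dirac_shift m l U = G"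
proof (rule hilbert_surjective[where C = C])
  have z: "wsob (\<lambda>x. 0) (\<lambda>x. 0)" using ac_deriv_const[of 0] by (simp add: wsob_def)
  have "0 *\<^sub>R pack (\<lambda>x. 0) (\<lambda>x. 0) \<in> dom_airy_dirac"
    by (rule dom_airy_dirac_scaleR[OF pack_in_dom[OF z z]])
  then show "0 \<in> dom_airy_dirac" by simp
  show "norm U \<le> C * norm (airy_dirac_shift m l U)" if "U \<in> dom_airy_dirac" for U
    using b that by (simp add: dirac_bound_def)
  show "U \<in> dom_airy_dirac \<and> airy_dirac_shift m l U = F"
    if "\<And>n::nat. X n \<in> dom_airy_dirac" "X \<longlonglongrightarrow> U" "(\<lambda>n. airy_dirac_shift m l (X n)) \<longlonglongrightarrow> F" for X U F
    using weak_system_limit[OF that(2,3) solution_imp_weak_system[OF that(1)]]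
    by (rule weak_system_imp_solution)
  show "E = 0" if "\<And>U. U \<in> dom_airy_dirac \<Longrightarrow> inner E (airy_dirac_shift m l U) = 0" for E
  proof -
    let ?V = "pack (\<lambda>x. cnj (wpart E x)) (\<lambda>x. cnj (vpart E x))" and ?Z = "pack (\<lambda>x. 0) (\<lambda>x. 0)"
    have V: "?V \<in> dom_airy_dirac \<and> airy_dirac_shift m l ?V = ?Z"
      using orthogonal_imp_weak_system[OF that] by (rule weak_system_imp_solution) blast
    have "(norm ?Z)\<^sup>2 = 0" by (subst norm_pack) (simp_all add: l2norm_def)
    then have "norm ?V = 0" using b V by (auto simp: dirac_bound_def)
    moreover have "(norm ?V)\<^sup>2 = (norm E)\<^sup>2"
      using norm_pack[OF in_l2_parts, of E E]
      by (subst norm_pack) (auto intro: in_l2_parts simp: pack_parts)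
    ultimately show "E = 0" by simp
  qed
qed (simp_all add: dom_airy_dirac_add dom_airy_dirac_scaleR)

lemma dirac_bij:
  assumes b: "dirac_bound m l C"
  shows "bij_betw (airy_dirac_shift m l) dom_airy_dirac UNIV"
  unfolding bij_betw_def
proof
  show "inj_on (airy_dirac_shift m l) dom_airy_dirac"
  proof (rule inj_onI)
    fix U V assume *: "U \<in> dom_airy_dirac" "V \<in> dom_airy_dirac" "airy_dirac_shift m l U = airy_dirac_shift m l V"
    have "U + (-1) *\<^sub>R V \<in> dom_airy_dirac" "airy_dirac_shift m l (U + (-1) *\<^sub>R V) = 0"
      using * dom_airy_dirac_scaleR[OF *(2), where c = "-1"] dom_airy_dirac_add[OF *(1) dom_airy_dirac_scaleR(1)[OF *(2), where c = "-1"]]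
      by simp_all
    then have "norm (U + (-1) *\<^sub>R V) \<le> C * norm (0 :: L2)" using b by (metis dirac_bound_def)
    then show "U = V" by simp
  qed
  show "airy_dirac_shift m l ` dom_airy_dirac = UNIV"
    using dirac_surjective[OF b] by (auto simp: image_iff) metis
qed

lemma dirac_inverse:
  assumes b: "dirac_bound m l C" and C: "0 \<le> C"
  shows "boundedly_invertible dom_airy_dirac (airy_dirac_shift m l)" "resolvent_norm m l \<le> C"
    "\<And>U. U \<in> dom_airy_dirac \<Longrightarrow> norm U \<le> resolvent_norm m l * norm (airy_dirac_shift m l U)"
proof -
  let ?T = "airy_dirac_shift m l" and ?R = "inv_into dom_airy_dirac (airy_dirac_shift m l)"
  note bij = dirac_bij[OF b]
  have R: "?R F \<in> dom_airy_dirac" "?T (?R F) = F" for F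
    using bij_betwE[OF bij_betw_inv_into[OF bij]] bij_betw_inv_into_right[OF bij] by auto
  have RT: "?R (?T U) = U" if "U \<in> dom_airy_dirac" for U
    by (rule bij_betw_inv_into_left[OF bij that])
  have add: "?R (F + G) = ?R F + ?R G" for F G
    using RT[OF dom_airy_dirac_add(1)[OF R(1) R(1)], of F G] dom_airy_dirac_add(2)[OF R(1) R(1), of m l F G]
    by (simp add: R(2))
  have scale: "?R (c *\<^sub>R F) = c *\<^sub>R ?R F" for c F
    using RT[OF dom_airy_dirac_scaleR(1)[OF R(1)], of c F] dom_airy_dirac_scaleR(2)[OF R(1), of m l c F]
    by (simp add: R(2))
  have bd: "norm (?R F) \<le> C * norm F" for F
    using b R[of F] unfolding dirac_bound_def by force
  have bl: "bounded_linear ?R"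
    by (rule bounded_linear_intro[where K = C]) (use add scale bd in \<open>auto simp: mult.commute\<close>)
  show "boundedly_invertible dom_airy_dirac ?T"
    using bij bl by (simp add: boundedly_invertible_def)
  show "resolvent_norm m l \<le> C"
    unfolding resolvent_norm_def by (rule onorm_bound[OF C bd])
  show "norm U \<le> resolvent_norm m l * norm (?T U)" if "U \<in> dom_airy_dirac" for U
    unfolding resolvent_norm_def using onorm[OF bl, of "?T U"] RT[OF that] by simp
qed

section \<open>The kernel of $D_+$\<close>

definition gauss :: "real \<Rightarrow> real \<Rightarrow> complex" where
  "gauss l x = exp (- (zeta l x)\<^sup>2 / 2)"

lemma norm_gauss_power2: "(norm (gauss l x))\<^sup>2 = exp (l\<^sup>2) * exp (- x\<^sup>2)"
proof -
  have "Re (- (zeta l x)\<^sup>2 / 2) = (l\<^sup>2 - x\<^sup>2) / 2"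
    by (simp add: zeta_def power2_eq_square field_simps)
  then have "norm (gauss l x) = exp ((l\<^sup>2 - x\<^sup>2) / 2)"
    by (simp only: gauss_def norm_exp_eq_Re)
  then show ?thesis by (simp flip: exp_double exp_add)
qed

lemma has_bochner_integral_exp_square: "has_bochner_integral lborel (\<lambda>x. exp (- x\<^sup>2)) (sqrt pi)"
  using has_bochner_integral_even_function[OF gaussian_moment_0] by simp

lemma integrable_square_exp_square: "integrable lborel (\<lambda>x::real. x\<^sup>2 * exp (- x\<^sup>2))"
proof -
  have "integrable lborel (\<lambda>x::real. exp (- x\<^sup>2) * x ^ (2 * 1))"
    using has_bochner_integral_even_function[OF gaussian_moment_even_pos[where k = 1]]
    by (auto simp: has_bochner_integral_iff)
  then show ?thesis by (simp add: mult.commute)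
qed

lemma gauss_measurable [measurable]: "gauss l \<in> borel_measurable borel"
  unfolding gauss_def by measurable

lemma wsob_gauss: "wsob (gauss l) (\<lambda>x. - (zeta l x * gauss l x))"
proof -
  have 1: "in_l2 (gauss l)"
    using has_bochner_integral_exp_square by (simp add: in_l2_def norm_gauss_power2 has_bochner_integral_iff)
  have "integrable lborel (\<lambda>x. exp (l\<^sup>2) * (x\<^sup>2 * exp (- x\<^sup>2)))"
    by (rule integrable_mult_right[OF integrable_square_exp_square])
  then have 2: "in_l2 (\<lambda>x. of_real x * gauss l x)"
    unfolding in_l2_def norm_mult power_mult_distrib norm_gauss_power2 by (simp add: mult_ac)
  have "ac_deriv (gauss l) (\<lambda>x. - (zeta l x * gauss l x))"
  proof (rule ac_deriv_C1)
    fix x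
    have "((\<lambda>z. exp (- (z + \<i> * of_real l)\<^sup>2 / 2)) has_field_derivative
        - (of_real x + \<i> * of_real l) * exp (- (of_real x + \<i> * of_real l)\<^sup>2 / 2)) (at (of_real x))"
      by (auto intro!: derivative_eq_intros simp: field_simps)
    from has_vector_derivative_real_field[OF this]
    show "(gauss l has_vector_derivative - (zeta l x * gauss l x)) (at x)"
      by (simp only: gauss_def[abs_def] zeta_def mult_minus_left)
  next
    show "continuous_on UNIV (\<lambda>x. - (zeta l x * gauss l x))"
      unfolding gauss_def zeta_def by (intro continuous_intros) auto
  qed
  with 1 2 show ?thesis
    unfolding wsob_def by (intro conjI in_l2_uminus in_l2_zeta)
qed

lemma l2norm_gauss: "(l2norm (gauss l))\<^sup>2 = exp (l\<^sup>2) * sqrt pi"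
  using has_bochner_integral_exp_square by (simp add: l2norm_power2 norm_gauss_power2 has_bochner_integral_iff)

text \<open>After scaling by \<open>sqrt 2\<close> the integrand is a multiple of the standard
  normal density times an oscillating exponential. The integral is then the characteristic function
  at \<open>- sqrt 2 * l\<close>, that is \<open>exp (- l\<^sup>2)\<close>, which cancels the factor
  \<open>exp (l\<^sup>2)\<close> in front.\<close>

lemma pairing_gauss: "pairing (gauss l) (gauss l) = of_real (sqrt pi)"
proof -
  have sq: "gauss l x * gauss l x = exp (- (zeta l x)\<^sup>2)" for x
    by (simp add: gauss_def flip: exp_add)
  have e: "gauss l (x / sqrt 2) * gauss l (x / sqrt 2)
      = of_real (exp (l\<^sup>2) * sqrt (2 * pi)) * (std_normal_density x *\<^sub>R iexp ((- sqrt 2 * l) * x))" for x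
  proof -
    have "- (zeta l (x / sqrt 2))\<^sup>2 = of_real (l\<^sup>2 - x\<^sup>2 / 2) + \<i> * of_real ((- sqrt 2 * l) * x)"
      by (simp add: zeta_def complex_eq_iff power2_eq_square field_simps)
    then have "gauss l (x / sqrt 2) * gauss l (x / sqrt 2)
        = of_real (exp (l\<^sup>2 - x\<^sup>2 / 2)) * iexp ((- sqrt 2 * l) * x)"
      unfolding sq by (simp only: exp_add exp_of_real)
    also have "exp (l\<^sup>2 - x\<^sup>2 / 2) = (exp (l\<^sup>2) * sqrt (2 * pi)) * std_normal_density x"
    proof -
      have "exp (l\<^sup>2 - x\<^sup>2 / 2) = exp (l\<^sup>2) * exp (- x\<^sup>2 / 2)" by (simp flip: exp_add)
      then show ?thesis by (simp add: std_normal_density_def)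
    qed
    finally show ?thesis by (simp only: of_real_mult scaleR_conv_of_real mult.assoc)
  qed
  have "pairing (gauss l) (gauss l) = \<bar>inverse (sqrt 2)\<bar> *\<^sub>R (\<integral>x. gauss l (0 + inverse (sqrt 2) * x) * gauss l (0 + inverse (sqrt 2) * x) \<partial>lborel)"
    unfolding pairing_def by (rule lborel_integral_real_affine) simp
  also have "(\<integral>x. gauss l (0 + inverse (sqrt 2) * x) * gauss l (0 + inverse (sqrt 2) * x) \<partial>lborel)
      = of_real (exp (l\<^sup>2) * sqrt (2 * pi)) * (\<integral>x. std_normal_density x *\<^sub>R iexp ((- sqrt 2 * l) * x) \<partial>lborel)"
    using e by (simp only: add_0 mult.commute[of "inverse (sqrt 2)"] divide_inverse[symmetric] integral_mult_right_zero)
  also have "(\<integral>x. std_normal_density x *\<^sub>R iexp ((- sqrt 2 * l) * x) \<partial>lborel) = char std_normal_distribution (- sqrt 2 * l)"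
    unfolding char_def by (subst integral_density) auto
  also have "\<dots> = of_real (exp (- (l\<^sup>2)))"
    unfolding char_std_normal_distribution by (simp add: power_mult_distrib)
  finally have "pairing (gauss l) (gauss l)
      = of_real (inverse (sqrt 2) * (exp (l\<^sup>2) * sqrt (2 * pi)) * exp (- (l\<^sup>2)))"
    by (simp only: scaleR_conv_of_real of_real_mult mult.assoc abs_of_pos[OF positive_imp_inverse_positive[OF real_sqrt_gt_zero]] zero_less_numeral)
  also have "inverse (sqrt 2) * (exp (l\<^sup>2) * sqrt (2 * pi)) * exp (- (l\<^sup>2)) = sqrt pi"
    by (simp add: real_sqrt_mult exp_minus field_simps)
  finally show ?thesis .
qed

lemma dplus_gauss: "dplus l (gauss l) (\<lambda>x. - (zeta l x * gauss l x)) = (\<lambda>x. 0)"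
  by (simp add: dplus_def fun_eq_iff)

section \<open>Lower bound for \<open>D\<^sub>+\<close> away from its kernel\<close>

text \<open>The multiplier \<open>\<rho> = 3 - arctan\<close> is bounded and positive with \<open>2 x \<rho> - \<rho>' \<ge> 1\<close> on the half line.\<close>

lemma half_line_estimate:
  assumes q: "wsob q q'" and q0: "q 0 = 0"
  shows "(LINT x:{0..}|lborel. (norm (q x))\<^sup>2) \<le> (LINT x:{0..}|lborel. 6 * (norm (q x) * norm (dplus l q q' x)))"
proof -
  note Q = wsobD[OF q]
  have d: "in_l2 (dplus l q q')" using q by auto
  define \<rho> where "\<rho> = (\<lambda>x::real. 3 - arctan x)"
  define \<rho>' where "\<rho>' = (\<lambda>x::real. - inverse (1 + x\<^sup>2))"
  have bnd: "\<bar>\<rho> x\<bar> \<le> 5" "\<bar>\<rho>' x\<bar> \<le> 1" for x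
  proof -
    have "\<bar>arctan x\<bar> < 2" using arctan_bounded[of x] pi_less_4 by auto
    then show "\<bar>\<rho> x\<bar> \<le> 5" by (simp add: \<rho>_def)
    show "\<bar>\<rho>' x\<bar> \<le> 1" by (simp add: \<rho>'_def inverse_le_1_iff add_pos_nonneg)
  qed
  have [measurable]: "\<rho> \<in> borel_measurable borel" "\<rho>' \<in> borel_measurable borel"
    unfolding \<rho>_def \<rho>'_def by measurable
  have ac\<rho>: "ac_deriv (\<lambda>x. of_real (\<rho> x)) (\<lambda>x. of_real (\<rho>' x))"
  proof (rule ac_deriv_C1)
    fix x
    have "(\<rho> has_real_derivative \<rho>' x) (at x)"
      unfolding \<rho>_def \<rho>'_def by (auto intro!: derivative_eq_intros)
    then show "((\<lambda>x. complex_of_real (\<rho> x)) has_vector_derivative of_real (\<rho>' x)) (at x)"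
      by (intro has_vector_derivative_of_real) (simp add: has_real_derivative_iff_has_vector_derivative)
  next
    have "1 + x\<^sup>2 \<noteq> 0" for x :: real by (metis add_pos_nonneg less_irrefl zero_le_power2 zero_less_one)
    then show "continuous_on UNIV (\<lambda>x. complex_of_real (\<rho>' x))"
      unfolding \<rho>'_def by (intro continuous_intros) auto
  qed
  define h where "h = (\<lambda>x. q' x * cnj (q x) + q x * cnj (q' x))"
  define P' where "P' = (\<lambda>x. of_real (\<rho>' x) * (q x * cnj (q x)) + of_real (\<rho> x) * h x)"
  have acP: "ac_deriv (\<lambda>x. of_real (\<rho> x) * (q x * cnj (q x))) P'"
    unfolding P'_def h_def using Q(4) ac\<rho> by (intro ac_deriv_mult ac_deriv_cnj)
  have iq: "integrable lborel (\<lambda>x. q x * cnj (q x))" "integrable lborel h"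
    unfolding h_def using Q by (auto intro!: integrable_mult_l2)
  have ib: "integrable lborel (\<lambda>x. of_real (a x) * f x)"
    if "a \<in> borel_measurable borel" "\<And>x. \<bar>a x\<bar> \<le> B" "integrable lborel f" for a :: "real \<Rightarrow> real" and f :: "real \<Rightarrow> complex" and B
  proof (rule Bochner_Integration.integrable_bound)
    show "integrable lborel (\<lambda>x. B *\<^sub>R f x)" using that(3) by simp
    show "(\<lambda>x. of_real (a x) * f x) \<in> borel_measurable lborel" using that(1,3) by auto
    show "AE x in lborel. norm (of_real (a x) * f x) \<le> norm (B *\<^sub>R f x)"
      using that(2) by (auto simp: norm_mult intro!: mult_right_mono order_trans[OF that(2) abs_ge_self])
  qed
  have iP: "integrable lborel (\<lambda>x. of_real (\<rho> x) * (q x * cnj (q x)))"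
    by (rule ib[of \<rho> 5]) (use bnd iq in auto)
  have iP': "integrable lborel P'"
    unfolding P'_def
    by (intro Bochner_Integration.integrable_add ib[of \<rho>' 1] ib[of \<rho> 5]) (use bnd iq in auto)
  \<comment> \<open>The boundary value at 0 is \<open>\<rho> 0\<close> times the squared modulus of
    \<open>q 0\<close>, hence zero.\<close>
  have zero: "(LINT x:{0..}|lborel. P' x) = 0"
    using integral_ac_deriv_atLeast[OF acP iP iP', of 0] q0 by simp
  have siP: "set_integrable lborel {0..} P'"
    using iP' unfolding set_integrable_def by (rule integrable_mult_indicator[rotated]) simp
  have in2: "set_integrable lborel {0..} (\<lambda>x. (norm (q x))\<^sup>2)"
    using Q(1) unfolding set_integrable_def in_l2_def by (intro integrable_mult_indicator) auto
  have "integrable lborel (\<lambda>x. norm (q x * dplus l q q' x))"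
    by (rule integrable_norm[OF integrable_mult_l2[OF Q(1) d]])
  then have in3: "set_integrable lborel {0..} (\<lambda>x. 6 * (norm (q x) * norm (dplus l q q' x)))"
    unfolding set_integrable_def norm_mult by (intro integrable_mult_indicator integrable_mult_right) auto
  have key: "(norm (q x))\<^sup>2 + Re (P' x) \<le> 6 * (norm (q x) * norm (dplus l q q' x))" if x: "x \<ge> 0" for x
  proof -
    define n where "n = (norm (q x))\<^sup>2"
    define r where "r = Re (dplus l q q' x * cnj (q x))"
    have n: "n = Re (q x) * Re (q x) + Im (q x) * Im (q x)"
      by (simp only: n_def cmod_power2) (simp add: power2_eq_square)
    have q': "Re (q' x) = Re (dplus l q q' x) - (x * Re (q x) - l * Im (q x))"
      "Im (q' x) = Im (dplus l q q' x) - (x * Im (q x) + l * Re (q x))"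
      by (simp_all add: dplus_def zeta_def)
    have h: "Re (h x) = 2 * r - 2 * x * n"
      unfolding h_def r_def n by (simp add: q' algebra_simps)
    have P': "Re (P' x) = \<rho>' x * n + \<rho> x * (2 * r) - \<rho> x * (2 * x) * n"
      unfolding P'_def by (simp add: h) (simp add: n algebra_simps)
    have \<rho>1: "1 \<le> \<rho> x" "\<rho> x \<le> 3"
      using x arctan_bounded[of x] pi_less_4 by (auto simp: \<rho>_def)
    \<comment> \<open>Near 0 the positivity comes from \<open>- \<rho>'\<close>, further out from
      \<open>2 * x\<close>: one has \<open>inverse (1 + x\<^sup>2) \<ge> 1 - x\<^sup>2\<close>, and
      \<open>x\<^sup>2 \<le> 2 * x\<close> up to \<open>x = 2\<close>, beyond which
      \<open>2 * x\<close> suffices alone.\<close>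
    have "1 \<le> inverse (1 + x\<^sup>2) + 1 * (2 * x)"
    proof (cases "x \<le> 2")
      case True
      have "(1 - x\<^sup>2) * (1 + x\<^sup>2) \<le> 1" by (simp add: algebra_simps)
      moreover have "0 < 1 + x\<^sup>2" by (simp add: add_pos_nonneg)
      ultimately have "1 - x\<^sup>2 \<le> inverse (1 + x\<^sup>2)" by (simp add: inverse_eq_divide pos_le_divide_eq)
      moreover have "x\<^sup>2 \<le> 2 * x" using True x by (simp add: power2_eq_square mult_right_mono)
      ultimately show ?thesis by simp
    next
      case False
      have "0 < inverse (1 + x\<^sup>2)" by (simp add: add_pos_nonneg)
      with False show ?thesis by linarith
    qed
    also have "\<dots> \<le> inverse (1 + x\<^sup>2) + \<rho> x * (2 * x)"
      using \<rho>1 x by (intro add_left_mono mult_right_mono) auto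
    finally have "1 * n \<le> (inverse (1 + x\<^sup>2) + \<rho> x * (2 * x)) * n"
      by (rule mult_right_mono) (simp add: n_def)
    then have "n + \<rho>' x * n - \<rho> x * (2 * x) * n \<le> 0" by (simp add: \<rho>'_def algebra_simps)
    moreover have "\<rho> x * (2 * r) \<le> 6 * (norm (q x) * norm (dplus l q q' x))"
    proof -
      have "r \<le> norm (q x) * norm (dplus l q q' x)"
        unfolding r_def using complex_Re_le_cmod[of "dplus l q q' x * cnj (q x)"]
        by (simp only: norm_mult complex_mod_cnj mult.commute)
      then have "\<rho> x * (2 * r) \<le> \<rho> x * (2 * (norm (q x) * norm (dplus l q q' x)))"
        using \<rho>1 by (intro mult_left_mono) auto
      also have "\<dots> \<le> 3 * (2 * (norm (q x) * norm (dplus l q q' x)))"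
        using \<rho>1 by (intro mult_right_mono) auto
      finally show ?thesis by simp
    qed
    ultimately show ?thesis unfolding P' n_def by linarith
  qed
  have siR: "set_integrable lborel {0..} (\<lambda>x. Re (P' x))"
    using integrable_Re[OF siP[unfolded set_integrable_def]] by (simp add: set_integrable_def)
  have "(LINT x:{0..}|lborel. Re (P' x)) = Re (LINT x:{0..}|lborel. P' x)"
    using integral_Re[OF siP[unfolded set_integrable_def]] by (simp add: set_lebesgue_integral_def)
  then have "(LINT x:{0..}|lborel. (norm (q x))\<^sup>2) = (LINT x:{0..}|lborel. (norm (q x))\<^sup>2 + Re (P' x))"
    using zero set_integral_add(2)[OF in2 siR] by simp
  also have "\<dots> \<le> (LINT x:{0..}|lborel. 6 * (norm (q x) * norm (dplus l q q' x)))"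
    using set_integral_add(1)[OF in2 siR] in3 key by (intro set_integral_mono) auto
  finally show ?thesis .
qed

lemma in_l2_reflect: "in_l2 f \<Longrightarrow> in_l2 (\<lambda>x. f (- x))"
  using lborel_integrable_real_affine[of "\<lambda>x. (norm (f x))\<^sup>2" "-1" 0]
  by (auto simp: in_l2_def)

lemma wsob_reflect:
  assumes "wsob f f'" shows "wsob (\<lambda>x. f (- x)) (\<lambda>x. - f' (- x))"
proof -
  have "in_l2 (\<lambda>x. - (of_real (- x) * f (- x)))"
    using in_l2_uminus[OF in_l2_reflect[OF wsobD(3)[OF assms]]] .
  then show ?thesis
    using assms unfolding wsob_def by (auto intro!: in_l2_reflect in_l2_uminus ac_deriv_reflect)
qed

lemma integral_split_reflect:
  fixes f :: "real \<Rightarrow> real"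
  assumes "integrable lborel f"
  shows "(\<integral>x. f x \<partial>lborel) = (LINT x:{0..}|lborel. f x) + (LINT x:{0..}|lborel. f (- x))"
proof -
  have si: "set_integrable lborel A f" if "A \<in> sets borel" for A
    using assms that unfolding set_integrable_def by (intro integrable_mult_indicator) auto
  have "(\<integral>x. f x \<partial>lborel) = (LINT x:{0..} \<union> {..<0}|lborel. f x)"
  proof -
    have "{0..} \<union> {..<0} = (UNIV :: real set)" by auto
    then show ?thesis by (simp add: set_lebesgue_integral_def)
  qed
  also have "\<dots> = (LINT x:{0..}|lborel. f x) + (LINT x:{..<0}|lborel. f x)"
    by (intro set_integral_Un si) auto
  also have "(LINT x:{..<0}|lborel. f x) = (\<integral>x. indicator {..<0} (- x) *\<^sub>R f (- x) \<partial>lborel)"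
    using lborel_integral_real_affine[of "-1" "\<lambda>x. indicator {..<0} x *\<^sub>R f x" 0]
    by (simp add: set_lebesgue_integral_def)
  also have "\<dots> = (LINT x:{0..}|lborel. f (- x))"
    unfolding set_lebesgue_integral_def
  proof (rule integral_cong_AE)
    have [measurable]: "f \<in> borel_measurable borel" using borel_measurable_integrable[OF assms] by simp
    show "(\<lambda>x. indicator {..<0} (- x) *\<^sub>R f (- x)) \<in> borel_measurable lborel" by measurable
    show "(\<lambda>x. indicator {0..} x *\<^sub>R f (- x)) \<in> borel_measurable lborel" by measurable
    have "AE x in lborel. x \<noteq> (0::real)" by (rule AE_lborel_singleton)
    then show "AE x in lborel. indicator {..<0} (- x) *\<^sub>R f (- x) = indicator {0..} x *\<^sub>R f (- x)"
      by eventually_elim (auto simp: indicator_def)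
  qed
  finally show ?thesis .
qed

text \<open>No such bound can hold on the span of \<open>gauss l\<close>. The condition at 0
  excludes this kernel, since \<open>gauss l\<close> has no zero, and decouples the half lines;
  reflection exchanges them and replaces \<open>l\<close> by \<open>- l\<close>, which is harmless
  as the constant is independent of \<open>l\<close>.\<close>

lemma l2norm_le_dplus:
  assumes q: "wsob q q'" and q0: "q 0 = 0"
  shows "l2norm q \<le> 6 * l2norm (dplus l q q')"
proof -
  note Q = wsobD(1)[OF q]
  have d: "in_l2 (dplus l q q')" using q by auto
  have r: "dplus (- l) (\<lambda>x. q (- x)) (\<lambda>x. - q' (- x)) = (\<lambda>x. - dplus l q q' (- x))"
    by (auto simp: dplus_def zeta_def algebra_simps)
  have i1: "integrable lborel (\<lambda>x. (norm (q x))\<^sup>2)" using Q by (simp add: in_l2_def)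
  have i2: "integrable lborel (\<lambda>x. 6 * (norm (q x) * norm (dplus l q q' x)))"
    using integrable_norm[OF integrable_mult_l2[OF Q d]] by (simp add: norm_mult)
  have "(l2norm q)\<^sup>2 = (LINT x:{0..}|lborel. (norm (q x))\<^sup>2) + (LINT x:{0..}|lborel. (norm (q (- x)))\<^sup>2)"
    unfolding l2norm_power2 by (rule integral_split_reflect[OF i1])
  also have "\<dots> \<le> (LINT x:{0..}|lborel. 6 * (norm (q x) * norm (dplus l q q' x)))
      + (LINT x:{0..}|lborel. 6 * (norm (q (- x)) * norm (dplus l q q' (- x))))"
    using half_line_estimate[OF q q0, of l] half_line_estimate[OF wsob_reflect[OF q], of "- l"] q0
    unfolding r by simp
  also have "\<dots> = (\<integral>x. 6 * (norm (q x) * norm (dplus l q q' x)) \<partial>lborel)"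
    by (rule integral_split_reflect[OF i2, symmetric])
  also have "\<dots> = 6 * Re (pairing (\<lambda>x. of_real (norm (q x))) (\<lambda>x. of_real (norm (dplus l q q' x))))"
    by (simp add: pairing_def flip: of_real_mult)
  also have "\<dots> \<le> 6 * (l2norm q * l2norm (dplus l q q'))"
    using order_trans[OF complex_Re_le_cmod pairing_bound[OF in_l2_norm[OF Q] in_l2_norm[OF d]]]
    by (simp add: l2norm_norm)
  finally have "l2norm q * l2norm q \<le> l2norm q * (6 * l2norm (dplus l q q'))"
    by (simp add: power2_eq_square mult_ac)
  then show ?thesis
    by (cases "l2norm q = 0") (simp_all add: order.strict_iff_order)
qed

section \<open>A priori bounds\<close>

definition pair_norm :: "(real \<Rightarrow> complex) \<Rightarrow> (real \<Rightarrow> complex) \<Rightarrow> real" where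
  "pair_norm a b = sqrt ((l2norm a)\<^sup>2 + (l2norm b)\<^sup>2)"

lemma pair_norm_bounds:
  "0 \<le> pair_norm a b" "l2norm a \<le> pair_norm a b" "l2norm b \<le> pair_norm a b" "pair_norm a b \<le> l2norm a + l2norm b"
  by (simp_all add: pair_norm_def real_le_rsqrt sqrt_sum_squares_le_sum)

lemma norm_pack_eq:
  assumes "in_l2 v" "in_l2 w" shows "norm (pack v w) = pair_norm v w / sqrt 2"
proof -
  have "norm (pack v w) = sqrt (((l2norm v)\<^sup>2 + (l2norm w)\<^sup>2) / 2)"
    using norm_pack[OF assms] by (metis norm_ge_zero real_sqrt_unique)
  then show ?thesis by (simp add: pair_norm_def real_sqrt_divide)
qed

abbreviation (input) data_norm where
  "data_norm m l v v' w w' \<equiv> pair_norm (op1 m l v v' w) (op2 m l v w w')"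

lemma dirac_boundI:
  assumes "\<And>v v' w w'. wsob v v' \<Longrightarrow> wsob w w' \<Longrightarrow> pair_norm v w \<le> C * data_norm m l v v' w w'"
  shows "dirac_bound m l C"
  unfolding dirac_bound_def
proof
  fix U assume "U \<in> dom_airy_dirac"
  then show "norm U \<le> C * norm (airy_dirac_shift m l U)"
  proof (rule dom_airy_diracE)
    fix v v' w w' assume *: "wsob v v'" "wsob w w'" "U = pack v w"
    show ?thesis
      unfolding *(3) airy_dirac_shift_pack[OF *(1,2)] norm_pack_eq[OF wsobD(1)[OF *(1)] wsobD(1)[OF *(2)]]
        norm_pack_eq[OF in_l2_op[OF *(1,2)]]
      using assms[OF *(1,2)] by (simp add: divide_right_mono)
  qed
qed

lemma dirac_boundD:
  assumes "dirac_bound m l C" "wsob v v'" "wsob w w'"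
  shows "pair_norm v w \<le> C * data_norm m l v v' w w'"
  using assms(1) pack_in_dom[OF assms(2,3)]
  unfolding dirac_bound_def
  by (force simp: airy_dirac_shift_pack[OF assms(2,3)] norm_pack_eq[OF wsobD(1)[OF assms(2)] wsobD(1)[OF assms(3)]]
      norm_pack_eq[OF in_l2_op[OF assms(2,3)]] divide_le_cancel)

lemma dirac_bound_mono: "dirac_bound m l B \<Longrightarrow> B \<le> C \<Longrightarrow> dirac_bound m l C"
  unfolding dirac_bound_def by (meson mult_right_mono norm_ge_zero order_trans)

lemma resolvent_normD:
  assumes "dirac_bound m l C" "0 \<le> C" "wsob v v'" "wsob w w'"
  shows "pair_norm v w \<le> resolvent_norm m l * data_norm m l v v' w w'"
proof -
  have "norm (pack v w) \<le> resolvent_norm m l * norm (airy_dirac_shift m l (pack v w))"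
    by (rule dirac_inverse(3)[OF assms(1,2) pack_in_dom[OF assms(3,4)]])
  then show ?thesis
    by (simp add: airy_dirac_shift_pack[OF assms(3,4)] norm_pack_eq[OF wsobD(1)[OF assms(3)] wsobD(1)[OF assms(4)]]
        norm_pack_eq[OF in_l2_op[OF assms(3,4)]] divide_le_cancel)
qed

lemma dirac_solve:
  assumes b: "dirac_bound m l C" and gh: "in_l2 g" "in_l2 h"
  obtains v v' w w' where "wsob v v'" "wsob w w'"
    "AE x in lborel. op1 m l v v' w x = g x" "AE x in lborel. op2 m l v w w' x = h x"
proof -
  obtain U where U: "U \<in> dom_airy_dirac" "airy_dirac_shift m l U = pack g h"
    using dirac_surjective[OF b] by blast
  from U(1) obtain v v' w w' where *: "wsob v v'" "wsob w w'" "U = pack v w" by (rule dom_airy_diracE)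
  have "pack (op1 m l v v' w) (op2 m l v w w') = pack g h"
    using U(2) airy_dirac_shift_pack[OF *(1,2)] *(3) by simp
  then have "AE x in lborel. vpart (pack g h) x = op1 m l v v' w x" "AE x in lborel. wpart (pack g h) x = op2 m l v w w' x"
    using parts_pack[OF in_l2_op[OF *(1,2)], of m l m l] by simp_all
  then have "AE x in lborel. op1 m l v v' w x = g x" "AE x in lborel. op2 m l v w w' x = h x"
    using parts_pack[OF gh] by (auto elim: eventually_elim2)
  with * show ?thesis by (intro that)
qed

section \<open>Bounds for large masses and their transfer to smaller ones\<close>

lemma dirac_bound_large:
  assumes m: "1 \<le> m" "4 * R \<le> m" and l: "\<bar>l\<bar> \<le> R"
  shows "dirac_bound m l (1 / m * (1 + 4 * R / m))"
proof (rule dirac_boundI)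
  fix v v' w w' assume v: "wsob v v'" and w: "wsob w w'"
  define N where "N = pair_norm v w"
  define F where "F = data_norm m l v v' w w'"
  define t where "t = 2 * R / m"
  have t: "0 \<le> t" "t \<le> 1 / 2" using m l by (auto simp: t_def divide_simps)
  have "m\<^sup>2 * (1 - t) * N\<^sup>2 \<le> (m\<^sup>2 - 2 * m * \<bar>l\<bar>) * N\<^sup>2"
    using m l by (intro mult_right_mono) (auto simp: t_def power2_eq_square field_simps)
  also have "\<dots> \<le> F\<^sup>2"
    using op_coercive[OF v w, of m l] m by (simp add: N_def F_def pair_norm_def)
  finally have 1: "m\<^sup>2 * (1 - t) * N\<^sup>2 \<le> F\<^sup>2" .
  \<comment> \<open>\<open>1 + 2 * t\<close> is an elementary upper bound for the inverse square
    root of \<open>1 - t\<close>: the product \<open>(1 + 2 * t)\<^sup>2 * (1 - t)\<close> equals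
    \<open>1 + 3 * t - 4 * t ^ 3\<close>, which is at least 1 for
    \<open>t \<le> 1 / 2\<close>.\<close>
  have "t * t \<le> (1/2) * (1/2)" using t by (intro mult_mono) auto
  then have "t * (4 * (t * t)) \<le> t * 3" using t by (intro mult_left_mono) auto
  then have "1 \<le> (1 + 2 * t)\<^sup>2 * (1 - t)" by (simp add: power2_eq_square algebra_simps)
  then have "m\<^sup>2 * N\<^sup>2 * 1 \<le> m\<^sup>2 * N\<^sup>2 * ((1 + 2 * t)\<^sup>2 * (1 - t))" by (intro mult_left_mono) auto
  also have "\<dots> = (1 + 2 * t)\<^sup>2 * (m\<^sup>2 * (1 - t) * N\<^sup>2)" by (simp add: mult_ac)
  also have "\<dots> \<le> (1 + 2 * t)\<^sup>2 * F\<^sup>2" using 1 by (intro mult_left_mono) auto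
  finally have "(m * N)\<^sup>2 \<le> ((1 + 2 * t) * F)\<^sup>2" by (simp add: power_mult_distrib)
  then have "m * N \<le> (1 + 2 * t) * F"
    by (rule power2_le_imp_le) (use t in \<open>simp add: F_def pair_norm_bounds\<close>)
  then show "pair_norm v w \<le> 1 / m * (1 + 4 * R / m) * data_norm m l v v' w w'"
    using m by (simp add: N_def F_def t_def field_simps)
qed

text \<open>If \<open>m'\<^sup>2 = m\<^sup>2 + 2\<close> then \<open>m\<^sup>2 - D\<^sub>+ D\<^sub>- = m'\<^sup>2 - D\<^sub>- D\<^sub>+\<close>, so solving the problem for \<open>m'\<close> with data
  \<open>(cnj v / m', 0)\<close> produces the test function \<open>y\<close> that controls \<open>v\<close>.\<close>

lemma ladder_v:
  assumes m: "0 < m" and m': "m'\<^sup>2 = m\<^sup>2 + 2" "0 < m'" and b: "dirac_bound m' l B" and B: "0 \<le> B"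
    and l: "\<bar>l\<bar> \<le> R" and v: "wsob v v'" and w: "wsob w w'"
  shows "l2norm v \<le> B * (4 + 2 * R) * data_norm m l v v' w w'"
proof -
  define g where "g = op1 m l v v' w"
  define h where "h = op2 m l v w w'"
  have gh: "in_l2 g" "in_l2 h" unfolding g_def h_def using v w by auto
  define F where "F = pair_norm g h"
  \<comment> \<open>The factor \<open>1 / m'\<close> normalises the eliminated equation for
    \<open>y\<close>, and it lets \<open>m * l2norm y\<close> be bounded by
    \<open>B * l2norm v\<close> without growth in \<open>m\<close>.\<close>
  define b where "b = (\<lambda>x. inverse (of_real m') * cnj (v x))"
  have b2: "in_l2 b" unfolding b_def using wsobD(1)[OF v] by auto
  have m'1: "1 \<le> m'" "m \<le> m'"
  proof -
    have "1\<^sup>2 \<le> m'\<^sup>2" "m\<^sup>2 \<le> m'\<^sup>2" using m'(1) by auto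
    then show "1 \<le> m'" "m \<le> m'" using m' by (auto intro: power2_le_imp_le)
  qed
  \<comment> \<open>Here \<open>y'\<close> is the first component of the solution and not the
    derivative of \<open>y\<close>, which is \<open>dy\<close>. Eliminating \<open>y'\<close> gives
    formally \<open>(m'\<^sup>2 - D\<^sub>- D\<^sub>+) y = cnj v\<close>.\<close>
  obtain y' dy' y dy where y': "wsob y' dy'" and y: "wsob y dy"
    and e1: "AE x in lborel. op1 m' l y' dy' y x = b x" and e2: "AE x in lborel. op2 m' l y' y dy x = 0"
    using dirac_solve[OF \<open>dirac_bound m' l B\<close> b2 in_l2_zero] by metis
  note in2 = wsobD(1)[OF v] wsobD(1)[OF w] wsobD(1)[OF y'] wsobD(1)[OF y]
  note D = in_l2_dminus[OF v, of l] in_l2_dplus[OF v, of l] in_l2_dplus[OF w, of l]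
    in_l2_dminus[OF y', of l] in_l2_dplus[OF y, of l] in_l2_dminus[OF y, of l]
  have Dy: "AE x in lborel. dplus l y dy x = \<i> * of_real m' * y' x"
    using e2
  proof eventually_elim
    case (elim x)
    then have "\<i> * (\<i> * dplus l y dy x + of_real m' * y' x) = 0" by (simp add: op2_def)
    then show ?case by (simp add: algebra_simps)
  qed
  have nb: "l2norm b \<le> l2norm v"
  proof -
    have "inverse m' * l2norm v \<le> 1 * l2norm v"
      using m'1 by (intro mult_right_mono) (auto simp: inverse_le_1_iff)
    then show ?thesis unfolding b_def l2norm_cmult using m'1 by (simp add: norm_inverse)
  qed
  have "pair_norm y' y \<le> B * pair_norm (op1 m' l y' dy' y) (op2 m' l y' y dy)"
    by (rule dirac_boundD[OF \<open>dirac_bound m' l B\<close> y' y])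
  also have "pair_norm (op1 m' l y' dy' y) (op2 m' l y' y dy) = l2norm b"
    unfolding pair_norm_def
    using l2norm_cong_AE[OF in_l2_op(1)[OF y' y] b2 e1] l2norm_cong_AE[OF in_l2_op(2)[OF y' y] in_l2_zero e2]
    by (simp add: l2norm_def[of "\<lambda>x. 0"])
  finally have py: "pair_norm y' y \<le> B * l2norm b" .
  have nbm: "m' * l2norm b = l2norm v"
    unfolding b_def l2norm_cmult using m'1 by (simp add: norm_inverse)
  have ly: "l2norm y \<le> B * l2norm v" "m * l2norm y \<le> B * l2norm v" "m' * l2norm y' \<le> B * l2norm v"
  proof -
    have 1: "l2norm y \<le> B * l2norm b" "l2norm y' \<le> B * l2norm b"
      using py pair_norm_bounds(2,3)[where a = y' and b = y] by linarith+
    show "l2norm y \<le> B * l2norm v" using 1(1) mult_left_mono[OF nb B] by linarith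
    have "m * l2norm y \<le> m' * l2norm y" using m'1 by (intro mult_right_mono) auto
    also have "\<dots> \<le> m' * (B * l2norm b)" using 1 m'1 by (intro mult_left_mono) auto
    also have "\<dots> = B * l2norm v" using nbm by (simp add: mult.left_commute)
    finally show "m * l2norm y \<le> B * l2norm v" .
    have "m' * l2norm y' \<le> m' * (B * l2norm b)" using 1 m'1 by (intro mult_left_mono) auto
    also have "\<dots> = B * l2norm v" using nbm by (simp add: mult.left_commute)
    finally show "m' * l2norm y' \<le> B * l2norm v" .
  qed
  have nDy: "l2norm (dplus l y dy) \<le> B * l2norm v"
  proof -
    have "l2norm (dplus l y dy) = l2norm (\<lambda>x. (\<i> * of_real m') * y' x)"
      by (rule l2norm_cong_AE[OF D(5) in_l2_cmult[OF in2(3)] Dy])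
    also have "\<dots> = m' * l2norm y'" unfolding l2norm_cmult using m'1 by (simp add: norm_mult)
    finally show ?thesis using ly(3) by simp
  qed
  \<comment> \<open>The second equation expresses \<open>D\<^sub>+ y\<close> through
    \<open>y'\<close>, and \<open>D\<^sub>-\<close> exceeds \<open>D\<^sub>+\<close> only by a
    multiple of \<open>y\<close>; this gives \<open>1 + (2 * R + 2)\<close>.\<close>
  have nDmy: "l2norm (dminus l y dy) \<le> (3 + 2 * R) * (B * l2norm v)"
  proof -
    have "l2norm (dminus l y dy) \<le> B * l2norm v + (2 * \<bar>l\<bar> + 2) * l2norm y"
      using l2norm_dminus_le[OF y, of l] nDy by linarith
    also have "(2 * \<bar>l\<bar> + 2) * l2norm y \<le> (2 * R + 2) * (B * l2norm v)"
      using l ly(1) by (intro mult_mono) auto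
    finally show ?thesis by (simp add: algebra_simps)
  qed
  \<comment> \<open>The equation for \<open>y\<close> and the commutation relation turn the
    left-hand side into \<open>D\<^sub>- v\<close> against \<open>D\<^sub>- y\<close> plus
    \<open>m\<^sup>2\<close> times \<open>v\<close> against \<open>y\<close>. On the right the two
    terms with \<open>w\<close> cancel because \<open>D\<^sub>+\<close> is minus the transpose of
    \<open>D\<^sub>-\<close>.\<close>
  have "pairing v (\<lambda>x. cnj (v x)) = \<i> * pairing g (dminus l y dy) + of_real m * pairing h y"
  proof -
    have "pairing (dplus l v v') (dplus l y dy) = pairing (dplus l v v') (\<lambda>x. (\<i> * of_real m') * y' x)"
      using pairing_cong_AE[OF D(5) in_l2_cmult[OF in2(3)] D(2) Dy] by (simp only: pairing_commute)
    then have 1: "pairing (dplus l v v') (dplus l y dy) = - \<i> * of_real m' * pairing v (dminus l y' dy')"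
      unfolding pairing_cmult_right pairing_dplus[OF v y'] by simp
    have "pairing v (\<lambda>x. cnj (v x)) = of_real m' * pairing v b"
      using m'(2) unfolding b_def by simp
    also have "pairing v b = pairing v (op1 m' l y' dy' y)"
      using pairing_cong_AE[OF in_l2_op(1)[OF y' y] b2 in2(1) e1] by (simp only: pairing_commute)
    also have "\<dots> = - \<i> * pairing v (dminus l y' dy') + of_real m' * pairing v y"
      unfolding op1_def by (simp only: pairing_add_right[OF in_l2_cmult[OF D(4)] in_l2_cmult[OF in2(4)] in2(1)] pairing_cmult_right)
    finally have "pairing v (\<lambda>x. cnj (v x)) = pairing (dplus l v v') (dplus l y dy) + of_real (m'\<^sup>2) * pairing v y"
      unfolding 1 by (simp add: power2_eq_square algebra_simps)
    then have L: "pairing v (\<lambda>x. cnj (v x)) = pairing (dminus l v v') (dminus l y dy) + of_real (m\<^sup>2) * pairing v y"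
      unfolding m'(1) pairing_dminus_dminus[OF v y] by (simp add: algebra_simps)
    have 2: "pairing g (dminus l y dy) = - \<i> * pairing (dminus l v v') (dminus l y dy) + of_real m * pairing w (dminus l y dy)"
      unfolding g_def op1_def
      by (simp only: pairing_add_left[OF in_l2_cmult[OF D(1)] in_l2_cmult[OF in2(2)] D(6)] pairing_cmult_left)
    have 3: "pairing h y = \<i> * pairing (dplus l w w') y + of_real m * pairing v y"
      unfolding h_def op2_def
      by (simp only: pairing_add_left[OF in_l2_cmult[OF D(3)] in_l2_cmult[OF in2(1)] in2(4)] pairing_cmult_left)
    show ?thesis
      unfolding L 2 3 pairing_dplus[OF w y] by (simp add: power2_eq_square algebra_simps)
  qed
  then have "(l2norm v)\<^sup>2 = norm (\<i> * pairing g (dminus l y dy) + of_real m * pairing h y)"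
    by (metis pairing_cnj_self norm_of_real abs_power2)
  also have "\<dots> \<le> norm (pairing g (dminus l y dy)) + m * norm (pairing h y)"
    using norm_triangle_ineq[of "\<i> * pairing g (dminus l y dy)" "of_real m * pairing h y"] m by (simp add: norm_mult)
  also have "\<dots> \<le> F * ((3 + 2 * R) * (B * l2norm v)) + F * (B * l2norm v)"
  proof (rule add_mono)
    have "norm (pairing g (dminus l y dy)) \<le> l2norm g * l2norm (dminus l y dy)"
      by (rule pairing_bound[OF gh(1) D(6)])
    also have "\<dots> \<le> F * ((3 + 2 * R) * (B * l2norm v))"
      using nDmy by (intro mult_mono) (auto simp: F_def pair_norm_bounds)
    finally show "norm (pairing g (dminus l y dy)) \<le> F * ((3 + 2 * R) * (B * l2norm v))" .
    have "m * norm (pairing h y) \<le> m * (l2norm h * l2norm y)"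
      using pairing_bound[OF gh(2) in2(4)] m by (intro mult_left_mono) auto
    also have "\<dots> = l2norm h * (m * l2norm y)" by simp
    also have "\<dots> \<le> F * (B * l2norm v)"
      by (rule mult_mono[OF _ ly(2)]) (use m in \<open>auto simp: F_def pair_norm_bounds\<close>)
    finally show "m * norm (pairing h y) \<le> F * (B * l2norm v)" .
  qed
  finally have "l2norm v * l2norm v \<le> l2norm v * (B * (4 + 2 * R) * F)"
    by (simp add: power2_eq_square algebra_simps)
  moreover have "0 \<le> B * (4 + 2 * R) * F"
    using B l by (auto simp: F_def pair_norm_bounds intro!: mult_nonneg_nonneg)
  ultimately have "l2norm v \<le> B * (4 + 2 * R) * F"
    by (cases "l2norm v = 0") (simp_all add: order.strict_iff_order)
  then show ?thesis by (simp add: F_def g_def h_def)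
qed

lemma l2norm_dplus_le:
  assumes v: "wsob v v'" and w: "wsob w w'" and m: "0 < m"
  shows "l2norm (dplus l w w') \<le> l2norm (op2 m l v w w') + m * l2norm v"
proof -
  have e: "dplus l w w' = (\<lambda>x. (- \<i>) * op2 m l v w w' x - (- \<i> * of_real m) * v x)"
    by (simp add: op2_def fun_eq_iff algebra_simps)
  have "l2norm (dplus l w w') \<le> l2norm (\<lambda>x. (- \<i>) * op2 m l v w w' x) + l2norm (\<lambda>x. (- \<i> * of_real m) * v x)"
    by (subst e, rule l2norm_diff_triangle[OF in_l2_cmult[OF in_l2_op(2)[OF v w]] in_l2_cmult[OF wsobD(1)[OF v]]])
  also have "\<dots> = l2norm (op2 m l v w w') + m * l2norm v"
    unfolding l2norm_cmult using m by (simp add: norm_mult)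
  finally show ?thesis .
qed

text \<open>Pairing the first equation with \<open>cnj w\<close> isolates
  \<open>m * (l2norm w)\<^sup>2\<close> and moves \<open>D\<^sub>-\<close> from \<open>v\<close>
  onto \<open>cnj w\<close>. There it becomes \<open>D\<^sub>+\<close>, which the second equation
  controls by \<open>h\<close> and \<open>v\<close>, up to \<open>2 * l * w\<close> caused by the
  conjugation. The result is a quadratic inequality for the norm of \<open>w\<close>.\<close>

lemma bound_w_by_v:
  assumes m: "0 < m" and l: "\<bar>l\<bar> \<le> R" and K: "0 \<le> K" and v: "wsob v v'" and w: "wsob w w'"
    and vK: "l2norm v \<le> K * data_norm m l v v' w w'"
  shows "l2norm w \<le> (1 + (1 + 2 * R * K + K) / m + K\<^sup>2) * data_norm m l v v' w w'"
proof -
  define g where "g = op1 m l v v' w"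
  define h where "h = op2 m l v w w'"
  have gh: "in_l2 g" "in_l2 h" unfolding g_def h_def using v w by auto
  define F where "F = pair_norm g h"
  have F: "0 \<le> F" "l2norm g \<le> F" "l2norm h \<le> F" by (simp_all add: F_def pair_norm_bounds)
  have vF: "l2norm v \<le> K * F" using vK by (simp add: F_def g_def h_def)
  have R: "0 \<le> R" using l by linarith
  define W where "W = l2norm w"
  have W0: "0 \<le> W" by (simp add: W_def)
  define q where "q = (\<lambda>x. cnj (w x))"
  have q: "wsob q (\<lambda>x. cnj (w' x))" unfolding q_def by (rule wsob_cnj[OF w])
  note in2 = wsobD(1)[OF v] wsobD(1)[OF w] wsobD(1)[OF q]
  have nD: "l2norm (dplus l w w') \<le> F + m * (K * F)"
    using l2norm_dplus_le[OF v w m, of l] F(3) mult_left_mono[OF vF, of m] m unfolding h_def by linarith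
  have nq: "l2norm (dplus l q (\<lambda>x. cnj (w' x))) \<le> F + m * (K * F) + 2 * R * W"
  proof -
    have "dplus l q (\<lambda>x. cnj (w' x)) = (\<lambda>x. cnj (dplus l w w' x - (2 * \<i> * of_real l) * w x))"
      unfolding q_def by (simp add: dplus_cnj fun_eq_iff)
    then have "l2norm (dplus l q (\<lambda>x. cnj (w' x))) = l2norm (\<lambda>x. dplus l w w' x - (2 * \<i> * of_real l) * w x)"
      by (simp only: l2norm_cnj)
    also have "\<dots> \<le> l2norm (dplus l w w') + l2norm (\<lambda>x. (2 * \<i> * of_real l) * w x)"
      by (rule l2norm_diff_triangle[OF in_l2_dplus[OF w] in_l2_cmult[OF in2(2)]])
    also have "l2norm (\<lambda>x. (2 * \<i> * of_real l) * w x) = 2 * \<bar>l\<bar> * W"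
      unfolding l2norm_cmult W_def by (simp add: norm_mult)
    also have "2 * \<bar>l\<bar> * W \<le> 2 * R * W" using l W0 by (intro mult_right_mono) auto
    finally show ?thesis using nD by linarith
  qed
  have "pairing g q = - \<i> * pairing (dminus l v v') q + of_real m * pairing w q"
    unfolding g_def op1_def
    by (simp only: pairing_add_left[OF in_l2_cmult[OF in_l2_dminus[OF v]] in_l2_cmult[OF in2(2)] in2(3)] pairing_cmult_left)
  then have e: "of_real m * pairing w q = pairing g q - \<i> * pairing v (dplus l q (\<lambda>x. cnj (w' x)))"
    unfolding pairing_dminus[OF v q] by simp
  have "m * W\<^sup>2 = norm (of_real m * pairing w q)"
    unfolding q_def pairing_cnj_self W_def using m by (simp add: norm_mult norm_power)
  also have "\<dots> \<le> norm (pairing g q) + norm (pairing v (dplus l q (\<lambda>x. cnj (w' x))))"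
    unfolding e using norm_triangle_ineq4[of "pairing g q" "\<i> * pairing v (dplus l q (\<lambda>x. cnj (w' x)))"]
    by (simp add: norm_mult)
  also have "\<dots> \<le> F * W + (K * F) * (F + m * (K * F) + 2 * R * W)"
  proof (rule add_mono)
    have "norm (pairing g q) \<le> l2norm g * l2norm q" by (rule pairing_bound[OF gh(1) in2(3)])
    also have "l2norm q = W" by (simp add: q_def W_def)
    also have "l2norm g * W \<le> F * W" using F W0 by (intro mult_right_mono)
    finally show "norm (pairing g q) \<le> F * W" .
    have "norm (pairing v (dplus l q (\<lambda>x. cnj (w' x)))) \<le> l2norm v * l2norm (dplus l q (\<lambda>x. cnj (w' x)))"
      by (rule pairing_bound[OF in2(1) in_l2_dplus[OF q]])
    also have "\<dots> \<le> (K * F) * (F + m * (K * F) + 2 * R * W)"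
      using vF nq K F by (intro mult_mono) auto
    finally show "norm (pairing v (dplus l q (\<lambda>x. cnj (w' x)))) \<le> (K * F) * (F + m * (K * F) + 2 * R * W)" .
  qed
  finally have main: "m * W\<^sup>2 \<le> F * W * (1 + 2 * R * K) + (K + m * K\<^sup>2) * (F * F)"
    by (simp add: power2_eq_square algebra_simps)
  have "W \<le> (1 + (1 + 2 * R * K + K) / m + K\<^sup>2) * F"
  \<comment> \<open>The summand 1 in the constant covers \<open>W \<le> F\<close>; otherwise
    \<open>F * F \<le> F * W\<close>, and the quadratic inequality can be divided by
    \<open>W\<close>.\<close>
  proof (cases "W \<le> F")
    case True
    have "1 * F \<le> (1 + (1 + 2 * R * K + K) / m + K\<^sup>2) * F"
      using F m K R by (intro mult_right_mono) auto
    with True show ?thesis by simp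
  next
    case False
    then have FW: "F \<le> W" "0 < W" using F by auto
    have "(K + m * K\<^sup>2) * (F * F) \<le> (K + m * K\<^sup>2) * (F * W)"
      using F FW K m by (intro mult_left_mono) auto
    with main have "m * W\<^sup>2 \<le> F * W * (1 + 2 * R * K) + (K + m * K\<^sup>2) * (F * W)" by linarith
    then have "W * (m * W) \<le> W * (F * (1 + 2 * R * K + K + m * K\<^sup>2))"
      by (simp add: power2_eq_square algebra_simps)
    then have "m * W \<le> F * (1 + 2 * R * K + K + m * K\<^sup>2)" using FW by simp
    then have "W \<le> F * ((1 + 2 * R * K + K) / m + K\<^sup>2)" using m by (simp add: field_simps)
    also have "\<dots> \<le> F * (1 + (1 + 2 * R * K + K) / m + K\<^sup>2)" using F by (intro mult_left_mono) auto
    finally show ?thesis by (simp add: mult.commute)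
  qed
  then show ?thesis by (simp add: W_def F_def g_def h_def)
qed

text \<open>Induction on the number \<open>k\<close> of ladder steps that lift \<open>a\<close> into
  the coercive range, each raising the squared mass by 2. The threshold \<open>a\<close> is
  quantified inside the induction because the hypothesis is applied at
  \<open>sqrt (a\<^sup>2 + 2)\<close>.\<close>

lemma uniform_bound:
  assumes R: "0 \<le> R" and a: "0 < a"
  shows "\<exists>B\<ge>0. \<forall>m\<ge>a. \<forall>l. \<bar>l\<bar> \<le> R \<longrightarrow> dirac_bound m l B"
proof -
  have "\<forall>a>0. (4 * R + 1)\<^sup>2 \<le> a\<^sup>2 + 2 * real k \<longrightarrow> (\<exists>B\<ge>0. \<forall>m\<ge>a. \<forall>l. \<bar>l\<bar> \<le> R \<longrightarrow> dirac_bound m l B)" for k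
  proof (induction k)
    case 0
    show ?case
    proof (intro allI impI)
      fix a :: real assume a: "0 < a" "(4 * R + 1)\<^sup>2 \<le> a\<^sup>2 + 2 * real 0"
      have aR: "4 * R + 1 \<le> a" by (rule power2_le_imp_le) (use a in simp_all)
      show "\<exists>B\<ge>0. \<forall>m\<ge>a. \<forall>l. \<bar>l\<bar> \<le> R \<longrightarrow> dirac_bound m l B"
      proof (intro exI[of _ 2] conjI allI impI)
        fix m l assume m: "a \<le> m" and l: "\<bar>l\<bar> \<le> R"
        have m1: "1 \<le> m" "4 * R \<le> m" using aR m R by auto
        have "1 / m * (1 + 4 * R / m) \<le> 1 * (1 + 1)"
          using m1 R by (intro mult_mono add_left_mono) auto
        then show "dirac_bound m l 2"
          using dirac_bound_mono[OF dirac_bound_large[OF m1 l]] by simp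
      qed simp
    qed
  next
    case (Suc k)
    show ?case
    proof (intro allI impI)
      fix a :: real assume a: "0 < a" "(4 * R + 1)\<^sup>2 \<le> a\<^sup>2 + 2 * real (Suc k)"
      have a2: "0 < a\<^sup>2 + 2" by (rule add_nonneg_pos) simp_all
      then have "0 < sqrt (a\<^sup>2 + 2)" "(sqrt (a\<^sup>2 + 2))\<^sup>2 = a\<^sup>2 + 2" by simp_all
      moreover from this(2) have "(4 * R + 1)\<^sup>2 \<le> (sqrt (a\<^sup>2 + 2))\<^sup>2 + 2 * real k"
        using a(2) by simp
      ultimately have "\<exists>B\<ge>0. \<forall>m\<ge>sqrt (a\<^sup>2 + 2). \<forall>l. \<bar>l\<bar> \<le> R \<longrightarrow> dirac_bound m l B"
        using Suc.IH by simp
      then obtain B where B: "0 \<le> B" "\<And>m l. sqrt (a\<^sup>2 + 2) \<le> m \<Longrightarrow> \<bar>l\<bar> \<le> R \<Longrightarrow> dirac_bound m l B"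
        by metis
      define K where "K = B * (4 + 2 * R)"
      have K: "0 \<le> K" using B R by (simp add: K_def)
      define C where "C = K + (1 + (1 + 2 * R * K + K) / a + K\<^sup>2)"
      have "0 \<le> C" using K R a by (simp add: C_def)
      moreover have "dirac_bound m l C" if m: "a \<le> m" and l: "\<bar>l\<bar> \<le> R" for m l
      proof (rule dirac_boundI)
        fix v v' w w' assume v: "wsob v v'" and w: "wsob w w'"
        have m0: "0 < m" using a m by simp
        have db: "dirac_bound (sqrt (m\<^sup>2 + 2)) l B"
          by (rule B(2)[OF _ l]) (use a m in \<open>simp add: power_mono\<close>)
        have 1: "l2norm v \<le> K * data_norm m l v v' w w'"
          unfolding K_def
        proof (rule ladder_v[OF m0 _ _ db B(1) l v w])
          have "0 < m\<^sup>2 + 2" by (rule add_nonneg_pos) simp_all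
          then show "(sqrt (m\<^sup>2 + 2))\<^sup>2 = m\<^sup>2 + 2" "0 < sqrt (m\<^sup>2 + 2)" by simp_all
        qed
        have "l2norm w \<le> (1 + (1 + 2 * R * K + K) / m + K\<^sup>2) * data_norm m l v v' w w'"
          by (rule bound_w_by_v[OF m0 l K v w 1])
        also have "\<dots> \<le> (1 + (1 + 2 * R * K + K) / a + K\<^sup>2) * data_norm m l v v' w w'"
          using m a K R by (intro mult_right_mono add_mono divide_left_mono) (auto simp: pair_norm_bounds)
        finally have "l2norm v + l2norm w \<le> C * data_norm m l v v' w w'"
          using 1 by (simp add: C_def distrib_right)
        then show "pair_norm v w \<le> C * data_norm m l v v' w w'"
          using pair_norm_bounds(4)[of v w] by linarith
      qed
      ultimately show "\<exists>B\<ge>0. \<forall>m\<ge>a. \<forall>l. \<bar>l\<bar> \<le> R \<longrightarrow> dirac_bound m l B" by blast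
    qed
  qed
  moreover obtain k :: nat where "(4 * R + 1)\<^sup>2 \<le> real k" using real_arch_simple by blast
  then have "(4 * R + 1)\<^sup>2 \<le> a\<^sup>2 + 2 * real k"
    using zero_le_power2[of a] by linarith
  ultimately show ?thesis using a by blast
qed

section \<open>Small mass and the final estimates\<close>

text \<open>Splitting off the multiple of the kernel element \<open>gauss l\<close> of \<open>D\<^sub>+\<close> that agrees with \<open>w\<close> at \<open>0\<close>
  leaves a function that is controlled by \<open>D\<^sub>+ w\<close>; the multiple itself is read off the pairing of the first
  equation with \<open>gauss l\<close>, which \<open>D\<^sub>-\<close> annihilates.\<close>

lemma kernel_decomposition:
  assumes m: "0 < m" and v: "wsob v v'" and w: "wsob w w'"
    and F: "F = data_norm m l v v' w w'"
  obtains c Q where "0 \<le> Q" "Q \<le> 6 * (F + m * l2norm v)"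
    "l2norm w \<le> Q + norm c * l2norm (gauss l)" "norm c * l2norm (gauss l) \<le> l2norm w + Q"
    "norm (of_real m * c * of_real (sqrt pi) - pairing (gauss l) (op1 m l v v' w)) \<le> m * (l2norm (gauss l) * Q)"
    "l2norm v \<le> F + m * l2norm w"
proof -
  define g where "g = op1 m l v v' w"
  define h where "h = op2 m l v w w'"
  have gh: "in_l2 g" "in_l2 h" unfolding g_def h_def using v w by auto
  have F': "l2norm g \<le> F" "l2norm h \<le> F" by (simp_all add: F g_def h_def pair_norm_bounds)
  let ?p = "gauss l" and ?p' = "\<lambda>x. - (zeta l x * gauss l x)"
  define c where "c = w 0 / gauss l 0"
  define q where "q = (\<lambda>x. w x - c * gauss l x)"
  define q' where "q' = (\<lambda>x. w' x - c * ?p' x)"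
  have q: "wsob q q'" unfolding q_def q'_def by (intro wsob_diff w wsob_cmult wsob_gauss)
  have q0: "q 0 = 0" by (simp add: q_def c_def gauss_def)
  note in2 = wsobD(1)[OF v] wsobD(1)[OF w] wsobD(1)[OF q] wsobD(1)[OF wsob_gauss[of l]]
  have Dq: "dplus l q q' = dplus l w w'"
    by (simp add: dplus_def q_def q'_def fun_eq_iff algebra_simps)
  have "l2norm (dplus l w w') \<le> F + m * l2norm v"
    using l2norm_dplus_le[OF v w m, of l] F' unfolding h_def by linarith
  then have Q: "l2norm q \<le> 6 * (F + m * l2norm v)"
    using l2norm_le_dplus[OF q q0, of l] unfolding Dq by argo
  have w1: "l2norm w \<le> l2norm q + norm c * l2norm ?p"
    using l2norm_triangle[OF in2(3) in_l2_cmult[OF in2(4)], of c] by (simp add: q_def)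
  have w2: "norm c * l2norm ?p \<le> l2norm w + l2norm q"
    using l2norm_diff_triangle[OF in2(2,3)] by (simp add: q_def)
  have "pairing ?p g = - \<i> * pairing ?p (dminus l v v') + of_real m * pairing ?p w"
    unfolding g_def op1_def
    by (simp only: pairing_add_right[OF in_l2_cmult[OF in_l2_dminus[OF v]] in_l2_cmult[OF in2(2)] in2(4)] pairing_cmult_right)
  also have "pairing ?p (dminus l v v') = 0"
    using pairing_dplus[OF wsob_gauss v, of l l] unfolding dplus_gauss by (simp add: pairing_def)
  also have "pairing ?p w = pairing ?p q + c * of_real (sqrt pi)"
    using pairing_add_right[OF in2(3) in_l2_cmult[OF in2(4)] in2(4), of c] by (simp add: q_def pairing_gauss)
  finally have "of_real m * c * of_real (sqrt pi) - pairing ?p g = - (of_real m * pairing ?p q)"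
    by (simp add: algebra_simps)
  then have "norm (of_real m * c * of_real (sqrt pi) - pairing ?p g) = m * norm (pairing ?p q)"
    using m by (simp only: norm_minus_cancel norm_mult norm_of_real abs_of_pos)
  also have "\<dots> \<le> m * (l2norm ?p * l2norm q)"
    using m pairing_bound[OF in2(4,3)] by (intro mult_left_mono) auto
  finally have pr: "norm (of_real m * c * of_real (sqrt pi) - pairing ?p g) \<le> m * (l2norm ?p * l2norm q)" .
  \<comment> \<open>\<open>D\<^sub>-\<close> is bounded below by 1 for every \<open>l\<close>, so
    the first equation alone controls \<open>v\<close> in terms of \<open>F\<close> and
    \<open>w\<close>.\<close>
  have "dminus l v v' = (\<lambda>x. \<i> * g x - (\<i> * of_real m) * w x)"
    by (simp add: g_def op1_def fun_eq_iff algebra_simps)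
  then have "l2norm (dminus l v v') \<le> l2norm (\<lambda>x. \<i> * g x) + l2norm (\<lambda>x. (\<i> * of_real m) * w x)"
    by (simp only: l2norm_diff_triangle[OF in_l2_cmult[OF gh(1)] in_l2_cmult[OF in2(2)]])
  also have "\<dots> = l2norm g + m * l2norm w"
    unfolding l2norm_cmult using m by (simp add: norm_mult)
  finally have "l2norm v \<le> F + m * l2norm w"
    using l2norm_le_dminus[OF v, of l] F' by linarith
  then show ?thesis using that[of "l2norm q" c] Q w1 w2 pr by (simp add: g_def)
qed

lemma l2norm_gauss_pos: "0 < l2norm (gauss l)"
proof -
  have "0 < (l2norm (gauss l))\<^sup>2" by (simp add: l2norm_gauss)
  then show ?thesis by (simp add: order.strict_iff_order)
qed

text \<open>The leading term \<open>E * F / m\<close> comes from the multiple of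
  \<open>gauss l\<close> in \<open>w\<close>. The function \<open>v\<close> and the rest of
  \<open>w\<close> are bounded by multiples of \<open>F + m * N\<close>, and after multiplication by
  \<open>m\<close> their share of \<open>m * N\<close> is small enough to be absorbed on the
  left.\<close>

lemma dirac_bound_small:
  assumes m: "0 < m" "m \<le> 1 / (26 * exp (R\<^sup>2))" and l: "\<bar>l\<bar> \<le> R"
  shows "dirac_bound m l (exp (l\<^sup>2) / m * (1 + 52 * exp (R\<^sup>2) * m))"
proof (rule dirac_boundI)
  fix v v' w w' assume v: "wsob v v'" and w: "wsob w w'"
  define F where "F = data_norm m l v v' w w'"
  define N where "N = pair_norm v w"
  define E where "E = exp (l\<^sup>2)"
  define E0 where "E0 = exp (R\<^sup>2)"
  define p where "p = l2norm (gauss l)"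
  have "l\<^sup>2 \<le> R\<^sup>2" using l by (simp add: abs_le_square_iff[symmetric])
  then have E: "1 \<le> E" "E \<le> E0" by (auto simp: E_def E0_def)
  have F0: "0 \<le> F" and N0: "0 \<le> N" "l2norm v \<le> N" "l2norm w \<le> N" "N \<le> l2norm v + l2norm w"
    by (simp_all add: F_def N_def pair_norm_bounds)
  have p: "0 < p" "p * p = E * sqrt pi"
    using l2norm_gauss_pos[of l] l2norm_gauss[of l] by (simp_all add: p_def E_def power2_eq_square)
  obtain c Q where Q: "0 \<le> Q" "Q \<le> 6 * (F + m * l2norm v)" "l2norm w \<le> Q + norm c * p"
    and c: "norm (of_real m * c * of_real (sqrt pi) - pairing (gauss l) (op1 m l v v' w)) \<le> m * (p * Q)"
    and v1: "l2norm v \<le> F + m * l2norm w"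
    using kernel_decomposition[OF m(1) v w F_def] unfolding p_def by metis
  define X where "X = norm c * p"
  have "norm (of_real m * c * of_real (sqrt pi)) \<le> p * F + m * (p * Q)"
  proof -
    have "norm (pairing (gauss l) (op1 m l v v' w)) \<le> p * l2norm (op1 m l v v' w)"
      unfolding p_def by (rule pairing_bound[OF wsobD(1)[OF wsob_gauss] in_l2_op(1)[OF v w]])
    also have "\<dots> \<le> p * F" using p by (intro mult_left_mono) (auto simp: F_def pair_norm_bounds)
    finally show ?thesis
      using c norm_triangle_sub[of "of_real m * c * of_real (sqrt pi)" "pairing (gauss l) (op1 m l v v' w)"] by linarith
  qed
  then have "m * norm c * sqrt pi \<le> p * (F + m * Q)" using m by (simp add: norm_mult algebra_simps)
  \<comment> \<open>One factor \<open>p\<close> stems from pairing with \<open>gauss l\<close>, the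
    other from the size of the multiple of \<open>gauss l\<close>. As
    \<open>p * p = E * sqrt pi\<close>, the root of pi cancels and exactly \<open>E\<close> remains
    as leading coefficient.\<close>
  then have "p * (m * norm c * sqrt pi) \<le> p * (p * (F + m * Q))" using p by (intro mult_left_mono) auto
  then have "sqrt pi * (m * X) \<le> sqrt pi * (E * (F + m * Q))"
    unfolding mult.assoc[of p p, symmetric] p(2) X_def by (simp add: mult_ac)
  then have mX: "m * X \<le> E * (F + m * Q)" by simp
  have mv: "m * l2norm v \<le> m * (F + m * N)"
    using v1 mult_left_mono[OF N0(3), of m] m by (intro mult_left_mono) linarith+
  have mQ: "m * Q \<le> 6 * (m * F) + 6 * (m * (m * N))"
  proof -
    have "m * l2norm v \<le> m * N" using N0 m by (intro mult_left_mono) auto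
    with Q(2) have "Q \<le> 6 * F + 6 * (m * N)" by argo
    then have "m * Q \<le> m * (6 * F + 6 * (m * N))" using m by (intro mult_left_mono) auto
    then show ?thesis by (simp add: algebra_simps)
  qed
  \<comment> \<open>\<open>Z\<close> gathers the corrections. Its total coefficient is at most
    \<open>1 + 6 * (1 + E)\<close>, and \<open>1 \<le> E\<close> bounds this by
    \<open>13 * E\<close>.\<close>
  define Z where "Z = m * F + m * (m * N)"
  have Z0: "0 \<le> Z" using m F0 N0 by (simp add: Z_def)
  have "m * N \<le> m * (l2norm v + l2norm w)" using N0 m by (intro mult_left_mono) auto
  also have "\<dots> \<le> m * (F + m * N) + m * (Q + X)"
    using mv Q(3) m unfolding X_def distrib_left[of m "l2norm v"] by (intro add_mono mult_left_mono) auto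
  also have "\<dots> \<le> Z + m * Q + E * (F + m * Q)"
    using mX by (simp add: Z_def algebra_simps)
  also have "\<dots> = Z + E * F + (1 + E) * (m * Q)" by (simp add: algebra_simps)
  also have "\<dots> \<le> Z + E * F + (1 + E) * (6 * Z)"
    using mQ E by (intro add_left_mono mult_left_mono) (auto simp: Z_def)
  also have "\<dots> \<le> E * Z + E * F + (E + E) * (6 * Z)"
    using E Z0 mult_right_mono[OF E(1) Z0] by (intro add_mono mult_right_mono order_refl) auto
  also have "\<dots> = E * F * (1 + 13 * m) + 13 * E * m * (m * N)"
    by (simp add: Z_def algebra_simps)
  also have "\<dots> \<le> E * F * (1 + 13 * m) + 13 * E0 * m * (m * N)"
    using E m N0 by (intro add_left_mono mult_right_mono) auto
  finally have main: "(m * N) * (1 - 13 * E0 * m) \<le> E * F * (1 + 13 * m)" by (simp add: algebra_simps)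
  \<comment> \<open>The 26 of the hypothesis is \<open>2 * 13\<close>: it makes
    \<open>s \<le> 1 / 2\<close>, where \<open>1 / (1 - s) \<le> 1 + 2 * s\<close>. With
    \<open>13 * m \<le> s\<close> and \<open>(1 + s) * (1 + 2 * s) \<le> 1 + 4 * s\<close> this
    leads to the constant \<open>52 = 4 * 13\<close>.\<close>
  define s where "s = 13 * E0 * m"
  have E0: "1 \<le> E0" using E by linarith
  have s: "0 \<le> s" "s \<le> 1 / 2"
    using m E0 by (auto simp: s_def E0_def[symmetric] field_simps)
  have "s * s \<le> 1 / 2 * s" using s by (intro mult_right_mono) auto
  then have "1 \<le> (1 - s) * (1 + 2 * s)" by (simp add: algebra_simps)
  then have "(m * N) * 1 \<le> (m * N) * ((1 - s) * (1 + 2 * s))" using m N0 by (intro mult_left_mono) auto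
  also have "\<dots> = (m * N) * (1 - s) * (1 + 2 * s)" by simp
  also have "\<dots> \<le> E * F * (1 + 13 * m) * (1 + 2 * s)"
    using main s by (intro mult_right_mono) (auto simp: s_def)
  also have "\<dots> \<le> E * F * (1 + 4 * s)"
  proof -
    have "13 * m * 1 \<le> 13 * m * E0" using m E0 by (intro mult_left_mono) auto
    then have "13 * m \<le> s" by (simp add: s_def mult_ac)
    then have "(1 + 13 * m) * (1 + 2 * s) \<le> (1 + s) * (1 + 2 * s)" using s by (intro mult_right_mono) auto
    also have "\<dots> \<le> 1 + 4 * s" using \<open>s * s \<le> 1 / 2 * s\<close> by (simp add: algebra_simps)
    finally have "E * F * ((1 + 13 * m) * (1 + 2 * s)) \<le> E * F * (1 + 4 * s)"
      using E F0 by (intro mult_left_mono) auto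
    then show ?thesis by (simp add: mult.assoc)
  qed
  finally have "N \<le> E * F * (1 + 4 * s) / m" using m by (simp add: field_simps)
  then show "pair_norm v w \<le> exp (l\<^sup>2) / m * (1 + 52 * exp (R\<^sup>2) * m) * data_norm m l v v' w w'"
    by (simp add: N_def E_def F_def s_def E0_def mult_ac)
qed

text \<open>The data \<open>(cnj (gauss l), 0)\<close> give equality in the Cauchy-Schwarz
  inequality for the pairing with \<open>gauss l\<close>. Their solution therefore attains the
  leading term of the upper bound up to a relative error of order \<open>m\<close>.\<close>

lemma resolvent_norm_lower_small:
  assumes m: "0 < m" "m \<le> 1 / (26 * exp (R\<^sup>2))" and l: "\<bar>l\<bar> \<le> R"
  shows "exp (l\<^sup>2) / m * (1 - 48 * exp (R\<^sup>2) * m) \<le> resolvent_norm m l"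
proof -
  define E where "E = exp (l\<^sup>2)"
  define E0 where "E0 = exp (R\<^sup>2)"
  define p where "p = l2norm (gauss l)"
  have "l\<^sup>2 \<le> R\<^sup>2" using l by (simp add: abs_le_square_iff[symmetric])
  then have E: "1 \<le> E" "E \<le> E0" by (auto simp: E_def E0_def)
  have p: "0 < p" "p * p = E * sqrt pi"
    using l2norm_gauss_pos[of l] l2norm_gauss[of l] by (simp_all add: p_def E_def power2_eq_square)
  define B where "B = E / m * (1 + 52 * E0 * m)"
  have db: "dirac_bound m l B"
    using dirac_bound_small[OF m l] by (simp add: B_def E_def E0_def)
  have B0: "0 \<le> B" using m E by (simp add: B_def)
  have pg: "in_l2 (gauss l)" by (rule wsobD(1)[OF wsob_gauss])
  obtain v v' w w' where v: "wsob v v'" and w: "wsob w w'"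
    and e: "AE x in lborel. op1 m l v v' w x = cnj (gauss l x)" "AE x in lborel. op2 m l v w w' x = 0"
    using dirac_solve[OF db in_l2_cnj[OF pg] in_l2_zero] by metis
  define N where "N = pair_norm v w"
  define F where "F = data_norm m l v v' w w'"
  have Fp: "F = p"
    unfolding F_def pair_norm_def
    using l2norm_cong_AE[OF in_l2_op(1)[OF v w] in_l2_cnj[OF pg] e(1)] l2norm_cong_AE[OF in_l2_op(2)[OF v w] in_l2_zero e(2)]
    by (simp add: p_def l2norm_def[of "\<lambda>x. 0"])
  have N0: "0 \<le> N" "l2norm v \<le> N" "l2norm w \<le> N" by (simp_all add: N_def pair_norm_bounds)
  have "pairing (gauss l) (op1 m l v v' w) = pairing (gauss l) (\<lambda>x. cnj (gauss l x))"
    using pairing_cong_AE[OF in_l2_op(1)[OF v w] in_l2_cnj[OF pg] pg e(1)] by (simp only: pairing_commute)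
  then have pg2: "pairing (gauss l) (op1 m l v v' w) = of_real (p * p)"
    by (simp only: pairing_cnj_self p_def power2_eq_square)
  obtain c Q where Q: "0 \<le> Q" "Q \<le> 6 * (F + m * l2norm v)" "norm c * p \<le> l2norm w + Q"
    and c: "norm (of_real m * c * of_real (sqrt pi) - pairing (gauss l) (op1 m l v v' w)) \<le> m * (p * Q)"
    using kernel_decomposition[OF m(1) v w F_def] unfolding p_def by metis
  have "p * p \<le> norm (of_real m * c * of_real (sqrt pi)) + m * (p * Q)"
    using c norm_triangle_ineq2[of "complex_of_real (p * p)" "of_real m * c * of_real (sqrt pi)"] p
      E m unfolding pg2 by (simp add: norm_minus_commute norm_mult)
  then have "p * (p * p) \<le> p * (m * norm c * sqrt pi + m * (p * Q))"
    using p m by (intro mult_left_mono) (auto simp: norm_mult)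
  then have "sqrt pi * (E * p) \<le> sqrt pi * (m * (norm c * p) + m * (E * Q))"
    using p(2) by (simp add: algebra_simps)
  then have "E * p \<le> m * (norm c * p) + m * (E * Q)" by simp
  also have "m * (norm c * p) \<le> m * (N + Q)" using Q(3) N0 m by (intro mult_left_mono) auto
  finally have 1: "E * p \<le> m * N + (1 + E) * (m * Q)" by (simp add: algebra_simps)
  have "N \<le> B * F" unfolding N_def F_def by (rule dirac_boundD[OF db v w])
  then have "m * N \<le> m * (B * F)" using m by (intro mult_left_mono) auto
  also have "\<dots> = E * p * (1 + 52 * E0 * m)" using m by (simp add: B_def Fp)
  also have "\<dots> \<le> E * p * 3"
    using m E p by (intro mult_left_mono) (auto simp: E0_def[symmetric] field_simps)
  finally have mN: "m * N \<le> 3 * (E * p)" by simp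
  have "m * l2norm v \<le> m * N" using N0 m by (intro mult_left_mono) auto
  \<comment> \<open>The upper bound enters only here, in the error, where its crude form
    \<open>m * N \<le> 3 * (E * p)\<close> is enough. The total \<open>6 + 18 = 24\<close> is
    doubled by \<open>1 + E \<le> 2 * E0\<close>, which is the origin of 48.\<close>
  with Q(2) mN have "Q \<le> 6 * p + 18 * (E * p)" unfolding Fp by argo
  also have "\<dots> \<le> 24 * (E * p)" using mult_right_mono[OF E(1), of p] p by simp
  finally have "(1 + E) * (m * Q) \<le> (E0 + E0) * (m * (24 * (E * p)))"
    using E m Q(1) by (intro mult_mono mult_left_mono) auto
  with 1 have "E * p * (1 - 48 * E0 * m) \<le> m * N" by (simp add: algebra_simps)
  also have "m * N \<le> m * (resolvent_norm m l * p)"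
    using resolvent_normD[OF db B0 v w] m unfolding N_def Fp[symmetric] F_def by (intro mult_left_mono) auto
  finally have "p * (E * (1 - 48 * E0 * m)) \<le> p * (m * resolvent_norm m l)" by (simp add: mult_ac)
  then have "E * (1 - 48 * E0 * m) \<le> m * resolvent_norm m l" using p by simp
  then show ?thesis using m by (simp add: E_def E0_def field_simps)
qed

text \<open>The pair \<open>(v, w) = (0, gauss l)\<close> is mapped to \<open>(m gauss l, 0)\<close>.\<close>

lemma resolvent_norm_ge:
  assumes m: "0 < m" and b: "dirac_bound m l B" "0 \<le> B"
  shows "1 / m \<le> resolvent_norm m l"
proof -
  let ?p = "gauss l" and ?p' = "\<lambda>x. - (zeta l x * gauss l x)"
  have z: "wsob (\<lambda>x. 0) (\<lambda>x. 0)" using wsob_cmult[OF wsob_gauss, of 0] by simp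
  have e: "op1 m l (\<lambda>x. 0) (\<lambda>x. 0) ?p = (\<lambda>x. of_real m * gauss l x)" "op2 m l (\<lambda>x. 0) ?p ?p' = (\<lambda>x. 0)"
    by (simp_all add: op1_def op2_def dminus_def dplus_def fun_eq_iff)
  have "pair_norm (\<lambda>x. 0) ?p \<le> resolvent_norm m l * data_norm m l (\<lambda>x. 0) (\<lambda>x. 0) ?p ?p'"
    by (rule resolvent_normD[OF b z wsob_gauss])
  moreover have "pair_norm (\<lambda>x. 0) ?p = l2norm ?p" by (simp add: pair_norm_def l2norm_def[of "\<lambda>x. 0"])
  moreover have "data_norm m l (\<lambda>x. 0) (\<lambda>x. 0) ?p ?p' = m * l2norm ?p"
    unfolding e using m by (simp add: pair_norm_def l2norm_def[of "\<lambda>x. 0"])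
  ultimately have "l2norm ?p * 1 \<le> l2norm ?p * (m * resolvent_norm m l)" by (simp add: mult_ac)
  then have "1 \<le> m * resolvent_norm m l" using l2norm_gauss_pos[of l] by simp
  then show ?thesis using m by (simp add: field_simps)
qed

theorem theorem2p5:
  fixes R :: real
  assumes "R > 0"
  shows
    "(\<forall>m>0. \<forall>l\<in>{-R..R}. boundedly_invertible dom_airy_dirac (airy_dirac_shift m l)) \<and>
     (\<exists>C>0. \<forall>\<^sub>F m in at_right 0. \<forall>l\<in>{-R..R}.
        \<exists>r. \<bar>r\<bar> \<le> C * m \<and> resolvent_norm m l = exp (l\<^sup>2) / m * (1 + r)) \<and>
     (\<forall>m1 m2. 0 < m1 \<and> m1 < m2 \<longrightarrow>
        (\<exists>C>0. \<forall>m\<in>{m1..m2}. \<forall>l\<in>{-R..R}.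
           inverse C \<le> resolvent_norm m l \<and> resolvent_norm m l \<le> C)) \<and>
     (\<exists>C>0. \<forall>\<^sub>F m in at_top. \<forall>l\<in>{-R..R}.
        \<exists>r. \<bar>r\<bar> \<le> C * inverse m \<and> resolvent_norm m l = 1 / m * (1 + r)) \<and>
     (\<exists>C>0. \<forall>m>0. \<forall>l\<in>{-R..R}.
        inverse C * (1 / m) \<le> resolvent_norm m l \<and> resolvent_norm m l \<le> C * (1 / m))"
proof -
  define E0 where "E0 = exp (R\<^sup>2)"
  have E0: "1 \<le> E0" by (simp add: E0_def)
  define m0 where "m0 = 1 / (26 * E0)"
  have m0: "0 < m0" using E0 by (simp add: m0_def)
  have bdd: "\<exists>B\<ge>0. \<forall>m\<ge>a. \<forall>l. \<bar>l\<bar> \<le> R \<longrightarrow> dirac_bound m l B" if "a > 0" for a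
    using uniform_bound[OF _ that] assms by simp
  have inv: "boundedly_invertible dom_airy_dirac (airy_dirac_shift m l)"
    and ge: "1 / m \<le> resolvent_norm m l" if m: "m > 0" and l: "\<bar>l\<bar> \<le> R" for m l
  proof -
    obtain B where B: "dirac_bound m l B" "0 \<le> B" using bdd[OF m] l by blast
    show "boundedly_invertible dom_airy_dirac (airy_dirac_shift m l)" by (rule dirac_inverse(1)[OF B])
    show "1 / m \<le> resolvent_norm m l" by (rule resolvent_norm_ge[OF m B])
  qed
  have large: "resolvent_norm m l \<le> 1 / m * (1 + 4 * R / m)" if "1 \<le> m" "4 * R \<le> m" "\<bar>l\<bar> \<le> R" for m l
    using dirac_inverse(2)[OF dirac_bound_large[OF that]] that assms by simp
  have small: "resolvent_norm m l \<le> exp (l\<^sup>2) / m * (1 + 52 * E0 * m)" "exp (l\<^sup>2) / m * (1 - 48 * E0 * m) \<le> resolvent_norm m l"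
    if "0 < m" "m \<le> m0" "\<bar>l\<bar> \<le> R" for m l
    using dirac_inverse(2)[OF dirac_bound_small[OF that(1) _ that(3)]] resolvent_norm_lower_small[OF that(1) _ that(3)] that
    by (simp_all add: E0_def m0_def)
  have 1: "\<forall>m>0. \<forall>l\<in>{-R..R}. boundedly_invertible dom_airy_dirac (airy_dirac_shift m l)"
    using inv by (simp add: abs_le_iff)
  have 2: "\<exists>C>0. \<forall>\<^sub>F m in at_right 0. \<forall>l\<in>{-R..R}.
        \<exists>r. \<bar>r\<bar> \<le> C * m \<and> resolvent_norm m l = exp (l\<^sup>2) / m * (1 + r)"
  proof (intro exI[of _ "52 * E0"] conjI)
    have "\<exists>r. \<bar>r\<bar> \<le> 52 * E0 * m \<and> resolvent_norm m l = exp (l\<^sup>2) / m * (1 + r)"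
      if m: "0 < m" "m < m0" and l: "l \<in> {-R..R}" for m l
    proof (intro exI[of _ "resolvent_norm m l * m / exp (l\<^sup>2) - 1"] conjI)
      have "resolvent_norm m l * m / exp (l\<^sup>2) \<le> 1 + 52 * E0 * m" "1 - 48 * E0 * m \<le> resolvent_norm m l * m / exp (l\<^sup>2)"
        using small[of m l] m l by (auto simp: field_simps abs_le_iff)
      \<comment> \<open>The deviations above and below carry 52 and 48; the larger one serves for
        both.\<close>
      moreover have "0 < E0 * m" using E0 m by simp
      ultimately show "\<bar>resolvent_norm m l * m / exp (l\<^sup>2) - 1\<bar> \<le> 52 * E0 * m" by (simp add: abs_le_iff)
      show "resolvent_norm m l = exp (l\<^sup>2) / m * (1 + (resolvent_norm m l * m / exp (l\<^sup>2) - 1))"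
        using m by simp
    qed
    then show "\<forall>\<^sub>F m in at_right 0. \<forall>l\<in>{-R..R}.
        \<exists>r. \<bar>r\<bar> \<le> 52 * E0 * m \<and> resolvent_norm m l = exp (l\<^sup>2) / m * (1 + r)"
      unfolding eventually_at_right_field using m0 by blast
  qed (use E0 in simp)
  have 3: "\<exists>C>0. \<forall>m\<in>{m1..m2}. \<forall>l\<in>{-R..R}. inverse C \<le> resolvent_norm m l \<and> resolvent_norm m l \<le> C"
    if m12: "0 < m1" "m1 < m2" for m1 m2
  proof -
    obtain B where B: "0 \<le> B" "\<And>m l. m1 \<le> m \<Longrightarrow> \<bar>l\<bar> \<le> R \<Longrightarrow> dirac_bound m l B"
      using bdd[OF m12(1)] by blast
    \<comment> \<open>The summand \<open>B\<close> takes care of the upper bound and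
      \<open>m2\<close> of the lower one, since \<open>1 / m \<ge> 1 / m2\<close>; the sum is
      positive even if \<open>B\<close> is zero.\<close>
    have "inverse (B + m2) \<le> resolvent_norm m l \<and> resolvent_norm m l \<le> B + m2"
      if "m \<in> {m1..m2}" "l \<in> {-R..R}" for m l
    proof
      have "inverse (B + m2) \<le> 1 / m"
        unfolding inverse_eq_divide using that m12 B by (intro divide_left_mono) auto
      then show "inverse (B + m2) \<le> resolvent_norm m l"
        using ge[of m l] that m12 by (simp add: abs_le_iff)
      show "resolvent_norm m l \<le> B + m2"
        using dirac_inverse(2)[OF B(2) B(1), of m l] that m12 by (simp add: abs_le_iff)
    qed
    then show ?thesis using m12 B by (intro exI[of _ "B + m2"]) auto
  qed
  have 4: "\<exists>C>0. \<forall>\<^sub>F m in at_top. \<forall>l\<in>{-R..R}.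
        \<exists>r. \<bar>r\<bar> \<le> C * inverse m \<and> resolvent_norm m l = 1 / m * (1 + r)"
  proof (intro exI[of _ "4 * R"] conjI)
    have "\<exists>r. \<bar>r\<bar> \<le> 4 * R * inverse m \<and> resolvent_norm m l = 1 / m * (1 + r)"
      if m: "max 1 (4 * R) \<le> m" and l: "l \<in> {-R..R}" for m l
    proof (intro exI[of _ "resolvent_norm m l * m - 1"] conjI)
      have m1: "1 \<le> m" "4 * R \<le> m" "0 < m" using m by auto
      have "resolvent_norm m l * m \<le> 1 + 4 * R / m" "1 \<le> resolvent_norm m l * m"
        using large[OF m1(1,2), of l] ge[OF m1(3), of l] l m1(3) by (auto simp: field_simps abs_le_iff)
      then show "\<bar>resolvent_norm m l * m - 1\<bar> \<le> 4 * R * inverse m" by (simp add: divide_inverse)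
      show "resolvent_norm m l = 1 / m * (1 + (resolvent_norm m l * m - 1))" using m1 by simp
    qed
    then show "\<forall>\<^sub>F m in at_top. \<forall>l\<in>{-R..R}. \<exists>r. \<bar>r\<bar> \<le> 4 * R * inverse m \<and> resolvent_norm m l = 1 / m * (1 + r)"
      unfolding eventually_at_top_linorder by blast
  qed (use assms in simp)
  have 5: "\<exists>C>0. \<forall>m>0. \<forall>l\<in>{-R..R}.
        inverse C * (1 / m) \<le> resolvent_norm m l \<and> resolvent_norm m l \<le> C * (1 / m)"
  proof -
    obtain B where B: "0 \<le> B" "\<And>m l. m0 \<le> m \<Longrightarrow> \<bar>l\<bar> \<le> R \<Longrightarrow> dirac_bound m l B"
      using bdd[OF m0] by blast
    \<comment> \<open>Three ranges make up the constant: up to \<open>m0\<close> the small-mass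
      bound contributes \<open>3 * E0\<close>, between \<open>m0\<close> and \<open>M\<close> the
      uniform bound contributes \<open>B * M\<close>, and beyond \<open>M\<close> the large-mass
      bound contributes 2.\<close>
    define M where "M = max 1 (4 * R)"
    define C where "C = 3 * E0 + B * M + 2"
    have BM: "0 \<le> B * M" using B by (simp add: M_def)
    have C: "1 \<le> C" "3 * E0 \<le> C" "B * M \<le> C" "2 \<le> C" using BM E0 by (auto simp: C_def)
    have "inverse C * (1 / m) \<le> resolvent_norm m l \<and> resolvent_norm m l \<le> C * (1 / m)"
      if m: "0 < m" and "l \<in> {-R..R}" for m l
    proof
      have l: "\<bar>l\<bar> \<le> R" using that by auto
      have "inverse C * (1 / m) \<le> 1 * (1 / m)"
        using C m by (intro mult_right_mono) (auto simp: inverse_le_1_iff)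
      with ge[OF m l] show "inverse C * (1 / m) \<le> resolvent_norm m l" by simp
      have "resolvent_norm m l * m \<le> C"
      proof (cases "m \<le> m0")
        case True
        have "52 * E0 * m \<le> 2" using True E0 by (simp add: m0_def field_simps)
        moreover have "exp (l\<^sup>2) \<le> E0" using l by (simp add: E0_def abs_le_square_iff[symmetric])
        ultimately have "exp (l\<^sup>2) * (1 + 52 * E0 * m) \<le> E0 * 3"
          using E0 m by (intro mult_mono) auto
        moreover have "resolvent_norm m l * m \<le> exp (l\<^sup>2) * (1 + 52 * E0 * m)"
          using small(1)[OF m True l] m by (simp add: field_simps)
        ultimately show ?thesis using C by linarith
      next
        case False
        show ?thesis
        proof (cases "m \<le> M")
          case True
          have "resolvent_norm m l \<le> B" using dirac_inverse(2)[OF B(2) B(1), of m l] False l by simp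
          then have "resolvent_norm m l * m \<le> B * M" using True m B by (intro mult_mono) auto
          with C show ?thesis by linarith
        next
          case False
          then have m1: "1 \<le> m" "4 * R \<le> m" by (auto simp: M_def)
          have "resolvent_norm m l * m \<le> 1 + 4 * R / m"
            using large[OF m1 l] m by (simp add: field_simps)
          also have "\<dots> \<le> 2" using m1 m by simp
          finally show ?thesis using C by linarith
        qed
      qed
      then show "resolvent_norm m l \<le> C * (1 / m)" using m by (simp add: field_simps)
    qed
    moreover have "0 < C" using C by simp
    ultimately show ?thesis by blast
  qed
  show ?thesis using 1 2 3 4 5 by blast
qed

end
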